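(* Consider, for each $n$, a graph $G=G_n$ on the vertex set $\{1,\dots,n\}$ and let $k=k_n$ satisfy $|G_n| \asymp k_n n$. Assume that $k_n$ is at least of order $1$ (i.e. $k_n \succsim 1$) and that $\sum_{i=1}^n |G_i|^2 = o(k_n n^2)$. Then, under the permutation null distribution, the sequence (indexed by $n$) of stochastic processes $\{Z_w(\lfloor nu\rfloor): 0<u<1\}$ is tight on the space $D[0+\epsilon,1-\epsilon]$, for any positive constant $\epsilon$.
   Context: Setting: observations $\mathbf{y}_1,\dots,\mathbf{y}_n$ are the nodes of a similarity graph $G$ (we use $G$ both for the graph and its edge set, so $|G|$ is the number of edges). $G_i$ denotes the subgraph of $G$ consisting of all edges incident to node $i$, so $|G_i|$ is the degree of node $i$. Permutation null distribution: the graph is fixed and the order (time labels) of the observations is a uniformly random permutation of $\{1,\dots,n\}$; all expectations, variances and probabilities are with respect to this randomness. For $t\in\{1,\dots,n-1\}$, let $g_i(t)=I_{i>t}$ (indicator that observation $i$ is observed after time $t$, in the permuted order). For an edge $e=(i,j)$, $J_e(t)=0$ if $g_i(t)\ne g_j(t)$, $J_e(t)=1$ if $g_i(t)=g_j(t)=0$, $J_e(t)=2$ if $g_i(t)=g_j(t)=1$. Let $R_1(t)=\sum_{e\in G} I_{J_e(t)=1}$ and $R_2(t)=\sum_{e\in G} I_{J_e(t)=2}$. Define $p(t)=\frac{n-t-1}{n-2}$, $q(t)=\frac{t-1}{n-2}$, $R_w(t)=p(t)R_1(t)+q(t)R_2(t)$, and $Z_w(t)=\frac{R_w(t)-\mathbf{E}(R_w(t))}{\sqrt{\mathrm{Var}(R_w(t))}}$.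 $D[a,b]$ is the space of real functions on $[a,b]$ that are right-continuous with left-hand limits (cadlag). Notation: $f_n\precsim g_n$ means $f_n$ is bounded above by a constant times $g_n$ asymptotically; $f_n\asymp g_n$ means bounded above and below; $f_n=o(g_n)$ means $f_n/g_n\to 0$. *)

theory Defs
  imports "HOL-Analysis.Analysis" "HOL-Library.Landau_Symbols" "HOL-Combinatorics.Permutations"
begin

text \<open>Cadlag functions on [a,b]; to make the Skorokhod distance a genuine metric we
  normalise the functions to be 0 outside [a,b].\<close>
definition cadlag_on :: "real \<Rightarrow> real \<Rightarrow> (real \<Rightarrow> real) \<Rightarrow> bool" where
  "cadlag_on a b x \<longleftrightarrow>
     (\<forall>t\<in>{a..b}. (t < b \<longrightarrow> (x \<longlongrightarrow> x t) (at_right t))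
                \<and> (a < t \<longrightarrow> (\<exists>l. (x \<longlongrightarrow> l) (at_left t))))"

definition Dspace :: "real \<Rightarrow> real \<Rightarrow> (real \<Rightarrow> real) set" where
  "Dspace a b = {x. cadlag_on a b x \<and> (\<forall>t. t \<notin> {a..b} \<longrightarrow> x t = 0)}"

definition time_changes :: "real \<Rightarrow> real \<Rightarrow> (real \<Rightarrow> real) set" where
  "time_changes a b = {l. strict_mono_on {a..b} l \<and> continuous_on {a..b} l \<and> l ` {a..b} = {a..b}}"

text \<open>Skorokhod J1 distance (Billingsley, eq. (12.13)).\<close>
definition skorokhod_dist :: "real \<Rightarrow> real \<Rightarrow> (real \<Rightarrow> real) \<Rightarrow> (real \<Rightarrow> real) \<Rightarrow> real" where
  "skorokhod_dist a b x y =
     Inf {max (SUP t\<in>{a..b}. \<bar>l t - t\<bar>) (SUP t\<in>{a..b}. \<bar>x t - y (l t)\<bar>) | l. l \<in> time_changes a b}"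

definition skorokhod_topology :: "real \<Rightarrow> real \<Rightarrow> (real \<Rightarrow> real) topology" where
  "skorokhod_topology a b = Metric_space.mtopology (Dspace a b) (skorokhod_dist a b)"

definition graph_on :: "nat \<Rightarrow> nat set set \<Rightarrow> bool" where
  "graph_on n G \<longleftrightarrow> (\<forall>e\<in>G. e \<subseteq> {1..n} \<and> card e = 2)"

definition degree :: "nat set set \<Rightarrow> nat \<Rightarrow> nat" where
  "degree G i = card {e\<in>G. i \<in> e}"

text \<open>Permutation null: observation i receives time label \<open>\<pi> i\<close>, \<open>\<pi>\<close> uniform on permutations of {1..n}.\<close>
definition perms :: "nat \<Rightarrow> (nat \<Rightarrow> nat) set" where
  "perms n = {\<pi>. \<pi> permutes {1..n}}"

definition perm_prob :: "nat \<Rightarrow> ((nat \<Rightarrow> nat) \<Rightarrow> bool) \<Rightarrow> real" where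
  "perm_prob n P = real (card {\<pi>\<in>perms n. P \<pi>}) / fact n"

definition perm_exp :: "nat \<Rightarrow> ((nat \<Rightarrow> nat) \<Rightarrow> real) \<Rightarrow> real" where
  "perm_exp n f = (\<Sum>\<pi>\<in>perms n. f \<pi>) / fact n"

definition perm_var :: "nat \<Rightarrow> ((nat \<Rightarrow> nat) \<Rightarrow> real) \<Rightarrow> real" where
  "perm_var n f = perm_exp n (\<lambda>\<pi>. (f \<pi> - perm_exp n f)^2)"

definition R1 :: "nat set set \<Rightarrow> (nat \<Rightarrow> nat) \<Rightarrow> nat \<Rightarrow> real" where
  "R1 G \<pi> t = real (card {e\<in>G. \<forall>i\<in>e. \<pi> i \<le> t})"

definition R2 :: "nat set set \<Rightarrow> (nat \<Rightarrow> nat) \<Rightarrow> nat \<Rightarrow> real" where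
  "R2 G \<pi> t = real (card {e\<in>G. \<forall>i\<in>e. t < \<pi> i})"

definition pw :: "nat \<Rightarrow> nat \<Rightarrow> real" where
  "pw n t = (real n - real t - 1) / (real n - 2)"

definition qw :: "nat \<Rightarrow> nat \<Rightarrow> real" where
  "qw n t = (real t - 1) / (real n - 2)"

definition Rw :: "nat \<Rightarrow> nat set set \<Rightarrow> (nat \<Rightarrow> nat) \<Rightarrow> nat \<Rightarrow> real" where
  "Rw n G \<pi> t = pw n t * R1 G \<pi> t + qw n t * R2 G \<pi> t"

definition Zw :: "nat \<Rightarrow> nat set set \<Rightarrow> (nat \<Rightarrow> nat) \<Rightarrow> nat \<Rightarrow> real" where
  "Zw n G \<pi> t = (Rw n G \<pi> t - perm_exp n (\<lambda>\<sigma>. Rw n G \<sigma> t))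
                  / sqrt (perm_var n (\<lambda>\<sigma>. Rw n G \<sigma> t))"

definition Zw_path :: "nat \<Rightarrow> nat set set \<Rightarrow> real \<Rightarrow> (nat \<Rightarrow> nat) \<Rightarrow> real \<Rightarrow> real" where
  "Zw_path n G \<epsilon> \<pi> u = (if \<epsilon> \<le> u \<and> u \<le> 1 - \<epsilon> then Zw n G \<pi> (nat \<lfloor>real n * u\<rfloor>) else 0)"

end

theory Submission
  imports Defs
begin

text \<open>
  After centring, \<open>Rw\<close> is a degenerate quadratic form \<open>W(S)\<close> in the set \<open>S\<close> of the first \<open>t\<close>
  observations: the weights \<open>pw\<close>, \<open>qw\<close> cancel the first-order part of the Hoeffding decomposition,
  and the remaining kernel has vanishing row sums. Hence \<open>W / ((n - t) (n - t - 1))\<close> is a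
  martingale in \<open>t\<close>, and \<open>Zw\<close> is this martingale times a deterministic factor that is smooth in
  \<open>t / n\<close>. A recursion in \<open>t\<close> for the fourth moment of the stopped martingale bounds the probability
  of an oscillation of fixed size over a time interval of length \<open>\<delta> n\<close> by
  \<open>C (\<delta>\<^sup>2 + \<delta> r)\<close>, where \<open>r\<close> is of order \<open>(\<Sum>i. degree i ^ 2) / |G|\<^sup>2\<close> and so tends to \<open>0\<close>. As
  there are about \<open>1 / \<delta>\<close> such intervals, the paths are with high probability uniformly close to
  step functions from a finite set. Totally bounded sets for the supremum distance have compact
  closure, also in the coarser Skorokhod topology.
\<close>

section \<open>The Skorokhod space\<close>

text \<open>Second moments would not suffice: they bound the probability of an oscillation over
  length \<open>\<delta> n\<close> only by a multiple of \<delta>, and summing over about 1 /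
  \<delta> intervals leaves nothing small. Fourth moments give the square of \<delta>. The fourth
  powers of single steps leave a term linear in \<delta>; it sums to a multiple of r over all
  intervals and is harmless only because r tends to 0 while \<delta> stays fixed. Both growth
  hypotheses enter here: the sum of squared degrees is o(k n^2) and |G| is of order k n, hence r =
  o(1 / k), which vanishes because k is at least of order 1. The degree hypothesis also makes the
  first-order part of the adjacency matrix negligible, so that the variance is at least a multiple
  of |G|. Staying \<epsilon> away from both ends keeps t and n - t comparable with n; the powers of
  \<beta> in the constants record this. Conditional expectations are replaced throughout by averages
  over the possible next arrivals.\<close>

lemma cadlag_on_bounded:
  assumes x: "cadlag_on a b x"
  shows "\<exists>B. \<forall>t\<in>{a..b}. \<bar>x t\<bar> \<le> B"
proof -
  \<comment> \<open>The one-sided limits give a bound near each point, and compactness of the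
    interval makes it global. At an end of the interval the outer side is vacuous, since no point
    there lies in \<open>{a..b}\<close>; the bound 0 used for it is arbitrary.\<close>
  have "\<exists>U B. open U \<and> t \<in> U \<and> (\<forall>s\<in>U. s \<in> {a..b} \<longrightarrow> \<bar>x s\<bar> \<le> B)" if t: "t \<in> {a..b}" for t
  proof -
    have "\<exists>B. \<forall>\<^sub>F s in at_right t. s \<in> {a..b} \<longrightarrow> \<bar>x s\<bar> \<le> B"
    proof (cases "t < b")
      case True
      then have "(x \<longlongrightarrow> x t) (at_right t)" using x t by (auto simp: cadlag_on_def)
      then have "\<forall>\<^sub>F s in at_right t. dist (x s) (x t) < 1" by (rule tendstoD) simp
      then have "\<forall>\<^sub>F s in at_right t. s \<in> {a..b} \<longrightarrow> \<bar>x s\<bar> \<le> \<bar>x t\<bar> + 1"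
        by eventually_elim (auto simp: dist_real_def)
      then show ?thesis by blast
    next
      case False
      then have "\<forall>\<^sub>F s in at_right t. s \<in> {a..b} \<longrightarrow> \<bar>x s\<bar> \<le> 0"
        using t by (auto simp: eventually_at_right_field intro!: exI[of _ "t+1"])
      then show ?thesis by blast
    qed
    then obtain B1 where B1: "\<forall>\<^sub>F s in at_right t. s \<in> {a..b} \<longrightarrow> \<bar>x s\<bar> \<le> B1" by blast
    have "\<exists>B. \<forall>\<^sub>F s in at_left t. s \<in> {a..b} \<longrightarrow> \<bar>x s\<bar> \<le> B"
    proof (cases "a < t")
      case True
      then obtain l where "(x \<longlongrightarrow> l) (at_left t)" using x t by (auto simp: cadlag_on_def)
      then have "\<forall>\<^sub>F s in at_left t. dist (x s) l < 1" by (rule tendstoD) simp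
      then have "\<forall>\<^sub>F s in at_left t. s \<in> {a..b} \<longrightarrow> \<bar>x s\<bar> \<le> \<bar>l\<bar> + 1"
        by eventually_elim (auto simp: dist_real_def)
      then show ?thesis by blast
    next
      case False
      then have "\<forall>\<^sub>F s in at_left t. s \<in> {a..b} \<longrightarrow> \<bar>x s\<bar> \<le> 0"
        using t by (auto simp: eventually_at_left_field intro!: exI[of _ "t-1"])
      then show ?thesis by blast
    qed
    then obtain B2 where B2: "\<forall>\<^sub>F s in at_left t. s \<in> {a..b} \<longrightarrow> \<bar>x s\<bar> \<le> B2" by blast
    define B where "B = max \<bar>x t\<bar> (max B1 B2)"
    have "\<forall>\<^sub>F s in at t. s \<in> {a..b} \<longrightarrow> \<bar>x s\<bar> \<le> B"
      unfolding eventually_at_split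
      by (intro conjI eventually_mono[OF B1] eventually_mono[OF B2]) (auto simp: B_def)
    then have "\<forall>\<^sub>F s in nhds t. s \<in> {a..b} \<longrightarrow> \<bar>x s\<bar> \<le> B"
      unfolding eventually_at_filter by eventually_elim (auto simp: B_def)
    then show ?thesis unfolding eventually_nhds by blast
  qed
  then obtain U B where U: "\<And>t. t \<in> {a..b} \<Longrightarrow> open (U t) \<and> t \<in> U t \<and> (\<forall>s\<in>U t. s \<in> {a..b} \<longrightarrow> \<bar>x s\<bar> \<le> B t)"
    by metis
  have "compact {a..b}" by simp
  then obtain C where C: "C \<subseteq> {a..b}" "finite C" "{a..b} \<subseteq> (\<Union>t\<in>C. U t)"
    by (rule compactE_image[where C = "{a..b}" and f = U]) (use U in auto)
  have "\<bar>x s\<bar> \<le> (\<Sum>t\<in>C. \<bar>B t\<bar>)" if "s \<in> {a..b}" for s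
  proof -
    from that C obtain t where t: "t \<in> C" "s \<in> U t" by auto
    then have "\<bar>x s\<bar> \<le> \<bar>B t\<bar>" using U[of t] C that by force
    also have "\<dots> \<le> (\<Sum>t\<in>C. \<bar>B t\<bar>)" using t C by (intro member_le_sum) auto
    finally show ?thesis .
  qed
  then show ?thesis by blast
qed

section \<open>The group of time changes and the Skorokhod distance\<close>

lemma time_changes_id: "(\<lambda>t. t) \<in> time_changes a b"
  by (auto simp: time_changes_def strict_mono_on_def)

lemma time_changes_in: "l \<in> time_changes a b \<Longrightarrow> t \<in> {a..b} \<Longrightarrow> l t \<in> {a..b}"
  by (auto simp: time_changes_def)

lemma time_changes_compose:
  assumes "k \<in> time_changes a b" "l \<in> time_changes a b"
  shows "(\<lambda>t. k (l t)) \<in> time_changes a b"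
proof -
  note kl = assms[unfolded time_changes_def mem_Collect_eq]
  have "(\<lambda>t. k (l t)) ` {a..b} = k ` (l ` {a..b})" by (simp only: image_image)
  then have "(\<lambda>t. k (l t)) ` {a..b} = {a..b}" using kl by metis
  moreover have "continuous_on {a..b} (\<lambda>t. k (l t))"
    by (rule continuous_on_compose2[of "{a..b}" k "{a..b}" l]) (use kl in simp_all)
  moreover have "strict_mono_on {a..b} (\<lambda>t. k (l t))"
  proof (rule strict_mono_onI)
    fix r s assume rs: "r \<in> {a..b}" "s \<in> {a..b}" "r < s"
    then have "l r < l s" using kl by (meson strict_mono_onD)
    then show "k (l r) < k (l s)"
      using kl(1) time_changes_in[OF assms(2) rs(1)] time_changes_in[OF assms(2) rs(2)]
      by (meson strict_mono_onD)
  qed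
  ultimately show ?thesis unfolding time_changes_def by blast
qed

lemma time_changes_inverse:
  assumes "l \<in> time_changes a b"
  shows "\<exists>k\<in>time_changes a b. (\<forall>t\<in>{a..b}. k (l t) = t) \<and> (\<forall>t\<in>{a..b}. l (k t) = t)"
proof
  have l: "strict_mono_on {a..b} l" "continuous_on {a..b} l" "l ` {a..b} = {a..b}"
    using assms by (auto simp: time_changes_def)
  have inj: "inj_on l {a..b}" using l(1) by (rule strict_mono_on_imp_inj_on)
  let ?k = "the_inv_into {a..b} l"
  show 1: "(\<forall>t\<in>{a..b}. ?k (l t) = t) \<and> (\<forall>t\<in>{a..b}. l (?k t) = t)"
    using inj l(3) by (auto simp: the_inv_into_f_f f_the_inv_into_f)
  have im: "?k ` {a..b} = {a..b}" using the_inv_into_onto[OF inj] l(3) by simp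
  have "continuous_on {a..b} ?k"
    using continuous_on_inv_into[OF l(2) _ inj] l(3) by simp
  moreover have "strict_mono_on {a..b} ?k"
  proof (rule strict_mono_onI)
    fix r s assume rs: "r \<in> {a..b}" "s \<in> {a..b}" "r < s"
    show "?k r < ?k s"
    proof (rule ccontr)
      assume "\<not> ?k r < ?k s"
      then have "l (?k s) \<le> l (?k r)" using im rs l(1)
        by (intro strict_mono_on_leD[OF l(1)]) auto
      then show False using 1 rs by auto
    qed
  qed
  ultimately show "?k \<in> time_changes a b" using im by (simp add: time_changes_def)
qed

lemma bdd_above_time_change:
  "l \<in> time_changes a b \<Longrightarrow> bdd_above ((\<lambda>t. \<bar>l t - t\<bar>) ` {a..b})"
  by (rule bdd_aboveI[where M = "b - a"]) (auto dest!: time_changes_in)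

text \<open>A real supremum says something only about a bounded set. Cadlag functions are bounded on
  a compact interval, and this justifies every pointwise estimate drawn from a supremum
  below.\<close>

lemma bdd_above_Dspace_diff:
  assumes "x \<in> Dspace a b" "y \<in> Dspace a b" "l ` {a..b} \<subseteq> {a..b}"
  shows "bdd_above ((\<lambda>t. \<bar>x t - y (l t)\<bar>) ` {a..b})"
proof -
  have "cadlag_on a b x" "cadlag_on a b y" using assms(1,2) by (simp_all add: Dspace_def)
  note bounds = this[THEN cadlag_on_bounded]
  from bounds(1) obtain B where B: "\<forall>t\<in>{a..b}. \<bar>x t\<bar> \<le> B" ..
  from bounds(2) obtain C where C: "\<forall>t\<in>{a..b}. \<bar>y t\<bar> \<le> C" ..
  have "\<bar>x t - y (l t)\<bar> \<le> B + C" if "t \<in> {a..b}" for t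
  proof -
    have "l t \<in> {a..b}" using that assms(3) by blast
    then have "\<bar>y (l t)\<bar> \<le> C" using C by blast
    moreover have "\<bar>x t\<bar> \<le> B" using B that by blast
    ultimately show ?thesis by linarith
  qed
  then show ?thesis by (intro bdd_aboveI[where M = "B + C"]) auto
qed

lemma skorokhod_set_nonneg:
  assumes "a \<le> b" "l \<in> time_changes a b"
  shows "0 \<le> max (SUP t\<in>{a..b}. \<bar>l t - t\<bar>) c"
  using cSUP_upper[OF _ bdd_above_time_change[OF assms(2)], of a] assms(1) by auto

lemma skorokhod_dist_nonneg:
  assumes "a \<le> b" shows "0 \<le> skorokhod_dist a b x y"
  unfolding skorokhod_dist_def
proof (rule cInf_greatest)
  show "{max (SUP t\<in>{a..b}. \<bar>l t - t\<bar>) (SUP t\<in>{a..b}. \<bar>x t - y (l t)\<bar>) | l. l \<in> time_changes a b} \<noteq> {}"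
    using time_changes_id[of a b] by auto
qed (use skorokhod_set_nonneg[OF assms] in auto)

lemma skorokhod_dist_le:
  assumes "a \<le> b" "l \<in> time_changes a b"
    and "\<And>t. t \<in> {a..b} \<Longrightarrow> \<bar>l t - t\<bar> \<le> r" "\<And>t. t \<in> {a..b} \<Longrightarrow> \<bar>x t - y (l t)\<bar> \<le> r"
  shows "skorokhod_dist a b x y \<le> r"
proof -
  have "skorokhod_dist a b x y \<le> max (SUP t\<in>{a..b}. \<bar>l t - t\<bar>) (SUP t\<in>{a..b}. \<bar>x t - y (l t)\<bar>)"
    unfolding skorokhod_dist_def
    by (rule cInf_lower) (use assms(1,2) skorokhod_set_nonneg in \<open>auto intro!: bdd_belowI[where m = 0]\<close>)
  also have "\<dots> \<le> r" using assms by (auto intro!: cSUP_least)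
  finally show ?thesis .
qed

text \<open>The infimum over time changes need not be attained, but a strict upper bound always
  produces a witness. Distances are therefore used with some slack from here on.\<close>

lemma skorokhod_dist_lessD:
  assumes "x \<in> Dspace a b" "y \<in> Dspace a b" "skorokhod_dist a b x y < r"
  shows "\<exists>l\<in>time_changes a b. \<forall>t\<in>{a..b}. \<bar>l t - t\<bar> < r \<and> \<bar>x t - y (l t)\<bar> < r"
proof -
  have "{max (SUP t\<in>{a..b}. \<bar>l t - t\<bar>) (SUP t\<in>{a..b}. \<bar>x t - y (l t)\<bar>) | l. l \<in> time_changes a b} \<noteq> {}"
    using time_changes_id[of a b] by auto
  from cInf_lessD[OF this assms(3)[unfolded skorokhod_dist_def]] obtain l where l: "l \<in> time_changes a b"
    "(SUP t\<in>{a..b}. \<bar>l t - t\<bar>) < r" "(SUP t\<in>{a..b}. \<bar>x t - y (l t)\<bar>) < r"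
    by auto
  have "l ` {a..b} \<subseteq> {a..b}" using l(1) by (auto simp: time_changes_def)
  from cSUP_upper[OF _ bdd_above_Dspace_diff[OF assms(1,2) this]] l(3)
  have 1: "\<bar>x t - y (l t)\<bar> < r" if "t \<in> {a..b}" for t using that by force
  from cSUP_upper[OF _ bdd_above_time_change[OF l(1)]] l(2)
  have 2: "\<bar>l t - t\<bar> < r" if "t \<in> {a..b}" for t using that by force
  show ?thesis using l(1) 1 2 by blast
qed

text \<open>Replacing a time change by its inverse and substituting \<open>t = l s\<close> leaves
  the sets of values under both suprema unchanged, so both infima run over the same set of
  reals.\<close>

lemma skorokhod_dist_commute: "skorokhod_dist a b x y = skorokhod_dist a b y x"
proof -
  let ?S = "\<lambda>x y. {max (SUP t\<in>{a..b}. \<bar>l t - t\<bar>) (SUP t\<in>{a..b}. \<bar>x t - y (l t)\<bar>) | l. l \<in> time_changes a b}"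
  have sub: "?S x y \<subseteq> ?S y x" for x y :: "real \<Rightarrow> real"
  proof
    fix r assume "r \<in> ?S x y"
    then obtain l where l: "l \<in> time_changes a b"
      and r: "r = max (SUP t\<in>{a..b}. \<bar>l t - t\<bar>) (SUP t\<in>{a..b}. \<bar>x t - y (l t)\<bar>)" by blast
    obtain k where k: "k \<in> time_changes a b" "\<And>t. t \<in> {a..b} \<Longrightarrow> k (l t) = t"
      using time_changes_inverse[OF l] by blast
    have im: "{a..b} = l ` {a..b}" using l by (simp add: time_changes_def)
    have "(\<lambda>t. \<bar>k t - t\<bar>) ` {a..b} = (\<lambda>t. \<bar>k t - t\<bar>) ` l ` {a..b}"
         "(\<lambda>t. \<bar>y t - x (k t)\<bar>) ` {a..b} = (\<lambda>t. \<bar>y t - x (k t)\<bar>) ` l ` {a..b}"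
      by (rule arg_cong[OF im])+
    then have "(\<lambda>t. \<bar>k t - t\<bar>) ` {a..b} = (\<lambda>t. \<bar>l t - t\<bar>) ` {a..b}"
              "(\<lambda>t. \<bar>y t - x (k t)\<bar>) ` {a..b} = (\<lambda>t. \<bar>x t - y (l t)\<bar>) ` {a..b}"
      unfolding image_image using k(2) by (auto simp: abs_minus_commute intro!: image_cong)
    then show "r \<in> ?S y x" using k(1) r by (auto intro!: exI[of _ k])
  qed
  show ?thesis unfolding skorokhod_dist_def
    by (rule arg_cong[where f = Inf], rule subset_antisym[OF sub sub])
qed

text \<open>The three cases use three different facts: outside the interval both functions are
  normalised to 0, at \<open>b\<close> every time change has \<open>b\<close> as a fixed point, and
  at the remaining points right-continuity absorbs a small shift of time.\<close>

lemma skorokhod_dist_eq_0_imp: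
  assumes "a \<le> b" and x: "x \<in> Dspace a b" and y: "y \<in> Dspace a b" and 0: "skorokhod_dist a b x y = 0"
  shows "x = y"
proof
  fix t
  consider "t \<notin> {a..b}" | "t = b" | "a \<le> t" "t < b" by fastforce
  then show "x t = y t"
  proof cases
    case 1
    then show ?thesis using x y by (auto simp: Dspace_def)
  next
    case 2
    have "\<bar>x b - y b\<bar> \<le> r" if r: "r > 0" for r
    proof -
      obtain l where l: "l \<in> time_changes a b" "\<And>t. t \<in> {a..b} \<Longrightarrow> \<bar>x t - y (l t)\<bar> < r"
        using skorokhod_dist_lessD[OF x y, unfolded 0, OF r] by blast
      have "b \<in> l ` {a..b}" using l(1) assms(1) by (simp add: time_changes_def)
      then obtain s where "s \<in> {a..b}" "l s = b" by force
      moreover have "strict_mono_on {a..b} l" using l(1) by (simp add: time_changes_def)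
      ultimately have "l b \<ge> b" using assms(1) strict_mono_on_leD[of "{a..b}" l s b] by auto
      then have "l b = b" using time_changes_in[OF l(1), of b] assms(1) by auto
      then show ?thesis using l(2)[of b] assms(1) by auto
    qed
    then show ?thesis using 2 field_le_epsilon[of "\<bar>x b - y b\<bar>" 0] by auto
  next
    case 3
    have "\<bar>x t - y t\<bar> \<le> r" if r: "r > 0" for r
    proof -
      have "(x \<longlongrightarrow> x t) (at_right t)" "(y \<longlongrightarrow> y t) (at_right t)"
        using x y 3 by (auto simp: Dspace_def cadlag_on_def)
      then have "\<forall>\<^sub>F s in at_right t. dist (x s) (x t) < r/3" "\<forall>\<^sub>F s in at_right t. dist (y s) (y t) < r/3"
        using tendstoD[of _ _ _ "r/3"] r by (metis divide_pos_pos zero_less_numeral)+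
      then have "\<forall>\<^sub>F s in at_right t. dist (x s) (x t) < r/3 \<and> dist (y s) (y t) < r/3"
        by (rule eventually_conj)
      then obtain c where c: "t < c" "\<And>s. t < s \<Longrightarrow> s < c \<Longrightarrow> dist (x s) (x t) < r/3 \<and> dist (y s) (y t) < r/3"
        unfolding eventually_at_right_field by blast
      define s where "s = (t + min b c) / 2"
      have s: "t < s" "s < c" "s \<in> {a..b}" using c 3 by (auto simp: s_def min_def field_simps)
      \<comment> \<open>The time change moves \<open>s\<close> by less than its distance to
        \<open>t\<close> and to \<open>c\<close>, so \<open>l s\<close> stays in the window to the
        right of \<open>t\<close> where \<open>y\<close> is close to \<open>y t\<close>.\<close>
      have "0 < min (r/3) (min (s - t) (c - s))" using r s by auto
      from this obtain l where l: "\<bar>l s - s\<bar> < min (r/3) (min (s - t) (c - s))"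
          "\<bar>x s - y (l s)\<bar> < min (r/3) (min (s - t) (c - s))"
        using skorokhod_dist_lessD[OF x y, unfolded 0, OF \<open>0 < min (r/3) (min (s - t) (c - s))\<close>] s(3) by blast
      then have "t < l s" "l s < c" by auto
      then have "dist (y (l s)) (y t) < r/3" using c(2) by blast
      moreover have "dist (x s) (x t) < r/3" using c(2) s by blast
      ultimately show ?thesis using l(2) unfolding dist_real_def by linarith
    qed
    then show ?thesis using field_le_epsilon[of "\<bar>x t - y t\<bar>" 0] by auto
  qed
qed

lemma skorokhod_dist_triangle:
  assumes "a \<le> b" and x: "x \<in> Dspace a b" and y: "y \<in> Dspace a b" and z: "z \<in> Dspace a b"
  shows "skorokhod_dist a b x z \<le> skorokhod_dist a b x y + skorokhod_dist a b y z"
proof (rule field_le_epsilon)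
  fix e :: real assume "0 < e"
  then have e: "skorokhod_dist a b x y < skorokhod_dist a b x y + e/2"
            "skorokhod_dist a b y z < skorokhod_dist a b y z + e/2" by auto
  obtain k where k: "k \<in> time_changes a b"
    "\<And>t. t \<in> {a..b} \<Longrightarrow> \<bar>k t - t\<bar> < skorokhod_dist a b x y + e/2"
    "\<And>t. t \<in> {a..b} \<Longrightarrow> \<bar>x t - y (k t)\<bar> < skorokhod_dist a b x y + e/2"
    using skorokhod_dist_lessD[OF x y e(1)] by blast
  obtain l where l: "l \<in> time_changes a b"
    "\<And>t. t \<in> {a..b} \<Longrightarrow> \<bar>l t - t\<bar> < skorokhod_dist a b y z + e/2"
    "\<And>t. t \<in> {a..b} \<Longrightarrow> \<bar>y t - z (l t)\<bar> < skorokhod_dist a b y z + e/2"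
    using skorokhod_dist_lessD[OF y z e(2)] by blast
  show "skorokhod_dist a b x z \<le> skorokhod_dist a b x y + skorokhod_dist a b y z + e"
  proof (rule skorokhod_dist_le[OF assms(1) time_changes_compose[OF l(1) k(1)]])
    fix t assume t: "t \<in> {a..b}"
    note kt = time_changes_in[OF k(1) t]
    show "\<bar>l (k t) - t\<bar> \<le> skorokhod_dist a b x y + skorokhod_dist a b y z + e"
      using k(2)[OF t] l(2)[OF kt] by linarith
    show "\<bar>x t - z (l (k t))\<bar> \<le> skorokhod_dist a b x y + skorokhod_dist a b y z + e"
      using k(3)[OF t] l(3)[OF kt] by linarith
  qed
qed

lemma skorokhod_dist_self:
  assumes "a \<le> b" shows "skorokhod_dist a b x x = 0"
proof (rule antisym[OF _ skorokhod_dist_nonneg[OF assms]])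
  show "skorokhod_dist a b x x \<le> 0" by (rule skorokhod_dist_le[OF assms time_changes_id]) simp_all
qed

lemma Metric_space_skorokhod:
  assumes "a \<le> b" shows "Metric_space (Dspace a b) (skorokhod_dist a b)"
proof
  fix x y z :: "real \<Rightarrow> real"
  show "0 \<le> skorokhod_dist a b x y" by (rule skorokhod_dist_nonneg[OF assms])
  show "skorokhod_dist a b x y = skorokhod_dist a b y x" by (rule skorokhod_dist_commute)
  assume x: "x \<in> Dspace a b" and y: "y \<in> Dspace a b"
  show "skorokhod_dist a b x y = 0 \<longleftrightarrow> x = y"
    using skorokhod_dist_eq_0_imp[OF assms x y] skorokhod_dist_self[OF assms] by metis
  assume z: "z \<in> Dspace a b"
  show "skorokhod_dist a b x z \<le> skorokhod_dist a b x y + skorokhod_dist a b y z"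
    by (rule skorokhod_dist_triangle[OF assms x y z])
qed

section \<open>The supremum distance\<close>

text \<open>The outer absolute value makes the distance nonnegative even for unbounded functions,
  where the supremum is a junk value.\<close>
definition sup_dist :: "real \<Rightarrow> real \<Rightarrow> (real \<Rightarrow> real) \<Rightarrow> (real \<Rightarrow> real) \<Rightarrow> real" where
  "sup_dist a b x y = \<bar>SUP t\<in>{a..b}. \<bar>x t - y t\<bar>\<bar>"

lemma sup_dist_le:
  assumes "a \<le> b" "x \<in> Dspace a b" "y \<in> Dspace a b" "\<And>t. t \<in> {a..b} \<Longrightarrow> \<bar>x t - y t\<bar> \<le> r"
  shows "sup_dist a b x y \<le> r"
proof -
  have "bdd_above ((\<lambda>t. \<bar>x t - y t\<bar>) ` {a..b})"
    using bdd_above_Dspace_diff[OF assms(2,3), of "\<lambda>t. t"] by simp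
  then have "\<bar>x a - y a\<bar> \<le> (SUP t\<in>{a..b}. \<bar>x t - y t\<bar>)" using assms(1) by (intro cSUP_upper) auto
  moreover have "(SUP t\<in>{a..b}. \<bar>x t - y t\<bar>) \<le> r" using assms by (intro cSUP_least) auto
  ultimately show ?thesis unfolding sup_dist_def by linarith
qed

lemma le_sup_dist:
  assumes "x \<in> Dspace a b" "y \<in> Dspace a b" "t \<in> {a..b}"
  shows "\<bar>x t - y t\<bar> \<le> sup_dist a b x y"
proof -
  have "bdd_above ((\<lambda>t. \<bar>x t - y t\<bar>) ` {a..b})"
    using bdd_above_Dspace_diff[OF assms(1,2), of "\<lambda>t. t"] by simp
  then have "\<bar>x t - y t\<bar> \<le> (SUP t\<in>{a..b}. \<bar>x t - y t\<bar>)" using assms(3) by (intro cSUP_upper) auto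
  then show ?thesis unfolding sup_dist_def by linarith
qed

lemma Metric_space_sup_dist:
  assumes ab: "a \<le> b" shows "Metric_space (Dspace a b) (sup_dist a b)"
proof
  fix x y z :: "real \<Rightarrow> real"
  show "0 \<le> sup_dist a b x y" by (simp add: sup_dist_def)
  show "sup_dist a b x y = sup_dist a b y x"
    unfolding sup_dist_def by (subst abs_minus_commute) (rule refl)
  assume x: "x \<in> Dspace a b" and y: "y \<in> Dspace a b"
  show "sup_dist a b x y = 0 \<longleftrightarrow> x = y"
  proof
    assume 0: "sup_dist a b x y = 0"
    have "x t = y t" for t
      by (cases "t \<in> {a..b}") (use le_sup_dist[OF x y, of t] 0 x y in \<open>auto simp: Dspace_def\<close>)
    then show "x = y" by auto
  next
    assume "x = y"
    then show "sup_dist a b x y = 0" using ab by (simp add: sup_dist_def)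
  qed
  assume z: "z \<in> Dspace a b"
  show "sup_dist a b x z \<le> sup_dist a b x y + sup_dist a b y z"
  proof (rule sup_dist_le[OF ab x z])
    fix t assume "t \<in> {a..b}"
    from le_sup_dist[OF x y this] le_sup_dist[OF y z this]
    show "\<bar>x t - z t\<bar> \<le> sup_dist a b x y + sup_dist a b y z" by linarith
  qed
qed

lemma skorokhod_dist_le_sup_dist:
  assumes "a \<le> b" "x \<in> Dspace a b" "y \<in> Dspace a b"
  shows "skorokhod_dist a b x y \<le> sup_dist a b x y"
proof (rule skorokhod_dist_le[where l = "\<lambda>t. t", OF assms(1) time_changes_id])
  show "\<bar>t - t\<bar> \<le> sup_dist a b x y" for t :: real by (simp add: sup_dist_def)
  show "\<bar>x t - y t\<bar> \<le> sup_dist a b x y" if "t \<in> {a..b}" for t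
    by (rule le_sup_dist[OF assms(2,3) that])
qed

text \<open>Total boundedness yields a compact closure only in a complete space. The distance
  \<open>skorokhod_dist\<close> is in general not complete, whereas uniform limits of cadlag
  functions are cadlag; this is why compactness is obtained through \<open>sup_dist\<close>.\<close>

lemma mcomplete_sup_dist:
  assumes ab: "a \<le> b" shows "Metric_space.mcomplete (Dspace a b) (sup_dist a b)"
proof -
  interpret M: Metric_space "Dspace a b" "sup_dist a b" by (rule Metric_space_sup_dist[OF ab])
  show ?thesis unfolding M.mcomplete_def
  proof (intro allI impI)
    fix f :: "nat \<Rightarrow> real \<Rightarrow> real" assume "M.MCauchy f"
    then have fD: "f n \<in> Dspace a b" and
      C: "\<And>e. e > 0 \<Longrightarrow> \<exists>N. \<forall>n m. N \<le> n \<longrightarrow> N \<le> m \<longrightarrow> sup_dist a b (f n) (f m) < e" for n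
      by (auto simp: M.MCauchy_def image_subset_iff)
    have C': "\<exists>N. \<forall>n\<ge>N. \<forall>m\<ge>N. \<forall>t\<in>{a..b}. \<bar>f n t - f m t\<bar> < e" if "e > 0" for e
      using C[OF that] le_sup_dist[OF fD fD] by (meson order_le_less_trans)
    define h where "h t = (if t \<in> {a..b} then lim (\<lambda>n. f n t) else 0)" for t
    have "uniformly_Cauchy_on {a..b} f"
      unfolding uniformly_Cauchy_on_def dist_real_def using C' by blast
    then have "uniform_limit {a..b} f (\<lambda>t. lim (\<lambda>n. f n t)) sequentially"
      by (metis Cauchy_uniformly_convergent uniformly_convergent_uniform_limit_iff)
    then have u: "uniform_limit {a..b} f h sequentially"
      by (rule uniform_limit_cong'[THEN iffD1, rotated -1]) (auto simp: h_def)
    have "cadlag_on a b h" unfolding cadlag_on_def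
    proof (intro ballI conjI impI)
      fix t assume t: "t \<in> {a..b}" "t < b"
      have "uniform_limit {t..b} f h sequentially"
        by (rule uniform_limit_on_subset[OF u]) (use t in auto)
      moreover have "\<forall>\<^sub>F n in sequentially. (f n \<longlongrightarrow> f n t) (at t within {t..b})"
        using fD t by (auto simp: Dspace_def cadlag_on_def at_within_Icc_at_right)
      moreover have "(\<lambda>n. f n t) \<longlonglongrightarrow> h t" using tendsto_uniform_limitI[OF u t(1)] .
      ultimately have "(h \<longlongrightarrow> h t) (at t within {t..b})"
        by (intro swap_uniform_limit[where f = f and F = sequentially and g = "\<lambda>n. f n t"]) auto
      then show "(h \<longlongrightarrow> h t) (at_right t)" using t by (simp add: at_within_Icc_at_right)
    next
      fix t assume t: "t \<in> {a..b}" "a < t"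
      have "\<forall>n. \<exists>l. (f n \<longlongrightarrow> l) (at_left t)" using fD t by (auto simp: Dspace_def cadlag_on_def)
      then obtain g where g: "\<And>n. (f n \<longlongrightarrow> g n) (at_left t)" by metis
      \<comment> \<open>Before the two limits can be interchanged, the left limits of the
        \<open>f n\<close> must themselves converge. A uniform bound on the differences survives the
        passage to the left limit, though only as a weak inequality, hence
        \<open>e/2\<close>.\<close>
      have "Cauchy g" unfolding Cauchy_def
      proof (intro allI impI)
        fix e :: real assume e: "e > 0"
        from C'[of "e/2"] e obtain N where N: "\<forall>n\<ge>N. \<forall>m\<ge>N. \<forall>t\<in>{a..b}. \<bar>f n t - f m t\<bar> < e/2" by auto
        have "dist (g m) (g n) < e" if "m \<ge> N" "n \<ge> N" for m n
        proof -
          have "((\<lambda>s. \<bar>f m s - f n s\<bar>) \<longlongrightarrow> \<bar>g m - g n\<bar>) (at_left t)" by (intro tendsto_intros g)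
          moreover have "\<forall>\<^sub>F s in at_left t. \<bar>f m s - f n s\<bar> \<le> e/2"
            unfolding eventually_at_left_field
            by (rule exI[of _ a]) (use t N that in \<open>auto intro!: less_imp_le\<close>)
          ultimately have "\<bar>g m - g n\<bar> \<le> e/2" by (rule tendsto_upperbound) auto
          then show ?thesis using e by (simp add: dist_real_def)
        qed
        then show "\<exists>M. \<forall>m\<ge>M. \<forall>n\<ge>M. dist (g m) (g n) < e" by blast
      qed
      then obtain l where l: "g \<longlonglongrightarrow> l" by (auto simp: Cauchy_convergent_iff convergent_def)
      have "uniform_limit {a..t} f h sequentially"
        by (rule uniform_limit_on_subset[OF u]) (use t in auto)
      moreover have "\<forall>\<^sub>F n in sequentially. (f n \<longlongrightarrow> g n) (at t within {a..t})"
        using g t by (simp add: at_within_Icc_at_left)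
      ultimately have "(h \<longlongrightarrow> l) (at t within {a..t})"
        using l by (intro swap_uniform_limit[where f = f and F = sequentially and g = g]) auto
      then show "\<exists>l. (h \<longlongrightarrow> l) (at_left t)" using t by (auto simp: at_within_Icc_at_left)
    qed
    then have hD: "h \<in> Dspace a b" by (auto simp: Dspace_def h_def)
    have "limitin M.mtopology f h sequentially"
      unfolding M.limit_metric_sequentially
    proof (intro conjI allI impI hD)
      fix e :: real assume e: "e > 0"
      then have "\<forall>\<^sub>F n in sequentially. \<forall>t\<in>{a..b}. dist (f n t) (h t) < e/2"
        by (intro uniform_limitD[OF u]) simp
      then obtain N where N: "\<forall>n\<ge>N. \<forall>t\<in>{a..b}. dist (f n t) (h t) < e/2"
        unfolding eventually_sequentially ..
      have "sup_dist a b (f n) h < e" if "n \<ge> N" for n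
      proof (rule order_le_less_trans[OF sup_dist_le[OF ab fD hD, of n "e/2"]])
        show "\<bar>f n t - h t\<bar> \<le> e/2" if "t \<in> {a..b}" for t
          using N \<open>n \<ge> N\<close> that by (simp add: dist_real_def less_imp_le)
      qed (use e in simp)
      then show "\<exists>N. \<forall>n\<ge>N. f n \<in> Dspace a b \<and> sup_dist a b (f n) h < e" using fD by blast
    qed
    then show "\<exists>x. limitin M.mtopology f x sequentially" by blast
  qed
qed

lemma uniformly_totally_bounded_subset_compactin_skorokhod:
  assumes ab: "a \<le> b" and F: "F \<subseteq> Dspace a b"
    and tb: "\<And>e. e > 0 \<Longrightarrow> \<exists>T. finite T \<and> (\<forall>x\<in>F. \<exists>y\<in>T. \<forall>t\<in>{a..b}. \<bar>x t - y t\<bar> \<le> e)"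
  shows "\<exists>K. F \<subseteq> K \<and> K \<subseteq> Dspace a b \<and> compactin (skorokhod_topology a b) K"
proof -
  interpret M: Metric_space "Dspace a b" "sup_dist a b" by (rule Metric_space_sup_dist[OF ab])
  interpret S: Metric_space "Dspace a b" "skorokhod_dist a b" by (rule Metric_space_skorokhod[OF ab])
  have "M.mtotally_bounded F" unfolding M.mtotally_bounded_def
  proof (intro allI impI)
    fix e :: real assume e: "e > 0"
    obtain T where T: "finite T" "\<And>x. x \<in> F \<Longrightarrow> \<exists>y\<in>T. \<forall>t\<in>{a..b}. \<bar>x t - y t\<bar> \<le> e/3"
      using tb[of "e/3"] e by auto
    \<comment> \<open>The given centres may be arbitrary functions, while total boundedness asks for
      centres in \<open>F\<close>. Each centre that is near some member of \<open>F\<close> is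
      replaced by such a member; this doubles the radius to \<open>2*e/3\<close>, still below
      \<open>e\<close>.\<close>
    define near where "near y x \<longleftrightarrow> x \<in> F \<and> (\<forall>t\<in>{a..b}. \<bar>x t - y t\<bar> \<le> e/3)" for y x
    define T' where "T' = {y\<in>T. \<exists>x. near y x}"
    define c where "c y = (SOME x. near y x)" for y
    have c: "near y (c y)" if "y \<in> T'" for y
    proof -
      have "\<exists>x. near y x" using that by (simp add: T'_def)
      then show ?thesis unfolding c_def by (rule someI_ex)
    qed
    show "\<exists>K. finite K \<and> K \<subseteq> F \<and> F \<subseteq> (\<Union>x\<in>K. M.mball x e)"
    proof (intro exI[of _ "c ` T'"] conjI subsetI)
      show "finite (c ` T')" using T(1) by (simp add: T'_def)
      show "z \<in> F" if "z \<in> c ` T'" for z using that c by (auto simp: near_def)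
      fix x assume x: "x \<in> F"
      then obtain y where y: "y \<in> T" "near y x" using T(2) by (auto simp: near_def)
      then have yT: "y \<in> T'" by (auto simp: T'_def)
      from c[OF yT] have cy: "near y (c y)" .
      have "sup_dist a b (c y) x \<le> 2*e/3"
      proof (rule sup_dist_le[OF ab])
        show "c y \<in> Dspace a b" "x \<in> Dspace a b" using cy x F by (auto simp: near_def)
        fix t assume "t \<in> {a..b}"
        then have "\<bar>c y t - y t\<bar> \<le> e/3" "\<bar>x t - y t\<bar> \<le> e/3" using cy y by (auto simp: near_def)
        then show "\<bar>c y t - x t\<bar> \<le> 2*e/3" by linarith
      qed
      then have "x \<in> M.mball (c y) e" using e cy x F by (auto simp: near_def)
      then show "x \<in> (\<Union>x\<in>c ` T'. M.mball x e)" using yT by blast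
    qed
  qed
  then have comp: "compactin M.mtopology (M.mtopology closure_of F)"
    using M.mtotally_bounded_eq_compact_closure_of[OF mcomplete_sup_dist[OF ab]] by blast
  \<comment> \<open>Convergence for \<open>sup_dist\<close> implies convergence for
    \<open>skorokhod_dist\<close> to the same limit, so the subsequences found in the finer topology
    serve here as well.\<close>
  have "compactin S.mtopology (M.mtopology closure_of F)"
    unfolding S.compactin_sequentially
  proof (intro conjI allI impI)
    show sub: "M.mtopology closure_of F \<subseteq> Dspace a b"
      using closure_of_subset_topspace[of M.mtopology F] by simp
    fix \<sigma> :: "nat \<Rightarrow> real \<Rightarrow> real" assume "range \<sigma> \<subseteq> M.mtopology closure_of F"
    then obtain l r where lr: "l \<in> M.mtopology closure_of F" "strict_mono r"
        "limitin M.mtopology (\<sigma> \<circ> r) l sequentially"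
      using comp unfolding M.compactin_sequentially by blast
    then have "limitin S.mtopology (\<sigma> \<circ> r) l sequentially"
      unfolding M.limit_metric_sequentially S.limit_metric_sequentially
      using skorokhod_dist_le_sup_dist[OF ab] by (meson order_le_less_trans)
    then show "\<exists>l r. l \<in> M.mtopology closure_of F \<and> strict_mono r \<and>
        limitin S.mtopology (\<sigma> \<circ> r) l sequentially"
      using lr by blast
  qed
  then show ?thesis unfolding skorokhod_topology_def
    using closure_of_subset[of F M.mtopology] F closure_of_subset_topspace[of M.mtopology F] by auto
qed

section \<open>Uniform random permutations\<close>

lemma finite_perms: "finite (perms n)"
  unfolding perms_def by (intro finite_permutations) auto

lemma card_perms: "card (perms n) = fact n"
  unfolding perms_def by (subst card_permutations[of _ n]) auto

lemma perm_exp_const [simp]: "perm_exp n (\<lambda>_. c) = c"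
  by (simp add: perm_exp_def card_perms)

lemma perm_exp_add: "perm_exp n (\<lambda>\<pi>. f \<pi> + g \<pi>) = perm_exp n f + perm_exp n g"
  by (simp add: perm_exp_def sum.distrib add_divide_distrib)

lemma perm_exp_cmult: "perm_exp n (\<lambda>\<pi>. c * f \<pi>) = c * perm_exp n f"
  by (simp add: perm_exp_def sum_distrib_left)

lemma perm_exp_divide: "perm_exp n (\<lambda>\<pi>. f \<pi> / c) = perm_exp n f / c"
  using perm_exp_cmult[of n "1 / c" f] by simp

lemma perm_exp_sum: "perm_exp n (\<lambda>\<pi>. \<Sum>i\<in>I. f i \<pi>) = (\<Sum>i\<in>I. perm_exp n (f i))"
  by (simp add: perm_exp_def sum.swap[of _ _ I] sum_divide_distrib)

lemma perm_exp_mono: "(\<And>\<pi>. \<pi> \<in> perms n \<Longrightarrow> f \<pi> \<le> g \<pi>) \<Longrightarrow> perm_exp n f \<le> perm_exp n g"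
  by (auto simp: perm_exp_def intro!: divide_right_mono sum_mono)

lemma perm_exp_cong: "(\<And>\<pi>. \<pi> \<in> perms n \<Longrightarrow> f \<pi> = g \<pi>) \<Longrightarrow> perm_exp n f = perm_exp n g"
  by (auto simp: perm_exp_def intro!: sum.cong)

lemma perm_exp_nonneg: "(\<And>\<pi>. \<pi> \<in> perms n \<Longrightarrow> 0 \<le> f \<pi>) \<Longrightarrow> 0 \<le> perm_exp n f"
  by (auto simp: perm_exp_def intro!: divide_nonneg_nonneg sum_nonneg)

lemma perm_prob_eq_perm_exp: "perm_prob n P = perm_exp n (\<lambda>\<pi>. of_bool (P \<pi>))"
  unfolding perm_prob_def perm_exp_def using finite_perms[of n]
  by (simp add: of_bool_def sum.If_cases Int_def)

lemma perm_prob_mono: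
  "(\<And>\<pi>. \<pi> \<in> perms n \<Longrightarrow> P \<pi> \<Longrightarrow> Q \<pi>) \<Longrightarrow> perm_prob n P \<le> perm_prob n Q"
  unfolding perm_prob_eq_perm_exp by (rule perm_exp_mono) auto

lemma perm_prob_disj: "perm_prob n (\<lambda>\<pi>. P \<pi> \<or> Q \<pi>) \<le> perm_prob n P + perm_prob n Q"
  unfolding perm_prob_eq_perm_exp perm_exp_add[symmetric] by (rule perm_exp_mono) auto

lemma perm_prob_UN:
  assumes "finite I"
  shows "perm_prob n (\<lambda>\<pi>. \<exists>i\<in>I. P i \<pi>) \<le> (\<Sum>i\<in>I. perm_prob n (P i))"
  unfolding perm_prob_eq_perm_exp perm_exp_sum[symmetric]
proof (rule perm_exp_mono)
  fix \<pi>
  show "of_bool (\<exists>i\<in>I. P i \<pi>) \<le> (\<Sum>i\<in>I. of_bool (P i \<pi>) :: real)"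
  proof (cases "\<exists>i\<in>I. P i \<pi>")
    case True
    then obtain i where "i \<in> I" "P i \<pi>" by blast
    then show ?thesis using member_le_sum[of i I "\<lambda>i. of_bool (P i \<pi>) :: real"] assms by auto
  qed (auto intro!: sum_nonneg)
qed

lemma perm_prob_not: "perm_prob n (\<lambda>\<pi>. \<not> P \<pi>) = 1 - perm_prob n P"
proof -
  have "perm_prob n (\<lambda>\<pi>. \<not> P \<pi>) + perm_prob n P = perm_exp n (\<lambda>_. 1)"
    unfolding perm_prob_eq_perm_exp perm_exp_add[symmetric] by (rule perm_exp_cong) auto
  then show ?thesis by simp
qed

lemma perm_prob_Markov:
  assumes "\<And>\<pi>. \<pi> \<in> perms n \<Longrightarrow> 0 \<le> f \<pi>" "\<And>\<pi>. \<pi> \<in> perms n \<Longrightarrow> P \<pi> \<Longrightarrow> c \<le> f \<pi>" "0 < c"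
  shows "perm_prob n P \<le> perm_exp n f / c"
  unfolding perm_prob_eq_perm_exp perm_exp_divide[symmetric]
  by (rule perm_exp_mono) (use assms in \<open>auto simp: of_bool_def field_simps\<close>)

definition first_obs :: "nat \<Rightarrow> nat \<Rightarrow> (nat \<Rightarrow> nat) \<Rightarrow> nat set" where
  "first_obs n t \<pi> = {i\<in>{1..n}. \<pi> i \<le> t}"

lemma first_obs_subset: "first_obs n t \<pi> \<subseteq> {1..n}"
  by (auto simp: first_obs_def)

lemma finite_first_obs [simp]: "finite (first_obs n t \<pi>)"
  by (auto simp: first_obs_def)

text \<open>The observation arriving at time \<open>r\<close> is \<open>inv \<pi> r\<close>. In this
  form the set grows by exactly one arrival per unit of time.\<close>

lemma first_obs_eq_image:
  assumes "\<pi> \<in> perms n" "t \<le> n"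
  shows "first_obs n t \<pi> = inv \<pi> ` {1..t}"
proof -
  have p: "\<pi> permutes {1..n}" using assms by (simp add: perms_def)
  show ?thesis
  proof (intro set_eqI iffI)
    fix i assume i: "i \<in> first_obs n t \<pi>"
    then have "\<pi> i \<in> {1..n}" using permutes_in_image[OF p] by (auto simp: first_obs_def)
    then show "i \<in> inv \<pi> ` {1..t}" using i permutes_inverses(2)[OF p, of i]
      by (force simp: first_obs_def)
  next
    fix i assume "i \<in> inv \<pi> ` {1..t}"
    then obtain r where r: "r \<in> {1..t}" "i = inv \<pi> r" by auto
    then have "i \<in> {1..n}" using permutes_in_image[OF permutes_inv[OF p], of r] assms(2) by auto
    then show "i \<in> first_obs n t \<pi>" using r permutes_inverses(1)[OF p] by (auto simp: first_obs_def)
  qed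
qed

lemma first_obs_0: "\<pi> \<in> perms n \<Longrightarrow> first_obs n 0 \<pi> = {}"
  by (simp add: first_obs_eq_image)

lemma first_obs_compl:
  assumes "\<pi> \<in> perms n" "t \<le> n"
  shows "{1..n} - first_obs n t \<pi> = inv \<pi> ` {Suc t..n}"
proof -
  have p: "inv \<pi> permutes {1..n}" using assms by (simp add: perms_def permutes_inv)
  have "{1..n} = inv \<pi> ` {1..n}" using permutes_image[OF p] by simp
  moreover have "{1..n} - {1..t} = {Suc t..n}" using assms by auto
  ultimately show ?thesis unfolding first_obs_eq_image[OF assms]
    using image_set_diff[OF permutes_inj[OF p], of "{1..n}" "{1..t}"] by metis
qed

lemma card_first_obs_compl:
  assumes "\<pi> \<in> perms n" "t \<le> n"
  shows "card ({1..n} - first_obs n t \<pi>) = n - t"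
proof -
  have "inv \<pi> permutes {1..n}" using assms by (simp add: perms_def permutes_inv)
  then show ?thesis unfolding first_obs_compl[OF assms]
    by (subst card_image) (auto intro: permutes_inj_on)
qed

lemma first_obs_Suc:
  assumes "\<pi> \<in> perms n" "t < n"
  shows "first_obs n (Suc t) \<pi> = insert (inv \<pi> (Suc t)) (first_obs n t \<pi>)"
  using assms by (simp add: first_obs_eq_image atLeastAtMostSuc_conv)

text \<open>Measurability with respect to the first \<open>t\<close> arrivals.\<close>
definition adapted :: "nat \<Rightarrow> nat \<Rightarrow> ((nat \<Rightarrow> nat) \<Rightarrow> 'a) \<Rightarrow> bool" where
  "adapted n t g \<longleftrightarrow> (\<forall>\<pi>\<in>perms n. \<forall>\<sigma>\<in>perms n.
     (\<forall>s\<le>t. first_obs n s \<pi> = first_obs n s \<sigma>) \<longrightarrow> g \<pi> = g \<sigma>)"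

text \<open>Exchanging the labels \<open>t + 1\<close> and \<open>r > t\<close> does not affect the first \<open>t\<close> arrivals, so the
  next arrival is uniform among the remaining observations.\<close>
lemma perm_exp_next_arrival:
  assumes t: "t < n" and H: "\<And>v. adapted n t (H v)"
  shows "perm_exp n (\<lambda>\<pi>. H (inv \<pi> (Suc t)) \<pi>) =
         perm_exp n (\<lambda>\<pi>. (\<Sum>v\<in>{1..n} - first_obs n t \<pi>. H v \<pi>) / (real n - real t))"
proof -
  have *: "perm_exp n (\<lambda>\<pi>. H (inv \<pi> (Suc t)) \<pi>) = perm_exp n (\<lambda>\<pi>. H (inv \<pi> r) \<pi>)"
    if r: "r \<in> {Suc t..n}" for r
  proof -
    define \<tau> where "\<tau> = Transposition.transpose (Suc t) r"
    have tau: "\<tau> permutes {1..n}" unfolding \<tau>_def using r t by (intro permutes_swap_id) auto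
    have bij: "bij_betw (\<lambda>\<pi>. \<tau> \<circ> \<pi>) (perms n) (perms n)"
    proof (rule bij_betw_byWitness[where f' = "\<lambda>\<pi>. \<tau> \<circ> \<pi>"])
      show "(\<lambda>\<pi>. \<tau> \<circ> \<pi>) ` perms n \<subseteq> perms n" "(\<lambda>\<pi>. \<tau> \<circ> \<pi>) ` perms n \<subseteq> perms n"
        using permutes_compose[OF _ tau] by (auto simp: perms_def)
    qed (auto simp: \<tau>_def fun_eq_iff)
    have "(\<Sum>\<pi>\<in>perms n. H (inv \<pi> (Suc t)) \<pi>) = (\<Sum>\<pi>\<in>perms n. H (inv (\<tau> \<circ> \<pi>) (Suc t)) (\<tau> \<circ> \<pi>))"
      using sum.reindex_bij_betw[OF bij, of "\<lambda>\<pi>. H (inv \<pi> (Suc t)) \<pi>"] by simp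
    also have "\<dots> = (\<Sum>\<pi>\<in>perms n. H (inv \<pi> r) \<pi>)"
    proof (rule sum.cong[OF refl])
      fix \<pi> assume pi: "\<pi> \<in> perms n"
      have "inv (\<tau> \<circ> \<pi>) (Suc t) = inv \<pi> r"
        using o_inv_distrib[of \<tau> \<pi>] permutes_bij[OF tau] permutes_bij[of \<pi>] pi
        by (simp add: perms_def \<tau>_def)
      moreover have "\<tau> \<circ> \<pi> \<in> perms n" using bij_betw_apply[OF bij pi] by simp
      moreover have "\<forall>s\<le>t. first_obs n s (\<tau> \<circ> \<pi>) = first_obs n s \<pi>"
        using r by (auto simp: first_obs_def \<tau>_def Transposition.transpose_def)
      ultimately show "H (inv (\<tau> \<circ> \<pi>) (Suc t)) (\<tau> \<circ> \<pi>) = H (inv \<pi> r) \<pi>"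
        using H[of "inv \<pi> r"] pi unfolding adapted_def by metis
    qed
    finally show ?thesis by (simp add: perm_exp_def)
  qed
  \<comment> \<open>All \<open>n - t\<close> labels after \<open>t\<close> give the same
    expectation, so it equals their average; as \<open>r\<close> runs through these labels,
    \<open>inv \<pi> r\<close> runs through the remaining observations.\<close>
  have "(real n - real t) * perm_exp n (\<lambda>\<pi>. H (inv \<pi> (Suc t)) \<pi>)
      = (\<Sum>r\<in>{Suc t..n}. perm_exp n (\<lambda>\<pi>. H (inv \<pi> (Suc t)) \<pi>))"
    using t by (simp add: of_nat_diff)
  also have "\<dots> = (\<Sum>r\<in>{Suc t..n}. perm_exp n (\<lambda>\<pi>. H (inv \<pi> r) \<pi>))"
    by (rule sum.cong[OF refl *])
  also have "\<dots> = perm_exp n (\<lambda>\<pi>. \<Sum>v\<in>{1..n} - first_obs n t \<pi>. H v \<pi>)"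
    unfolding perm_exp_sum[symmetric]
  proof (rule perm_exp_cong)
    fix \<pi> assume pi: "\<pi> \<in> perms n"
    then have "inj_on (inv \<pi>) {Suc t..n}"
      by (auto simp: perms_def intro: permutes_inj_on permutes_inv)
    then show "(\<Sum>r\<in>{Suc t..n}. H (inv \<pi> r) \<pi>) = (\<Sum>v\<in>{1..n} - first_obs n t \<pi>. H v \<pi>)"
      using first_obs_compl[OF pi, of t] t by (simp add: sum.reindex)
  qed
  finally show ?thesis using t by (simp add: perm_exp_divide field_simps)
qed

text \<open>This one-step recursion takes the place of conditioning on the first \<open>t\<close>
  arrivals. Every moment formula and moment bound for functions of \<open>first_obs\<close> is
  proved by induction on \<open>t\<close> from it.\<close>

lemma perm_exp_first_obs_Suc:
  assumes "t < n"
  shows "perm_exp n (\<lambda>\<pi>. f (first_obs n (Suc t) \<pi>)) =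
         perm_exp n (\<lambda>\<pi>. (\<Sum>v\<in>{1..n} - first_obs n t \<pi>. f (insert v (first_obs n t \<pi>))) / (real n - real t))"
proof -
  have "perm_exp n (\<lambda>\<pi>. f (first_obs n (Suc t) \<pi>)) =
        perm_exp n (\<lambda>\<pi>. f (insert (inv \<pi> (Suc t)) (first_obs n t \<pi>)))"
    using assms by (intro perm_exp_cong) (simp add: first_obs_Suc)
  also have "\<dots> = perm_exp n (\<lambda>\<pi>. (\<Sum>v\<in>{1..n} - first_obs n t \<pi>. f (insert v (first_obs n t \<pi>))) / (real n - real t))"
    by (rule perm_exp_next_arrival[OF assms, of "\<lambda>v \<pi>. f (insert v (first_obs n t \<pi>))"])
       (auto simp: adapted_def)
  finally show ?thesis .
qed

section \<open>Degenerate quadratic forms under random sampling\<close>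

lemma sum_compl_of_sum_zero:
  fixes a :: "nat \<Rightarrow> real"
  assumes "(\<Sum>i\<in>{1..n}. a i) = 0" "S \<subseteq> {1..n}"
  shows "(\<Sum>i\<in>{1..n} - S. a i) = - (\<Sum>i\<in>S. a i)"
  using assms by (simp add: sum_diff)

lemma sum_pow4_le:
  fixes a :: "'a \<Rightarrow> real"
  assumes "finite I" shows "(\<Sum>i\<in>I. a i ^ 4) \<le> (\<Sum>i\<in>I. (a i)\<^sup>2)\<^sup>2"
proof -
  have "(\<Sum>i\<in>I. a i ^ 4) \<le> (\<Sum>i\<in>I. (a i)\<^sup>2 * (\<Sum>i\<in>I. (a i)\<^sup>2))"
  proof (rule sum_mono)
    fix i assume "i \<in> I"
    then have "(a i)\<^sup>2 \<le> (\<Sum>i\<in>I. (a i)\<^sup>2)" using assms by (intro member_le_sum) auto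
    then have "(a i)\<^sup>2 * (a i)\<^sup>2 \<le> (a i)\<^sup>2 * (\<Sum>i\<in>I. (a i)\<^sup>2)" by (rule mult_left_mono) simp
    then show "a i ^ 4 \<le> (a i)\<^sup>2 * (\<Sum>i\<in>I. (a i)\<^sup>2)" by (simp add: power4_eq_xxxx power2_eq_square mult.assoc)
  qed
  then show ?thesis by (simp add: sum_distrib_right[symmetric] power2_eq_square)
qed

text \<open>Expand and bound \<open>4 x y\<^sup>3\<close> by \<open>2 x\<^sup>2 y\<^sup>2 + 2 y\<^sup>4\<close>; the linear term is kept because it
  averages out.\<close>
lemma add_pow4_le:
  fixes x y :: real
  shows "(x + y) ^ 4 \<le> x ^ 4 + 4 * x ^ 3 * y + 8 * (x\<^sup>2 * y\<^sup>2) + 3 * y ^ 4"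
proof -
  have "0 \<le> 2 * (x * y - y\<^sup>2)\<^sup>2" by simp
  then show ?thesis by (simp add: power2_eq_square power4_eq_xxxx power3_eq_cube algebra_simps)
qed

lemma perm_exp_linear_square_le:
  fixes a :: "nat \<Rightarrow> real"
  assumes a: "(\<Sum>i\<in>{1..n}. a i) = 0" and \<beta>: "0 < \<beta>"
  shows "\<beta> * real n \<le> real n - real t \<Longrightarrow> t \<le> n \<Longrightarrow>
    perm_exp n (\<lambda>\<pi>. (\<Sum>i\<in>first_obs n t \<pi>. a i)\<^sup>2) \<le> real t * ((\<Sum>i\<in>{1..n}. (a i)\<^sup>2) / (\<beta> * real n))"
proof (induction t)
  case 0
  have "perm_exp n (\<lambda>\<pi>. (\<Sum>i\<in>first_obs n 0 \<pi>. a i)\<^sup>2) = perm_exp n (\<lambda>_. 0)"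
    by (rule perm_exp_cong) (simp add: first_obs_0)
  then show ?case by simp
next
  case (Suc t)
  define Q where "Q = (\<Sum>i\<in>{1..n}. (a i)\<^sup>2)"
  have t: "t < n" "0 < real n" "\<beta> * real n \<le> real n - real t" using Suc.prems by auto
  have Q0: "0 \<le> Q" by (simp add: Q_def sum_nonneg)
  have "perm_exp n (\<lambda>\<pi>. (\<Sum>i\<in>first_obs n (Suc t) \<pi>. a i)\<^sup>2)
    = perm_exp n (\<lambda>\<pi>. (\<Sum>v\<in>{1..n} - first_obs n t \<pi>. (\<Sum>i\<in>insert v (first_obs n t \<pi>). a i)\<^sup>2) / (real n - real t))"
    by (rule perm_exp_first_obs_Suc[OF t(1)])
  also have "\<dots> \<le> perm_exp n (\<lambda>\<pi>. (\<Sum>i\<in>first_obs n t \<pi>. a i)\<^sup>2 + Q / (\<beta> * real n))"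
  proof (rule perm_exp_mono)
    fix \<pi> assume pi: "\<pi> \<in> perms n"
    let ?S = "first_obs n t \<pi>" let ?C = "{1..n} - ?S"
    define Y where "Y = (\<Sum>i\<in>?S. a i)"
    have sa: "(\<Sum>v\<in>?C. a v) = - Y" unfolding Y_def by (rule sum_compl_of_sum_zero[OF a first_obs_subset])
    have sq: "(\<Sum>v\<in>?C. (a v)\<^sup>2) \<le> Q" unfolding Q_def by (rule sum_mono2) auto
    have "(\<Sum>v\<in>?C. (\<Sum>i\<in>insert v ?S. a i)\<^sup>2) = (\<Sum>v\<in>?C. Y\<^sup>2 + 2 * Y * a v + (a v)\<^sup>2)"
      by (rule sum.cong) (auto simp: Y_def power2_eq_square algebra_simps)
    also have "\<dots> = (real n - real t) * Y\<^sup>2 + 2 * Y * (\<Sum>v\<in>?C. a v) + (\<Sum>v\<in>?C. (a v)\<^sup>2)"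
      using card_first_obs_compl[OF pi, of t] t by (simp add: sum.distrib sum_distrib_left of_nat_diff)
    also have "\<dots> \<le> (real n - real t) * Y\<^sup>2 + Q"
    proof -
      have "2 * Y * - Y = - 2 * Y\<^sup>2" by (simp add: power2_eq_square)
      then show ?thesis using sq zero_le_power2[of Y] unfolding sa by linarith
    qed
    finally have "(\<Sum>v\<in>?C. (\<Sum>i\<in>insert v ?S. a i)\<^sup>2) / (real n - real t) \<le> ((real n - real t) * Y\<^sup>2 + Q) / (real n - real t)"
      using t by (intro divide_right_mono) auto
    also have "\<dots> = Y\<^sup>2 + Q / (real n - real t)" using t by (simp add: add_divide_distrib)
    also have "Q / (real n - real t) \<le> Q / (\<beta> * real n)"
      using t \<beta> Q0 by (intro divide_left_mono) auto
    finally show "(\<Sum>v\<in>?C. (\<Sum>i\<in>insert v ?S. a i)\<^sup>2) / (real n - real t) \<le> (\<Sum>i\<in>?S. a i)\<^sup>2 + Q / (\<beta> * real n)"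
      by (simp add: Y_def)
  qed
  also have "\<dots> \<le> real t * (Q / (\<beta> * real n)) + Q / (\<beta> * real n)"
    using Suc.IH t by (simp add: perm_exp_add Q_def)
  finally show ?case unfolding Q_def[symmetric] of_nat_Suc distrib_right by simp
qed

lemma perm_exp_linear_pow4_le:
  fixes a :: "nat \<Rightarrow> real"
  assumes a: "(\<Sum>i\<in>{1..n}. a i) = 0" and \<beta>: "0 < \<beta>" "\<beta> \<le> 1"
  shows "\<beta> * real n \<le> real n - real t \<Longrightarrow> t \<le> n \<Longrightarrow>
    perm_exp n (\<lambda>\<pi>. (\<Sum>i\<in>first_obs n t \<pi>. a i) ^ 4) \<le> real t * (11 * (\<Sum>i\<in>{1..n}. (a i)\<^sup>2)\<^sup>2 / (\<beta>\<^sup>2 * real n))"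
proof (induction t)
  case 0
  have "perm_exp n (\<lambda>\<pi>. (\<Sum>i\<in>first_obs n 0 \<pi>. a i) ^ 4) = perm_exp n (\<lambda>_. 0)"
    by (rule perm_exp_cong) (simp add: first_obs_0)
  then show ?case by simp
next
  case (Suc t)
  define Q where "Q = (\<Sum>i\<in>{1..n}. (a i)\<^sup>2)"
  have t: "t < n" "0 < real n" "\<beta> * real n \<le> real n - real t" using Suc.prems by auto
  have Q0: "0 \<le> Q" by (simp add: Q_def sum_nonneg)
  let ?Y = "\<lambda>\<pi>. \<Sum>i\<in>first_obs n t \<pi>. a i"
  have sq: "perm_exp n (\<lambda>\<pi>. (?Y \<pi>)\<^sup>2) \<le> Q / \<beta>"
  proof -
    have "perm_exp n (\<lambda>\<pi>. (?Y \<pi>)\<^sup>2) \<le> real t * (Q / (\<beta> * real n))"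
      using perm_exp_linear_square_le[OF a \<beta>(1) t(3)] t(1) by (simp add: Q_def)
    also have "\<dots> \<le> real n * (Q / (\<beta> * real n))"
      using t Q0 \<beta> by (intro mult_right_mono) auto
    finally show ?thesis using t by simp
  qed
  have "perm_exp n (\<lambda>\<pi>. (\<Sum>i\<in>first_obs n (Suc t) \<pi>. a i) ^ 4)
    = perm_exp n (\<lambda>\<pi>. (\<Sum>v\<in>{1..n} - first_obs n t \<pi>. (\<Sum>i\<in>insert v (first_obs n t \<pi>). a i) ^ 4) / (real n - real t))"
    by (rule perm_exp_first_obs_Suc[OF t(1)])
  also have "\<dots> \<le> perm_exp n (\<lambda>\<pi>. ?Y \<pi> ^ 4 + (8 * Q * (?Y \<pi>)\<^sup>2 + 3 * Q\<^sup>2) / (\<beta> * real n))"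
  proof (rule perm_exp_mono)
    fix \<pi> assume pi: "\<pi> \<in> perms n"
    let ?S = "first_obs n t \<pi>" let ?C = "{1..n} - ?S"
    define Y where "Y = (\<Sum>i\<in>?S. a i)"
    have sa: "(\<Sum>v\<in>?C. a v) = - Y" unfolding Y_def by (rule sum_compl_of_sum_zero[OF a first_obs_subset])
    have sq: "(\<Sum>v\<in>?C. (a v)\<^sup>2) \<le> Q" unfolding Q_def by (rule sum_mono2) auto
    have s4: "(\<Sum>v\<in>?C. a v ^ 4) \<le> Q\<^sup>2"
      by (rule order_trans[OF sum_pow4_le power_mono[OF sq]]) (auto intro: sum_nonneg)
    have "(\<Sum>v\<in>?C. (\<Sum>i\<in>insert v ?S. a i) ^ 4) = (\<Sum>v\<in>?C. (Y + a v) ^ 4)"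
      by (rule sum.cong) (auto simp: Y_def add.commute)
    also have "\<dots> \<le> (\<Sum>v\<in>?C. Y ^ 4 + 4 * Y ^ 3 * a v + 8 * (Y\<^sup>2 * (a v)\<^sup>2) + 3 * a v ^ 4)"
      by (intro sum_mono add_pow4_le)
    also have "\<dots> = (real n - real t) * Y ^ 4 + 4 * Y ^ 3 * (\<Sum>v\<in>?C. a v) + 8 * Y\<^sup>2 * (\<Sum>v\<in>?C. (a v)\<^sup>2) + 3 * (\<Sum>v\<in>?C. a v ^ 4)"
      using card_first_obs_compl[OF pi, of t] t by (simp add: sum.distrib sum_distrib_left of_nat_diff mult.assoc)
    also have "\<dots> \<le> (real n - real t) * Y ^ 4 + 0 + 8 * Y\<^sup>2 * Q + 3 * Q\<^sup>2"
    proof (intro add_mono order_refl)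
      have "4 * Y ^ 3 * (\<Sum>v\<in>?C. a v) = - (4 * Y ^ 4)" unfolding sa by (simp add: power4_eq_xxxx power3_eq_cube)
      also have "\<dots> \<le> 0" by simp
      finally show "4 * Y ^ 3 * (\<Sum>v\<in>?C. a v) \<le> 0" .
      show "8 * Y\<^sup>2 * (\<Sum>v\<in>?C. (a v)\<^sup>2) \<le> 8 * Y\<^sup>2 * Q" using sq by (intro mult_left_mono) auto
      show "3 * (\<Sum>v\<in>?C. a v ^ 4) \<le> 3 * Q\<^sup>2" using s4 by simp
    qed
    finally have "(\<Sum>v\<in>?C. (\<Sum>i\<in>insert v ?S. a i) ^ 4) / (real n - real t)
        \<le> ((real n - real t) * Y ^ 4 + (8 * Q * Y\<^sup>2 + 3 * Q\<^sup>2)) / (real n - real t)"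
      using t by (intro divide_right_mono) (auto simp: ac_simps)
    also have "\<dots> = Y ^ 4 + (8 * Q * Y\<^sup>2 + 3 * Q\<^sup>2) / (real n - real t)" using t by (simp add: add_divide_distrib)
    also have "(8 * Q * Y\<^sup>2 + 3 * Q\<^sup>2) / (real n - real t) \<le> (8 * Q * Y\<^sup>2 + 3 * Q\<^sup>2) / (\<beta> * real n)"
      using t \<beta> Q0 by (intro divide_left_mono) auto
    finally show "(\<Sum>v\<in>?C. (\<Sum>i\<in>insert v ?S. a i) ^ 4) / (real n - real t) \<le> ?Y \<pi> ^ 4 + (8 * Q * (?Y \<pi>)\<^sup>2 + 3 * Q\<^sup>2) / (\<beta> * real n)"
      by (simp add: Y_def)
  qed
  also have "\<dots> = perm_exp n (\<lambda>\<pi>. ?Y \<pi> ^ 4) + (8 * Q * perm_exp n (\<lambda>\<pi>. (?Y \<pi>)\<^sup>2) + 3 * Q\<^sup>2) / (\<beta> * real n)"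
    by (simp add: perm_exp_add perm_exp_divide perm_exp_cmult)
  also have "\<dots> \<le> real t * (11 * Q\<^sup>2 / (\<beta>\<^sup>2 * real n)) + 11 * Q\<^sup>2 / (\<beta>\<^sup>2 * real n)"
  proof (rule add_mono)
    show "perm_exp n (\<lambda>\<pi>. ?Y \<pi> ^ 4) \<le> real t * (11 * Q\<^sup>2 / (\<beta>\<^sup>2 * real n))"
      using Suc.IH t by (simp add: Q_def)
    have "8 * Q * perm_exp n (\<lambda>\<pi>. (?Y \<pi>)\<^sup>2) \<le> 8 * Q * (Q / \<beta>)" using Q0 sq by (intro mult_left_mono) auto
    \<comment> \<open>Here \<open>\<beta> \<le> 1\<close> merges the two contributions. The constant
      11 is 8 + 3, the two coefficients of \<open>add_pow4_le\<close>, with the second moment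
      bounded by \<open>Q / \<beta>\<close>.\<close>
    moreover have "Q\<^sup>2 \<le> Q\<^sup>2 / \<beta>" using \<beta> by (simp add: field_simps mult_left_le_one_le)
    ultimately have "8 * Q * perm_exp n (\<lambda>\<pi>. (?Y \<pi>)\<^sup>2) + 3 * Q\<^sup>2 \<le> 11 * (Q\<^sup>2 / \<beta>)"
      by (simp add: power2_eq_square)
    then have "(8 * Q * perm_exp n (\<lambda>\<pi>. (?Y \<pi>)\<^sup>2) + 3 * Q\<^sup>2) / (\<beta> * real n) \<le> 11 * (Q\<^sup>2 / \<beta>) / (\<beta> * real n)"
      using \<beta> by (intro divide_right_mono) auto
    then show "(8 * Q * perm_exp n (\<lambda>\<pi>. (?Y \<pi>)\<^sup>2) + 3 * Q\<^sup>2) / (\<beta> * real n) \<le> 11 * Q\<^sup>2 / (\<beta>\<^sup>2 * real n)"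
      by (simp add: power2_eq_square mult.assoc)
  qed
  finally show ?case unfolding Q_def[symmetric] of_nat_Suc distrib_right by simp
qed

text \<open>Kernels whose rows sum to zero: the second-order part of a Hoeffding decomposition.\<close>
locale degenerate_kernel =
  fixes n :: nat and c :: "nat \<Rightarrow> nat \<Rightarrow> real"
  assumes sym: "c i j = c j i"
    and diag [simp]: "c i i = 0"
    and row_sum: "v \<in> {1..n} \<Longrightarrow> (\<Sum>i\<in>{1..n}. c i v) = 0"
begin

text \<open>The change of \<open>quad\<close> when \<open>v\<close> joins \<open>S\<close>. For
  fixed \<open>v\<close> in the vertex set it is also a centred linear statistic of the sample, so
  the preceding moment bounds apply to it.\<close>

definition lin :: "nat \<Rightarrow> nat set \<Rightarrow> real" where
  "lin v S = (\<Sum>i\<in>S. c i v)"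

definition quad :: "nat set \<Rightarrow> real" where
  "quad S = (\<Sum>i\<in>S. \<Sum>j\<in>S. c i j) / 2"

text \<open>A squared Euclidean norm; correspondingly \<open>total_norm\<close> is the squared
  Frobenius norm, counting every unordered pair twice.\<close>

definition row_norm :: "nat \<Rightarrow> real" where
  "row_norm v = (\<Sum>i\<in>{1..n}. (c i v)\<^sup>2)"

definition total_norm :: real where
  "total_norm = (\<Sum>v\<in>{1..n}. row_norm v)"

lemma row_norm_nonneg: "0 \<le> row_norm v"
  by (simp add: row_norm_def sum_nonneg)

lemma total_norm_nonneg: "0 \<le> total_norm"
  by (simp add: total_norm_def sum_nonneg row_norm_nonneg)

lemma lin_insert: "finite S \<Longrightarrow> v \<notin> S \<Longrightarrow> lin w (insert v S) = lin w S + c v w"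
  by (simp add: lin_def)

lemma quad_empty [simp]: "quad {} = 0"
  by (simp add: quad_def)

lemma quad_insert:
  assumes "finite S" "v \<notin> S" shows "quad (insert v S) = quad S + lin v S"
proof -
  have "(\<Sum>i\<in>insert v S. \<Sum>j\<in>insert v S. c i j) = (\<Sum>i\<in>S. \<Sum>j\<in>S. c i j) + (\<Sum>j\<in>S. c v j) + (\<Sum>i\<in>S. c i v)"
    using assms by (simp add: sum.distrib)
  also have "(\<Sum>j\<in>S. c v j) = (\<Sum>i\<in>S. c i v)" by (rule sum.cong) (auto simp: sym)
  finally show ?thesis by (simp add: quad_def lin_def)
qed

text \<open>Vanishing row sums turn each sum over the complement into minus a sum over
  \<open>S\<close>; the factor 2 undoes the halving in \<open>quad\<close>. Divided by
  \<open>n - t\<close>, this is the mean drift of \<open>quad\<close> at the next arrival.\<close>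

lemma sum_lin_compl:
  assumes "S \<subseteq> {1..n}" shows "(\<Sum>v\<in>{1..n} - S. lin v S) = - 2 * quad S"
proof -
  have "(\<Sum>v\<in>{1..n} - S. lin v S) = (\<Sum>i\<in>S. \<Sum>v\<in>{1..n} - S. c v i)"
    unfolding lin_def by (subst sum.swap) (simp add: sym)
  also have "\<dots> = (\<Sum>i\<in>S. - (\<Sum>v\<in>S. c v i))"
    using assms by (intro sum.cong refl sum_compl_of_sum_zero row_sum) auto
  also have "\<dots> = - 2 * quad S"
    unfolding quad_def by (subst sum.swap) (simp add: sum_negf)
  finally show ?thesis .
qed

lemma perm_exp_two_late:
  assumes "v \<in> {1..n}" "w \<in> {1..n}" "v \<noteq> w"
  shows "t \<le> n \<Longrightarrow> perm_exp n (\<lambda>\<pi>. of_bool (v \<notin> first_obs n t \<pi> \<and> w \<notin> first_obs n t \<pi>)) =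
     (real n - real t) * (real n - real t - 1) / (real n * (real n - 1))"
proof (induction t)
  case 0
  have "perm_exp n (\<lambda>\<pi>. of_bool (v \<notin> first_obs n 0 \<pi> \<and> w \<notin> first_obs n 0 \<pi>)) = perm_exp n (\<lambda>_. 1)"
    by (rule perm_exp_cong) (simp add: first_obs_0)
  then show ?case using assms by auto
next
  case (Suc t)
  then have t: "t < n" by simp
  have "perm_exp n (\<lambda>\<pi>. of_bool (v \<notin> first_obs n (Suc t) \<pi> \<and> w \<notin> first_obs n (Suc t) \<pi>)) =
    perm_exp n (\<lambda>\<pi>. (\<Sum>u\<in>{1..n} - first_obs n t \<pi>. of_bool (v \<notin> insert u (first_obs n t \<pi>) \<and> w \<notin> insert u (first_obs n t \<pi>))) / (real n - real t))"
    by (rule perm_exp_first_obs_Suc[OF t])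
  also have "\<dots> = perm_exp n (\<lambda>\<pi>. (real n - real t - 2) / (real n - real t) * of_bool (v \<notin> first_obs n t \<pi> \<and> w \<notin> first_obs n t \<pi>))"
  proof (rule perm_exp_cong)
    fix \<pi> assume pi: "\<pi> \<in> perms n"
    let ?S = "first_obs n t \<pi>"
    show "(\<Sum>u\<in>{1..n} - ?S. of_bool (v \<notin> insert u ?S \<and> w \<notin> insert u ?S)) / (real n - real t) =
      (real n - real t - 2) / (real n - real t) * of_bool (v \<notin> ?S \<and> w \<notin> ?S)"
    proof (cases "v \<notin> ?S \<and> w \<notin> ?S")
      case True
      \<comment> \<open>If \<open>v\<close> and \<open>w\<close> are both still missing, the next
        arrival must avoid exactly these two among the \<open>n - t\<close> candidates.\<close>
      have "(\<Sum>u\<in>{1..n} - ?S. of_bool (v \<notin> insert u ?S \<and> w \<notin> insert u ?S) :: real)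
          = (\<Sum>u\<in>{1..n} - ?S. 1 - of_bool (u = v) - of_bool (u = w))"
        using True assms(3) by (intro sum.cong) auto
      also have "\<dots> = real n - real t - 2"
        using True assms t card_first_obs_compl[OF pi, of t]
        by (simp add: sum_subtractf of_bool_def of_nat_diff)
      finally show ?thesis using True by simp
    qed auto
  qed
  also have "\<dots> = (real n - real t - 2) / (real n - real t) * ((real n - real t) * (real n - real t - 1) / (real n * (real n - 1)))"
    unfolding perm_exp_cmult using Suc t by simp
  also have "\<dots> = (real n - real t - 2) * (real n - real t - 1) / (real n * (real n - 1))"
    using t by (simp only: times_divide_times_eq) simp
  finally show ?case by (simp add: algebra_simps)
qed

lemma perm_exp_lin_square:
  assumes n: "3 \<le> n" and v: "v \<in> {1..n}"
  shows "t \<le> n \<Longrightarrow> perm_exp n (\<lambda>\<pi>. of_bool (v \<notin> first_obs n t \<pi>) * (lin v (first_obs n t \<pi>))\<^sup>2) =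
     row_norm v * (real t * (real n - real t) * (real n - real t - 1)) / (real n * (real n - 1) * (real n - 2))"
proof (induction t)
  case 0
  have "perm_exp n (\<lambda>\<pi>. of_bool (v \<notin> first_obs n 0 \<pi>) * (lin v (first_obs n 0 \<pi>))\<^sup>2) = perm_exp n (\<lambda>_. 0)"
    by (rule perm_exp_cong) (simp add: first_obs_0 lin_def)
  then show ?case by simp
next
  case (Suc t)
  then have t: "t < n" by simp
  define K where "K = real n - real t"
  have K: "K > 0" using t by (simp add: K_def)
  let ?f = "\<lambda>\<pi>. of_bool (v \<notin> first_obs n t \<pi>) * (lin v (first_obs n t \<pi>))\<^sup>2"
  let ?g = "\<lambda>\<pi>. \<Sum>w\<in>{1..n}. (c w v)\<^sup>2 * of_bool (v \<notin> first_obs n t \<pi> \<and> w \<notin> first_obs n t \<pi>)"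
  have "perm_exp n (\<lambda>\<pi>. of_bool (v \<notin> first_obs n (Suc t) \<pi>) * (lin v (first_obs n (Suc t) \<pi>))\<^sup>2) =
    perm_exp n (\<lambda>\<pi>. (\<Sum>u\<in>{1..n} - first_obs n t \<pi>. of_bool (v \<notin> insert u (first_obs n t \<pi>)) * (lin v (insert u (first_obs n t \<pi>)))\<^sup>2) / (real n - real t))"
    by (rule perm_exp_first_obs_Suc[OF t])
  \<comment> \<open>The coefficient \<open>K - 3\<close> arises from \<open>K\<close> candidates,
    minus 2 for the cross term with the centred remainder, minus 1 because \<open>v\<close> itself
    must not be the next arrival. The new term \<open>?g\<close> involves only the event that two
    observations are late.\<close>
  also have "\<dots> = perm_exp n (\<lambda>\<pi>. ((K - 3) * ?f \<pi> + ?g \<pi>) / K)"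
  proof (rule perm_exp_cong)
    fix \<pi> assume pi: "\<pi> \<in> perms n"
    let ?S = "first_obs n t \<pi>" let ?C = "{1..n} - ?S"
    define L where "L = lin v ?S"
    have "(\<Sum>u\<in>?C. of_bool (v \<notin> insert u ?S) * (lin v (insert u ?S))\<^sup>2) = (K - 3) * ?f \<pi> + ?g \<pi>"
    proof (cases "v \<in> ?S")
      case False
      have "(\<Sum>u\<in>?C. of_bool (v \<notin> insert u ?S) * (lin v (insert u ?S))\<^sup>2)
          = (\<Sum>u\<in>?C. L\<^sup>2 + 2 * L * c u v + (c u v)\<^sup>2 - of_bool (u = v) * L\<^sup>2)"
        using False by (intro sum.cong) (auto simp: L_def lin_insert power2_eq_square algebra_simps)
      also have "\<dots> = K * L\<^sup>2 + 2 * L * (\<Sum>u\<in>?C. c u v) + (\<Sum>u\<in>?C. (c u v)\<^sup>2) - L\<^sup>2"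
      proof -
        have "(\<Sum>u\<in>?C. of_bool (u = v) * L\<^sup>2) = L\<^sup>2"
          using False v by (simp add: sum_distrib_right[symmetric] of_bool_def)
        then show ?thesis
          using card_first_obs_compl[OF pi, of t] t
          by (simp add: sum.distrib sum_subtractf sum_distrib_left of_nat_diff K_def)
      qed
      also have "(\<Sum>u\<in>?C. c u v) = - L"
        unfolding L_def lin_def by (rule sum_compl_of_sum_zero[OF row_sum[OF v] first_obs_subset])
      also have "(\<Sum>u\<in>?C. (c u v)\<^sup>2) = ?g \<pi>"
        using False by (intro sum.mono_neutral_cong_left) auto
      finally show ?thesis using False by (simp add: L_def power2_eq_square algebra_simps)
    qed auto
    then show "(\<Sum>u\<in>?C. of_bool (v \<notin> insert u ?S) * (lin v (insert u ?S))\<^sup>2) / (real n - real t) = ((K - 3) * ?f \<pi> + ?g \<pi>) / K"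
      by (simp add: K_def)
  qed
  also have "\<dots> = ((K - 3) * perm_exp n ?f + perm_exp n ?g) / K"
    by (simp add: perm_exp_divide perm_exp_add perm_exp_cmult)
  also have "perm_exp n ?g = row_norm v * (K * (K - 1) / (real n * (real n - 1)))"
  proof -
    have "(c w v)\<^sup>2 * perm_exp n (\<lambda>\<pi>. of_bool (v \<notin> first_obs n t \<pi> \<and> w \<notin> first_obs n t \<pi>))
       = (c w v)\<^sup>2 * (K * (K - 1) / (real n * (real n - 1)))" if "w \<in> {1..n}" for w
      using perm_exp_two_late[OF v that, of t] t by (cases "w = v") (auto simp: K_def)
    then show ?thesis
      unfolding perm_exp_sum perm_exp_cmult row_norm_def sum_distrib_right by (intro sum.cong) auto
  qed
  also have "perm_exp n ?f = row_norm v * (real t * K * (K - 1)) / (real n * (real n - 1) * (real n - 2))"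
    using Suc t by (simp add: K_def)
  also have "((K - 3) * (row_norm v * (real t * K * (K - 1)) / (real n * (real n - 1) * (real n - 2)))
      + row_norm v * (K * (K - 1) / (real n * (real n - 1)))) / K =
      row_norm v * (K - 1) * (real t * (K - 3) + (real n - 2)) / (real n * (real n - 1) * (real n - 2))"
    using K n by (simp add: divide_simps) (simp add: algebra_simps)
  \<comment> \<open>This factorisation closes the induction: passing from \<open>t\<close> to
    \<open>t + 1\<close> replaces \<open>t K (K - 1)\<close> by
    \<open>(t + 1) (K - 1) (K - 2)\<close>.\<close>
  also have "real t * (K - 3) + (real n - 2) = (real t + 1) * (K - 2)" by (simp add: K_def algebra_simps)
  finally show ?case by (simp add: K_def algebra_simps)
qed

text \<open>The cross term is \<open>2 * quad\<close> times the drift \<open>- 2 * quad\<close>,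
  which accounts for the 4.\<close>

lemma quad_sum_insert_square:
  assumes "\<pi> \<in> perms n" "t \<le> n"
  shows "(\<Sum>v\<in>{1..n} - first_obs n t \<pi>. (quad (insert v (first_obs n t \<pi>)))\<^sup>2) =
    (real n - real t - 4) * (quad (first_obs n t \<pi>))\<^sup>2
      + (\<Sum>v\<in>{1..n}. of_bool (v \<notin> first_obs n t \<pi>) * (lin v (first_obs n t \<pi>))\<^sup>2)"
proof -
  let ?S = "first_obs n t \<pi>" let ?C = "{1..n} - ?S"
  have "(\<Sum>v\<in>?C. (quad (insert v ?S))\<^sup>2) = (\<Sum>v\<in>?C. (quad ?S)\<^sup>2 + 2 * quad ?S * lin v ?S + (lin v ?S)\<^sup>2)"
    by (rule sum.cong) (auto simp: quad_insert power2_eq_square algebra_simps)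
  also have "\<dots> = (real n - real t) * (quad ?S)\<^sup>2 + 2 * quad ?S * (\<Sum>v\<in>?C. lin v ?S) + (\<Sum>v\<in>?C. (lin v ?S)\<^sup>2)"
    using card_first_obs_compl[OF assms] assms(2)
    by (simp add: sum.distrib sum_distrib_left of_nat_diff)
  also have "(\<Sum>v\<in>?C. (lin v ?S)\<^sup>2) = (\<Sum>v\<in>{1..n}. of_bool (v \<notin> ?S) * (lin v ?S)\<^sup>2)"
    by (intro sum.mono_neutral_cong_left) auto
  finally show ?thesis unfolding sum_lin_compl[OF first_obs_subset] by (simp add: power2_eq_square algebra_simps)
qed

lemma perm_exp_quad:
  shows "t \<le> n \<Longrightarrow> perm_exp n (\<lambda>\<pi>. quad (first_obs n t \<pi>)) = 0"
proof (induction t)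
  case 0
  have "perm_exp n (\<lambda>\<pi>. quad (first_obs n 0 \<pi>)) = perm_exp n (\<lambda>_. 0)"
    by (rule perm_exp_cong) (simp add: first_obs_0)
  then show ?case by simp
next
  case (Suc t)
  then have t: "t < n" by simp
  have "perm_exp n (\<lambda>\<pi>. quad (first_obs n (Suc t) \<pi>)) =
     perm_exp n (\<lambda>\<pi>. (\<Sum>v\<in>{1..n} - first_obs n t \<pi>. quad (insert v (first_obs n t \<pi>))) / (real n - real t))"
    by (rule perm_exp_first_obs_Suc[OF t])
  also have "\<dots> = perm_exp n (\<lambda>\<pi>. (real n - real t - 2) / (real n - real t) * quad (first_obs n t \<pi>))"
  proof (rule perm_exp_cong)
    fix \<pi> assume pi: "\<pi> \<in> perms n"
    let ?S = "first_obs n t \<pi>" let ?C = "{1..n} - ?S"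
    have "(\<Sum>v\<in>?C. quad (insert v ?S)) = (\<Sum>v\<in>?C. quad ?S + lin v ?S)"
      by (rule sum.cong) (auto simp: quad_insert)
    also have "\<dots> = (real n - real t - 2) * quad ?S"
      unfolding sum.distrib sum_lin_compl[OF first_obs_subset]
      using card_first_obs_compl[OF pi, of t] t by (simp add: of_nat_diff algebra_simps)
    finally show "(\<Sum>v\<in>?C. quad (insert v ?S)) / (real n - real t) = (real n - real t - 2) / (real n - real t) * quad ?S"
      by simp
  qed
  finally show ?case unfolding perm_exp_cmult using Suc t by simp
qed

text \<open>An exact formula is needed, not just a bound: since the processes are divided by their
  standard deviation, both a lower bound on the variance and its regularity in \<open>t\<close> will
  be read off from it.\<close>

lemma perm_exp_quad_square:
  assumes n: "4 \<le> n"
  shows "t \<le> n \<Longrightarrow> perm_exp n (\<lambda>\<pi>. (quad (first_obs n t \<pi>))\<^sup>2) =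
     total_norm / 2 * (real t * (real t - 1) * (real n - real t) * (real n - real t - 1))
        / (real n * (real n - 1) * (real n - 2) * (real n - 3))"
proof (induction t)
  case 0
  have "perm_exp n (\<lambda>\<pi>. (quad (first_obs n 0 \<pi>))\<^sup>2) = perm_exp n (\<lambda>_. 0)"
    by (rule perm_exp_cong) (simp add: first_obs_0)
  then show ?case by simp
next
  case (Suc t)
  then have t: "t < n" by simp
  define K where "K = real n - real t"
  have K: "K > 0" using t by (simp add: K_def)
  have "perm_exp n (\<lambda>\<pi>. (quad (first_obs n (Suc t) \<pi>))\<^sup>2) =
    perm_exp n (\<lambda>\<pi>. (\<Sum>v\<in>{1..n} - first_obs n t \<pi>. (quad (insert v (first_obs n t \<pi>)))\<^sup>2) / (real n - real t))"
    by (rule perm_exp_first_obs_Suc[OF t])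
  also have "\<dots> = perm_exp n (\<lambda>\<pi>. ((K - 4) * (quad (first_obs n t \<pi>))\<^sup>2
      + (\<Sum>v\<in>{1..n}. of_bool (v \<notin> first_obs n t \<pi>) * (lin v (first_obs n t \<pi>))\<^sup>2)) / K)"
    using t by (intro perm_exp_cong) (simp only: quad_sum_insert_square less_imp_le K_def)
  also have "\<dots> = ((K - 4) * perm_exp n (\<lambda>\<pi>. (quad (first_obs n t \<pi>))\<^sup>2)
      + (\<Sum>v\<in>{1..n}. perm_exp n (\<lambda>\<pi>. of_bool (v \<notin> first_obs n t \<pi>) * (lin v (first_obs n t \<pi>))\<^sup>2))) / K"
    by (simp only: perm_exp_divide perm_exp_add perm_exp_cmult perm_exp_sum)
  also have "(\<Sum>v\<in>{1..n}. perm_exp n (\<lambda>\<pi>. of_bool (v \<notin> first_obs n t \<pi>) * (lin v (first_obs n t \<pi>))\<^sup>2))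
     = total_norm * (real t * K * (K - 1)) / (real n * (real n - 1) * (real n - 2))"
    unfolding total_norm_def sum_distrib_right sum_divide_distrib
    using t n by (intro sum.cong refl) (simp add: perm_exp_lin_square K_def)
  also have "perm_exp n (\<lambda>\<pi>. (quad (first_obs n t \<pi>))\<^sup>2) = total_norm / 2 * (real t * (real t - 1) * K * (K - 1))
        / (real n * (real n - 1) * (real n - 2) * (real n - 3))"
    using Suc t by (simp add: K_def)
  also have "((K - 4) * (total_norm / 2 * (real t * (real t - 1) * K * (K - 1))
        / (real n * (real n - 1) * (real n - 2) * (real n - 3)))
      + total_norm * (real t * K * (K - 1)) / (real n * (real n - 1) * (real n - 2))) / K
    = total_norm / 2 * (real t * (K - 1) * ((real t - 1) * (K - 4) + 2 * (real n - 3)))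
        / (real n * (real n - 1) * (real n - 2) * (real n - 3))"
    using K n by (simp add: divide_simps) (simp add: algebra_simps)
  also have "(real t - 1) * (K - 4) + 2 * (real n - 3) = (real t + 1) * (K - 2)"
    by (simp add: K_def algebra_simps)
  finally show ?case by (simp add: K_def algebra_simps)
qed

end

section \<open>The stopped martingale\<close>

lemma adaptedD:
  "adapted n t g \<Longrightarrow> \<pi> \<in> perms n \<Longrightarrow> \<sigma> \<in> perms n \<Longrightarrow>
    (\<And>s. s \<le> t \<Longrightarrow> first_obs n s \<pi> = first_obs n s \<sigma>) \<Longrightarrow> g \<pi> = g \<sigma>"
  unfolding adapted_def by blast

lemma adaptedI:
  "(\<And>\<pi> \<sigma>. \<pi> \<in> perms n \<Longrightarrow> \<sigma> \<in> perms n \<Longrightarrow>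
    (\<And>s. s \<le> t \<Longrightarrow> first_obs n s \<pi> = first_obs n s \<sigma>) \<Longrightarrow> g \<pi> = g \<sigma>) \<Longrightarrow> adapted n t g"
  unfolding adapted_def by blast

context degenerate_kernel
begin

text \<open>The numerator does not depend on \<open>t\<close> and only normalises: it keeps the
  scaling between fixed positive bounds while \<open>n - t\<close> is of order
  \<open>n\<close>.\<close>

definition mscale :: "nat \<Rightarrow> real" where
  "mscale t = (real n)\<^sup>2 / ((real n - real t) * (real n - real t - 1))"

text \<open>Given the first \<open>t\<close> arrivals, \<open>quad\<close> drifts by the factor \<open>1 - 2 / (n - t)\<close>; the scaling
  \<open>mscale\<close> compensates for this and yields a martingale.\<close>
definition mart :: "nat \<Rightarrow> (nat \<Rightarrow> nat) \<Rightarrow> real" where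
  "mart t \<pi> = mscale t * quad (first_obs n t \<pi>)"

text \<open>The second summand removes the mean drift, so this is the centred increment that
  \<open>mart\<close> receives when \<open>v\<close> is the next arrival.\<close>

definition incr :: "nat \<Rightarrow> nat \<Rightarrow> nat set \<Rightarrow> real" where
  "incr t v S = mscale (Suc t) * (lin v S + 2 * quad S / (real n - real t))"

lemma mart_Suc:
  assumes pi: "\<pi> \<in> perms n" and t: "t + 2 < n"
  shows "mart (Suc t) \<pi> = mart t \<pi> + incr t (inv \<pi> (Suc t)) (first_obs n t \<pi>)"
proof -
  let ?S = "first_obs n t \<pi>" and ?v = "inv \<pi> (Suc t)"
  define K where "K = real n - real t"
  have K: "K > 2" using t by (simp add: K_def)
  have "t \<le> n" using t by simp
  then have "inv \<pi> (Suc t) \<in> {1..n} - ?S" unfolding first_obs_compl[OF pi \<open>t \<le> n\<close>] using t by auto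
  then have "quad (first_obs n (Suc t) \<pi>) = quad ?S + lin ?v ?S"
    using t by (simp add: first_obs_Suc[OF pi] quad_insert)
  moreover have ms: "mscale (Suc t) = (real n)\<^sup>2 / ((K - 1) * (K - 2))" "mscale t = (real n)\<^sup>2 / (K * (K - 1))"
    by (simp_all add: mscale_def K_def algebra_simps)
  \<comment> \<open>The quotient of consecutive scalings equals the drift factor
    \<open>1 - 2 / K\<close>. The assumption \<open>t + 2 < n\<close> keeps \<open>K - 2\<close>
    positive.\<close>
  then have "mscale t = mscale (Suc t) * ((K - 2) / K)" using K by simp
  moreover have "mscale (Suc t) * (quad ?S + lin ?v ?S)
      = mscale (Suc t) * ((K - 2) / K) * quad ?S + mscale (Suc t) * (lin ?v ?S + 2 * quad ?S / K)"
    using K by (simp add: field_simps)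
  ultimately show ?thesis unfolding mart_def incr_def K_def[symmetric] by simp
qed

lemma mscale_bounds:
  assumes "0 < \<beta>" "\<beta> * real n \<le> real n - real t - 1" "0 < n"
  shows "0 \<le> mscale t" "mscale t \<le> 1 / \<beta>\<^sup>2"
proof -
  have "0 < \<beta> * real n" using assms by simp
  then have "(\<beta> * real n) * (\<beta> * real n) \<le> (real n - real t) * (real n - real t - 1)"
    using assms(2) by (intro mult_mono) auto
  moreover have "0 < (\<beta> * real n) * (\<beta> * real n)" using \<open>0 < \<beta> * real n\<close> by simp
  ultimately have "mscale t \<le> (real n)\<^sup>2 / ((\<beta> * real n) * (\<beta> * real n))" "0 \<le> mscale t"
    unfolding mscale_def by (auto intro!: divide_left_mono divide_nonneg_nonneg)
  then show "0 \<le> mscale t" "mscale t \<le> 1 / \<beta>\<^sup>2" using assms by (simp_all add: power2_eq_square)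
qed

text \<open>The martingale property, expressed as a vanishing average over the next arrival.\<close>

lemma sum_incr:
  assumes "\<pi> \<in> perms n" "t < n"
  shows "(\<Sum>v\<in>{1..n} - first_obs n t \<pi>. incr t v (first_obs n t \<pi>)) = 0"
  unfolding incr_def sum_distrib_left[symmetric] sum.distrib sum_lin_compl[OF first_obs_subset]
  using card_first_obs_compl[OF assms(1), of t] assms(2) by (simp add: of_nat_diff)

text \<open>The term \<open>2 * quad / (n - t)\<close> is minus the mean of \<open>lin\<close> over
  the remaining observations, and centring can only decrease a sum of squares. The scaling costs two
  factors \<open>1 / \<beta>\<^sup>2\<close>.\<close>

lemma sum_incr_square_le:
  assumes pi: "\<pi> \<in> perms n" and t: "t < n" and \<beta>: "0 < \<beta>" "\<beta> * real n \<le> real n - real t - 2"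
  shows "(\<Sum>v\<in>{1..n} - first_obs n t \<pi>. (incr t v (first_obs n t \<pi>))\<^sup>2)
      \<le> (\<Sum>v\<in>{1..n}. (lin v (first_obs n t \<pi>))\<^sup>2) / \<beta> ^ 4"
proof -
  let ?S = "first_obs n t \<pi>" let ?C = "{1..n} - ?S"
  define K where "K = real n - real t"
  define W where "W = quad ?S"
  have K: "K > 0" using t by (simp add: K_def)
  have m: "0 \<le> mscale (Suc t)" "mscale (Suc t) \<le> 1 / \<beta>\<^sup>2" using mscale_bounds[of \<beta> "Suc t"] \<beta> t by auto
  then have m2: "(mscale (Suc t))\<^sup>2 \<le> 1 / \<beta> ^ 4"
    using power_mono[OF m(2,1), of 2] by (simp add: power_divide)
  have "(\<Sum>v\<in>?C. (lin v ?S + 2 * W / K)\<^sup>2)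
      = (\<Sum>v\<in>?C. (lin v ?S)\<^sup>2 + 4 * W / K * lin v ?S + 4 * W\<^sup>2 / K\<^sup>2)"
    by (rule sum.cong) (auto simp: power2_eq_square algebra_simps)
  also have "\<dots> = (\<Sum>v\<in>?C. (lin v ?S)\<^sup>2) + 4 * W / K * (\<Sum>v\<in>?C. lin v ?S) + K * (4 * W\<^sup>2 / K\<^sup>2)"
    unfolding sum.distrib sum_distrib_left[symmetric]
    using card_first_obs_compl[OF pi, of t] t by (simp add: of_nat_diff K_def)
  also have "(\<Sum>v\<in>?C. lin v ?S) = - 2 * W" unfolding W_def by (rule sum_lin_compl[OF first_obs_subset])
  also have "(\<Sum>v\<in>?C. (lin v ?S)\<^sup>2) + 4 * W / K * (- 2 * W) + K * (4 * W\<^sup>2 / K\<^sup>2) = (\<Sum>v\<in>?C. (lin v ?S)\<^sup>2) - 4 * W\<^sup>2 / K"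
    using K by (simp add: power2_eq_square field_simps)
  also have "\<dots> \<le> (\<Sum>v\<in>?C. (lin v ?S)\<^sup>2)" using K by simp
  also have "\<dots> \<le> (\<Sum>v\<in>{1..n}. (lin v ?S)\<^sup>2)" by (rule sum_mono2) auto
  finally have "(\<Sum>v\<in>?C. (lin v ?S + 2 * W / K)\<^sup>2) \<le> (\<Sum>v\<in>{1..n}. (lin v ?S)\<^sup>2)" .
  then have "(mscale (Suc t))\<^sup>2 * (\<Sum>v\<in>?C. (lin v ?S + 2 * W / K)\<^sup>2) \<le> 1 / \<beta> ^ 4 * (\<Sum>v\<in>{1..n}. (lin v ?S)\<^sup>2)"
    by (intro mult_mono m2) (auto intro: sum_nonneg)
  then show ?thesis unfolding incr_def power_mult_distrib sum_distrib_left[symmetric]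
    by (simp add: W_def K_def)
qed

text \<open>Here \<mu> is minus the mean of \<open>lin\<close> over the complement. Two applications
  of Cauchy-Schwarz bound \<open>K * \<mu> ^ 4\<close> by the sum of fourth powers; together with
  \<open>(x + \<mu>) ^ 4 \<le> 8 * x ^ 4 + 8 * \<mu> ^ 4\<close> this gives the factor 16.\<close>

lemma sum_incr_pow4_le:
  assumes pi: "\<pi> \<in> perms n" and t: "t < n" and \<beta>: "0 < \<beta>" "\<beta> * real n \<le> real n - real t - 2"
  shows "(\<Sum>v\<in>{1..n} - first_obs n t \<pi>. incr t v (first_obs n t \<pi>) ^ 4)
      \<le> 16 * (\<Sum>v\<in>{1..n}. lin v (first_obs n t \<pi>) ^ 4) / \<beta> ^ 8"
proof -
  let ?S = "first_obs n t \<pi>" let ?C = "{1..n} - ?S"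
  define K where "K = real n - real t"
  define \<mu> where "\<mu> = 2 * quad ?S / K"
  have K: "K > 0" using t by (simp add: K_def)
  have card: "real (card ?C) = K" using card_first_obs_compl[OF pi, of t] t by (simp add: K_def of_nat_diff)
  have m: "0 \<le> mscale (Suc t)" "mscale (Suc t) \<le> 1 / \<beta>\<^sup>2" using mscale_bounds[of \<beta> "Suc t"] \<beta> t by auto
  then have m4: "mscale (Suc t) ^ 4 \<le> 1 / \<beta> ^ 8"
    using power_mono[OF m(2,1), of 4] by (simp add: power_divide power_mult[symmetric])
  have \<mu>: "(\<Sum>v\<in>?C. lin v ?S) = - (K * \<mu>)"
    unfolding sum_lin_compl[OF first_obs_subset] \<mu>_def using K by simp
  have "(\<Sum>v\<in>?C. lin v ?S)\<^sup>2 \<le> (\<Sum>v\<in>?C. (lin v ?S)\<^sup>2) * K"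
    using sum_squared_le_sum_of_squares[of "\<lambda>v. lin v ?S" ?C] card by simp
  then have "((\<Sum>v\<in>?C. lin v ?S)\<^sup>2)\<^sup>2 \<le> ((\<Sum>v\<in>?C. (lin v ?S)\<^sup>2) * K)\<^sup>2"
    by (rule power_mono) simp
  also have "\<dots> = (\<Sum>v\<in>?C. (lin v ?S)\<^sup>2)\<^sup>2 * K\<^sup>2" by (simp add: power_mult_distrib)
  also have "\<dots> \<le> ((\<Sum>v\<in>?C. ((lin v ?S)\<^sup>2)\<^sup>2) * K) * K\<^sup>2"
    using sum_squared_le_sum_of_squares[of "\<lambda>v. (lin v ?S)\<^sup>2" ?C] card by (intro mult_right_mono) auto
  finally have "K ^ 3 * (K * \<mu> ^ 4) \<le> K ^ 3 * (\<Sum>v\<in>?C. lin v ?S ^ 4)"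
    unfolding \<mu> by (simp add: power2_eq_square power4_eq_xxxx power3_eq_cube algebra_simps)
  then have \<mu>4: "K * \<mu> ^ 4 \<le> (\<Sum>v\<in>?C. lin v ?S ^ 4)" using K by simp
  have "(\<Sum>v\<in>?C. (lin v ?S + \<mu>) ^ 4) \<le> (\<Sum>v\<in>?C. 8 * lin v ?S ^ 4 + 8 * \<mu> ^ 4)"
  proof (rule sum_mono)
    fix v
    let ?x = "lin v ?S"
    have "(?x + \<mu>)\<^sup>2 \<le> 2 * ?x\<^sup>2 + 2 * \<mu>\<^sup>2"
      using zero_le_power2[of "?x - \<mu>"] by (simp add: power2_eq_square algebra_simps)
    then have "((?x + \<mu>)\<^sup>2)\<^sup>2 \<le> (2 * ?x\<^sup>2 + 2 * \<mu>\<^sup>2)\<^sup>2" by (rule power_mono) simp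
    also have "\<dots> \<le> 8 * (?x\<^sup>2)\<^sup>2 + 8 * (\<mu>\<^sup>2)\<^sup>2"
      using zero_le_power2[of "?x\<^sup>2 - \<mu>\<^sup>2"] by (simp add: power2_eq_square algebra_simps)
    finally show "(?x + \<mu>) ^ 4 \<le> 8 * ?x ^ 4 + 8 * \<mu> ^ 4" by (simp add: power_mult[symmetric])
  qed
  also have "\<dots> = 8 * (\<Sum>v\<in>?C. lin v ?S ^ 4) + 8 * (K * \<mu> ^ 4)"
    unfolding sum.distrib sum_distrib_left[symmetric] using card by simp
  also have "\<dots> \<le> 16 * (\<Sum>v\<in>?C. lin v ?S ^ 4)" using \<mu>4 by simp
  also have "\<dots> \<le> 16 * (\<Sum>v\<in>{1..n}. lin v ?S ^ 4)" by (intro mult_left_mono sum_mono2) auto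
  finally have "mscale (Suc t) ^ 4 * (\<Sum>v\<in>?C. (lin v ?S + \<mu>) ^ 4) \<le> 1 / \<beta> ^ 8 * (16 * (\<Sum>v\<in>{1..n}. lin v ?S ^ 4))"
    using m4 by (intro mult_mono) (auto intro: sum_nonneg)
  then show ?thesis unfolding incr_def power_mult_distrib sum_distrib_left[symmetric]
    by (simp add: \<mu>_def K_def)
qed

lemma perm_exp_lin_pow4_le:
  assumes "0 < \<beta>" "\<beta> \<le> 1" "\<beta> * real n \<le> real n - real t" "t \<le> n" "v \<in> {1..n}"
  shows "perm_exp n (\<lambda>\<pi>. lin v (first_obs n t \<pi>) ^ 4) \<le> 11 / \<beta>\<^sup>2 * (row_norm v)\<^sup>2"
proof -
  have n: "0 < n" using assms by auto
  have "perm_exp n (\<lambda>\<pi>. lin v (first_obs n t \<pi>) ^ 4) \<le> real t * (11 * (row_norm v)\<^sup>2 / (\<beta>\<^sup>2 * real n))"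
    unfolding lin_def row_norm_def by (rule perm_exp_linear_pow4_le[OF row_sum[OF assms(5)] assms(1-4)])
  also have "\<dots> \<le> real n * (11 * (row_norm v)\<^sup>2 / (\<beta>\<^sup>2 * real n))"
    using assms by (intro mult_right_mono) auto
  also have "\<dots> = 11 / \<beta>\<^sup>2 * (row_norm v)\<^sup>2" using n by simp
  finally show ?thesis .
qed

text \<open>Cauchy-Schwarz with weights \<open>row_norm v\<close>; where \<open>row_norm v = 0\<close>, also \<open>lin v S = 0\<close>.\<close>
lemma sum_lin_square_square_le:
  assumes "S \<subseteq> {1..n}"
  shows "(\<Sum>v\<in>{1..n}. (lin v S)\<^sup>2)\<^sup>2 \<le> total_norm * (\<Sum>v\<in>{1..n}. lin v S ^ 4 / row_norm v)"
proof -
  have 0: "lin v S = 0" if "row_norm v = 0" for v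
  proof -
    have "\<forall>i\<in>{1..n}. (c i v)\<^sup>2 = 0" using that unfolding row_norm_def by (subst (asm) sum_nonneg_eq_0_iff) auto
    then show ?thesis unfolding lin_def using assms by (intro sum.neutral) auto
  qed
  have "(\<Sum>v\<in>{1..n}. (lin v S)\<^sup>2) = (\<Sum>v\<in>{1..n}. sqrt (row_norm v) * ((lin v S)\<^sup>2 / sqrt (row_norm v)))"
    by (rule sum.cong) (auto simp: 0)
  then have "(\<Sum>v\<in>{1..n}. (lin v S)\<^sup>2)\<^sup>2
      \<le> (\<Sum>v\<in>{1..n}. (sqrt (row_norm v))\<^sup>2) * (\<Sum>v\<in>{1..n}. ((lin v S)\<^sup>2 / sqrt (row_norm v))\<^sup>2)"
    using Cauchy_Schwarz_ineq_sum[of "\<lambda>v. sqrt (row_norm v)" "\<lambda>v. (lin v S)\<^sup>2 / sqrt (row_norm v)" "{1..n}"] by simp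
  then show ?thesis
    by (simp add: total_norm_def row_norm_nonneg power_divide power_mult[symmetric])
qed

text \<open>The fourth moment of \<open>lin v\<close> is of order
  \<open>(row_norm v)\<^sup>2\<close>; dividing by the weight \<open>row_norm v\<close> and summing
  returns \<open>total_norm\<close>. Without weights one would get \<open>n\<close> times the sum of
  squared row norms, which is much larger when the degrees are uneven.\<close>

lemma perm_exp_sum_lin_square_square_le:
  assumes "0 < \<beta>" "\<beta> \<le> 1" "\<beta> * real n \<le> real n - real t" "t \<le> n"
  shows "perm_exp n (\<lambda>\<pi>. (\<Sum>v\<in>{1..n}. (lin v (first_obs n t \<pi>))\<^sup>2)\<^sup>2) \<le> 11 / \<beta>\<^sup>2 * total_norm\<^sup>2"
proof -
  have "perm_exp n (\<lambda>\<pi>. (\<Sum>v\<in>{1..n}. (lin v (first_obs n t \<pi>))\<^sup>2)\<^sup>2)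
     \<le> perm_exp n (\<lambda>\<pi>. total_norm * (\<Sum>v\<in>{1..n}. lin v (first_obs n t \<pi>) ^ 4 / row_norm v))"
    by (intro perm_exp_mono sum_lin_square_square_le first_obs_subset)
  also have "\<dots> = total_norm * (\<Sum>v\<in>{1..n}. perm_exp n (\<lambda>\<pi>. lin v (first_obs n t \<pi>) ^ 4) / row_norm v)"
    by (simp only: perm_exp_cmult perm_exp_sum perm_exp_divide)
  also have "\<dots> \<le> total_norm * (\<Sum>v\<in>{1..n}. 11 / \<beta>\<^sup>2 * row_norm v)"
  proof (intro mult_left_mono total_norm_nonneg sum_mono)
    fix v assume v: "v \<in> {1..n}"
    have "perm_exp n (\<lambda>\<pi>. lin v (first_obs n t \<pi>) ^ 4) / row_norm v \<le> 11 / \<beta>\<^sup>2 * (row_norm v)\<^sup>2 / row_norm v"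
      by (rule divide_right_mono[OF perm_exp_lin_pow4_le[OF assms v] row_norm_nonneg])
    then show "perm_exp n (\<lambda>\<pi>. lin v (first_obs n t \<pi>) ^ 4) / row_norm v \<le> 11 / \<beta>\<^sup>2 * row_norm v"
      by (simp add: power2_eq_square split: if_splits)
  qed
  also have "\<dots> = 11 / \<beta>\<^sup>2 * total_norm\<^sup>2"
    by (simp only: sum_distrib_left[symmetric] total_norm_def[symmetric]) (simp add: power2_eq_square)
  finally show ?thesis .
qed

text \<open>The displacement of \<open>mart\<close> after time \<open>s\<close>, frozen as soon as
  it reaches size \<open>l\<close>. If the displacement is ever that large, the final value is too,
  so Markov's inequality at the end of the interval controls the maximum over it.\<close>

primrec stopped :: "nat \<Rightarrow> real \<Rightarrow> nat \<Rightarrow> (nat \<Rightarrow> nat) \<Rightarrow> real" where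
  "stopped s l 0 \<pi> = 0"
| "stopped s l (Suc j) \<pi> = (if \<bar>stopped s l j \<pi>\<bar> < l then mart (s + Suc j) \<pi> - mart s \<pi> else stopped s l j \<pi>)"

lemma stopped_eq: "\<bar>stopped s l j \<pi>\<bar> < l \<Longrightarrow> stopped s l j \<pi> = mart (s + j) \<pi> - mart s \<pi>"
  by (cases j) (auto split: if_splits)

lemma stopped_ge:
  assumes "0 < l" "l \<le> \<bar>mart (s + i) \<pi> - mart s \<pi>\<bar>"
  shows "i \<le> j \<Longrightarrow> l \<le> \<bar>stopped s l j \<pi>\<bar>"
proof (induction j)
  case 0
  then show ?case using assms by simp
next
  case (Suc j)
  show ?case
  proof (cases "i \<le> j")
    case True
    then show ?thesis using Suc.IH by simp
  next
    case False
    then have "i = Suc j" using Suc.prems by simp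
    then show ?thesis using assms(2) by simp
  qed
qed

lemma stopped_Suc:
  assumes "\<pi> \<in> perms n" "s + j + 2 < n"
  shows "stopped s l (Suc j) \<pi> = stopped s l j \<pi>
     + of_bool (\<bar>stopped s l j \<pi>\<bar> < l) * incr (s + j) (inv \<pi> (Suc (s + j))) (first_obs n (s + j) \<pi>)"
  using mart_Suc[OF assms] stopped_eq[of s l j \<pi>] by auto

lemma adapted_stopped: "adapted n (s + j) (stopped s l j)"
proof (rule adaptedI)
  fix \<pi> \<sigma> assume *: "\<And>r. r \<le> s + j \<Longrightarrow> first_obs n r \<pi> = first_obs n r \<sigma>"
  have "i \<le> j \<Longrightarrow> stopped s l i \<pi> = stopped s l i \<sigma>" for i
  proof (induction i)
    case (Suc i)
    then show ?case using *[of s] *[of "s + Suc i"] by (simp add: mart_def)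
  qed simp
  then show "stopped s l j \<pi> = stopped s l j \<sigma>" by simp
qed

text \<open>The cubic term of the expansion averages to 0 by the martingale property. In the
  quadratic term the squared displacement and the squared \<open>lin\<close> sums are dependent;
  Young's inequality with a free weight \<theta> separates them, so that only their individual
  moments are needed.\<close>

lemma perm_exp_stopped_pow4_step:
  assumes \<beta>: "0 < \<beta>" "\<beta> \<le> 1" and t: "\<beta> * real n \<le> real n - real (s + j) - 2" and n: "0 < n" and \<theta>: "0 < \<theta>"
  shows "perm_exp n (\<lambda>\<pi>. stopped s l (Suc j) \<pi> ^ 4) \<le> perm_exp n (\<lambda>\<pi>. stopped s l j \<pi> ^ 4)
     + (4 * \<theta> * perm_exp n (\<lambda>\<pi>. stopped s l j \<pi> ^ 4)
        + 44 * total_norm\<^sup>2 / (\<theta> * \<beta> ^ 12) + 528 * (\<Sum>v\<in>{1..n}. (row_norm v)\<^sup>2) / \<beta> ^ 11) / real n"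
proof -
  define u where "u = s + j"
  define D where "D = stopped s l j"
  define L2 where "L2 \<pi> = (\<Sum>v\<in>{1..n}. (lin v (first_obs n u \<pi>))\<^sup>2)" for \<pi>
  define L4 where "L4 \<pi> = (\<Sum>v\<in>{1..n}. lin v (first_obs n u \<pi>) ^ 4)" for \<pi>
  have \<beta>n: "0 < \<beta> * real n" using \<beta> n by simp
  have u: "u + 2 < n" "u < n" "u \<le> n" "\<beta> * real n \<le> real n - real u" "\<beta> * real n \<le> real n - real u - 2"
    using t \<beta>n unfolding u_def by linarith+
  define H where "H v \<pi> = (D \<pi> + of_bool (\<bar>D \<pi>\<bar> < l) * incr u v (first_obs n u \<pi>)) ^ 4" for v \<pi>
  have "adapted n u (H v)" for v
  proof (rule adaptedI)
    fix \<pi> \<sigma> assume *: "\<pi> \<in> perms n" "\<sigma> \<in> perms n" "\<And>r. r \<le> u \<Longrightarrow> first_obs n r \<pi> = first_obs n r \<sigma>"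
    then have "D \<pi> = D \<sigma>" unfolding D_def u_def by (intro adaptedD[OF adapted_stopped])
    then show "H v \<pi> = H v \<sigma>" using *(3)[of u] by (simp add: H_def)
  qed
  have "perm_exp n (\<lambda>\<pi>. stopped s l (Suc j) \<pi> ^ 4) = perm_exp n (\<lambda>\<pi>. H (inv \<pi> (Suc u)) \<pi>)"
    using u(1) unfolding u_def by (intro perm_exp_cong) (simp only: stopped_Suc H_def D_def u_def)
  also have "\<dots> = perm_exp n (\<lambda>\<pi>. (\<Sum>v\<in>{1..n} - first_obs n u \<pi>. H v \<pi>) / (real n - real u))"
    by (rule perm_exp_next_arrival) fact+
  also have "\<dots> \<le> perm_exp n (\<lambda>\<pi>. D \<pi> ^ 4 + (4 * \<theta> * D \<pi> ^ 4
       + 4 / (\<theta> * \<beta> ^ 10) * (L2 \<pi>)\<^sup>2 + 48 / \<beta> ^ 9 * L4 \<pi>) / real n)"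
  proof (rule perm_exp_mono)
    fix \<pi> assume pi: "\<pi> \<in> perms n"
    let ?S = "first_obs n u \<pi>" let ?C = "{1..n} - ?S"
    define K where "K = real n - real u"
    have K: "K > 0" "\<beta> * real n \<le> K" using u by (auto simp: K_def)
    have card: "real (card ?C) = K" using card_first_obs_compl[OF pi u(3)] u by (simp add: K_def of_nat_diff)
    \<comment> \<open>The indicator of not having been stopped depends only on the arrivals so far,
      hence factors out of the sums over the next arrival.\<close>
    define g :: real where "g = of_bool (\<bar>D \<pi>\<bar> < l)"
    have g: "0 \<le> g" "g \<le> 1" "g\<^sup>2 \<le> 1" "g ^ 4 \<le> 1" by (simp_all add: g_def)
    let ?x = "\<lambda>v. incr u v ?S"
    have L0: "0 \<le> L2 \<pi>" "0 \<le> L4 \<pi>" by (auto simp: L2_def L4_def intro!: sum_nonneg)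
    have sq: "g\<^sup>2 * (\<Sum>v\<in>?C. (?x v)\<^sup>2) \<le> L2 \<pi> / \<beta> ^ 4"
      using mult_mono[OF g(3) sum_incr_square_le[OF pi u(2) \<beta>(1) u(5)]]
      by (simp add: L2_def sum_nonneg)
    have p4: "g ^ 4 * (\<Sum>v\<in>?C. ?x v ^ 4) \<le> 16 * L4 \<pi> / \<beta> ^ 8"
      using mult_mono[OF g(4) sum_incr_pow4_le[OF pi u(2) \<beta>(1) u(5)]]
      by (simp add: L4_def sum_nonneg)
    have "(\<Sum>v\<in>?C. H v \<pi>) \<le> (\<Sum>v\<in>?C. D \<pi> ^ 4 + 4 * D \<pi> ^ 3 * g * ?x v + 8 * (D \<pi>)\<^sup>2 * g\<^sup>2 * (?x v)\<^sup>2 + 3 * g ^ 4 * ?x v ^ 4)"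
    proof (rule sum_mono)
      fix v
      show "H v \<pi> \<le> D \<pi> ^ 4 + 4 * D \<pi> ^ 3 * g * ?x v + 8 * (D \<pi>)\<^sup>2 * g\<^sup>2 * (?x v)\<^sup>2 + 3 * g ^ 4 * ?x v ^ 4"
        using add_pow4_le[of "D \<pi>" "g * ?x v"] unfolding H_def g_def[symmetric]
        by (simp add: power_mult_distrib mult.assoc)
    qed
    also have "\<dots> = K * D \<pi> ^ 4 + 8 * (D \<pi>)\<^sup>2 * (g\<^sup>2 * (\<Sum>v\<in>?C. (?x v)\<^sup>2)) + 3 * (g ^ 4 * (\<Sum>v\<in>?C. ?x v ^ 4))"
      unfolding sum.distrib sum_distrib_left[symmetric] sum_incr[OF pi u(2)] using card by simp
    also have "\<dots> \<le> K * D \<pi> ^ 4 + 8 * (D \<pi>)\<^sup>2 * (L2 \<pi> / \<beta> ^ 4) + 3 * (16 * L4 \<pi> / \<beta> ^ 8)"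
      by (intro add_mono mult_left_mono sq p4) (use K(1) in simp_all)
    finally have "(\<Sum>v\<in>?C. H v \<pi>) / K \<le> (K * D \<pi> ^ 4 + 8 * (D \<pi>)\<^sup>2 * (L2 \<pi> / \<beta> ^ 4) + 3 * (16 * L4 \<pi> / \<beta> ^ 8)) / K"
      by (rule divide_right_mono) (rule less_imp_le[OF K(1)])
    also have "\<dots> = D \<pi> ^ 4 + (8 * (D \<pi>)\<^sup>2 * (L2 \<pi> / \<beta> ^ 4) + 3 * (16 * L4 \<pi> / \<beta> ^ 8)) / K"
      using K by (simp add: add_divide_distrib)
    also have "(8 * (D \<pi>)\<^sup>2 * (L2 \<pi> / \<beta> ^ 4) + 3 * (16 * L4 \<pi> / \<beta> ^ 8)) / K
       \<le> (8 * (D \<pi>)\<^sup>2 * (L2 \<pi> / \<beta> ^ 4) + 3 * (16 * L4 \<pi> / \<beta> ^ 8)) / (\<beta> * real n)"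
      using K \<beta>n L0 \<beta> by (intro divide_left_mono) auto
    also have "\<dots> = (8 * ((D \<pi>)\<^sup>2 * (L2 \<pi> / \<beta> ^ 5)) + 48 / \<beta> ^ 9 * L4 \<pi>) / real n"
      using \<beta> n by (simp add: divide_simps power_numeral_reduce)
    also have "\<dots> \<le> (4 * \<theta> * D \<pi> ^ 4 + 4 / (\<theta> * \<beta> ^ 10) * (L2 \<pi>)\<^sup>2 + 48 / \<beta> ^ 9 * L4 \<pi>) / real n"
    proof -
      \<comment> \<open>Young's inequality by completing the square.\<close>
      have "0 \<le> 4 * \<theta> * ((D \<pi>)\<^sup>2 - L2 \<pi> / \<beta> ^ 5 / \<theta>)\<^sup>2" using \<theta> by simp
      also have "\<dots> = 4 * \<theta> * ((D \<pi>)\<^sup>2)\<^sup>2 + 4 / \<theta> * (L2 \<pi> / \<beta> ^ 5)\<^sup>2 - 8 * ((D \<pi>)\<^sup>2 * (L2 \<pi> / \<beta> ^ 5))"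
        using \<theta> by (simp add: power2_diff power_divide divide_simps) (simp add: algebra_simps power2_eq_square)
      finally have "8 * ((D \<pi>)\<^sup>2 * (L2 \<pi> / \<beta> ^ 5)) \<le> 4 * \<theta> * D \<pi> ^ 4 + 4 / (\<theta> * \<beta> ^ 10) * (L2 \<pi>)\<^sup>2"
        by (simp add: power_divide power_mult[symmetric])
      then show ?thesis by (intro divide_right_mono) auto
    qed
    finally show "(\<Sum>v\<in>?C. H v \<pi>) / (real n - real u) \<le> D \<pi> ^ 4 + (4 * \<theta> * D \<pi> ^ 4
       + 4 / (\<theta> * \<beta> ^ 10) * (L2 \<pi>)\<^sup>2 + 48 / \<beta> ^ 9 * L4 \<pi>) / real n"
      by (simp add: K_def)
  qed
  also have "\<dots> = perm_exp n (\<lambda>\<pi>. D \<pi> ^ 4) + (4 * \<theta> * perm_exp n (\<lambda>\<pi>. D \<pi> ^ 4)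
       + 4 / (\<theta> * \<beta> ^ 10) * perm_exp n (\<lambda>\<pi>. (L2 \<pi>)\<^sup>2) + 48 / \<beta> ^ 9 * perm_exp n L4) / real n"
    by (simp only: perm_exp_add perm_exp_divide perm_exp_cmult)
  also have "\<dots> \<le> perm_exp n (\<lambda>\<pi>. D \<pi> ^ 4) + (4 * \<theta> * perm_exp n (\<lambda>\<pi>. D \<pi> ^ 4)
       + 4 / (\<theta> * \<beta> ^ 10) * (11 / \<beta>\<^sup>2 * total_norm\<^sup>2) + 48 / \<beta> ^ 9 * (11 / \<beta>\<^sup>2 * (\<Sum>v\<in>{1..n}. (row_norm v)\<^sup>2))) / real n"
  proof (intro add_left_mono divide_right_mono add_mono mult_left_mono order_refl)
    show "perm_exp n (\<lambda>\<pi>. (L2 \<pi>)\<^sup>2) \<le> 11 / \<beta>\<^sup>2 * total_norm\<^sup>2"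
      unfolding L2_def by (rule perm_exp_sum_lin_square_square_le[OF \<beta> u(4,3)])
    show "perm_exp n L4 \<le> 11 / \<beta>\<^sup>2 * (\<Sum>v\<in>{1..n}. (row_norm v)\<^sup>2)"
      unfolding L4_def perm_exp_sum sum_distrib_left by (intro sum_mono perm_exp_lin_pow4_le[OF \<beta> u(4,3)])
  qed (use \<beta> \<theta> in auto)
  also have "4 / (\<theta> * \<beta> ^ 10) * (11 / \<beta>\<^sup>2 * total_norm\<^sup>2) = 44 * total_norm\<^sup>2 / (\<theta> * \<beta> ^ 12)"
    by (simp add: power_add[symmetric] mult.assoc)
  also have "48 / \<beta> ^ 9 * (11 / \<beta>\<^sup>2 * (\<Sum>v\<in>{1..n}. (row_norm v)\<^sup>2)) = 528 * (\<Sum>v\<in>{1..n}. (row_norm v)\<^sup>2) / \<beta> ^ 11"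
    by (simp add: power_add[symmetric])
  finally show ?thesis by (simp add: D_def)
qed

lemma perm_exp_stopped_pow4_le:
  assumes \<beta>: "0 < \<beta>" "\<beta> \<le> 1" and J: "\<beta> * real n \<le> real n - real (s + J) - 1" and n: "0 < n"
    and \<delta>: "real J \<le> \<delta> * real n" "0 < \<delta>"
  shows "perm_exp n (\<lambda>\<pi>. stopped s l J \<pi> ^ 4)
    \<le> 2 * \<delta> * (352 * \<delta> * total_norm\<^sup>2 / \<beta> ^ 12 + 528 * (\<Sum>v\<in>{1..n}. (row_norm v)\<^sup>2) / \<beta> ^ 11)"
proof -
  define \<kappa> where "\<kappa> = 352 * \<delta> * total_norm\<^sup>2 / \<beta> ^ 12 + 528 * (\<Sum>v\<in>{1..n}. (row_norm v)\<^sup>2) / \<beta> ^ 11"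
  have \<kappa>0: "0 \<le> \<kappa>" unfolding \<kappa>_def using \<delta> \<beta> by (intro add_nonneg_nonneg divide_nonneg_nonneg mult_nonneg_nonneg sum_nonneg) auto
  let ?f = "\<lambda>j. perm_exp n (\<lambda>\<pi>. stopped s l j \<pi> ^ 4)"
  have *: "j \<le> J \<Longrightarrow> ?f j \<le> real j * (2 * \<kappa> / real n)" for j
  proof (induction j)
    case (Suc j)
    have IH: "?f j \<le> real j * (2 * \<kappa> / real n)" using Suc by simp
    also have "\<dots> \<le> real J * (2 * \<kappa> / real n)" using Suc.prems \<kappa>0 by (intro mult_right_mono) auto
    also have "\<dots> \<le> (\<delta> * real n) * (2 * \<kappa> / real n)" using \<delta> \<kappa>0 by (intro mult_right_mono) auto
    also have "\<dots> = 2 * \<delta> * \<kappa>" using n by simp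
    \<comment> \<open>With \<theta> equal to \<open>1 / (8 * \<delta>)\<close>, the induction bound
      \<open>2 * \<delta> * \<kappa>\<close> turns the self-referential term into at most \<kappa>,
      so each step adds at most \<open>2 * \<kappa> / n\<close> and the induction closes. The
      constant 352 is 8 times 44.\<close>
    finally have fj: "4 * (1 / (8 * \<delta>)) * ?f j \<le> \<kappa>" using \<delta> by (simp add: field_simps)
    have "?f (Suc j) \<le> ?f j + (4 * (1 / (8 * \<delta>)) * ?f j
        + 44 * total_norm\<^sup>2 / (1 / (8 * \<delta>) * \<beta> ^ 12) + 528 * (\<Sum>v\<in>{1..n}. (row_norm v)\<^sup>2) / \<beta> ^ 11) / real n"
      using J Suc.prems \<delta> by (intro perm_exp_stopped_pow4_step \<beta> n) auto
    also have "44 * total_norm\<^sup>2 / (1 / (8 * \<delta>) * \<beta> ^ 12) = 352 * \<delta> * total_norm\<^sup>2 / \<beta> ^ 12" by simp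
    also have "?f j + (4 * (1 / (8 * \<delta>)) * ?f j + 352 * \<delta> * total_norm\<^sup>2 / \<beta> ^ 12 + 528 * (\<Sum>v\<in>{1..n}. (row_norm v)\<^sup>2) / \<beta> ^ 11) / real n
       \<le> real j * (2 * \<kappa> / real n) + 2 * \<kappa> / real n"
      using fj unfolding \<kappa>_def by (intro add_mono IH[unfolded \<kappa>_def] divide_right_mono) auto
    finally show ?case unfolding of_nat_Suc distrib_right by simp
  qed simp
  have "?f J \<le> real J * (2 * \<kappa> / real n)" using * by simp
  also have "\<dots> \<le> (\<delta> * real n) * (2 * \<kappa> / real n)" using \<delta> \<kappa>0 by (intro mult_right_mono) auto
  also have "\<dots> = 2 * \<delta> * \<kappa>" using n by simp
  finally show ?thesis by (simp add: \<kappa>_def)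
qed

lemma perm_prob_max_mart_le:
  assumes \<beta>: "0 < \<beta>" "\<beta> \<le> 1" and J: "\<beta> * real n \<le> real n - real (s + J) - 1" and n: "0 < n"
    and \<delta>: "real J \<le> \<delta> * real n" "0 < \<delta>" and l: "0 < l"
  shows "perm_prob n (\<lambda>\<pi>. \<exists>i\<le>J. l \<le> \<bar>mart (s + i) \<pi> - mart s \<pi>\<bar>)
    \<le> 2 * \<delta> * (352 * \<delta> * total_norm\<^sup>2 / \<beta> ^ 12 + 528 * (\<Sum>v\<in>{1..n}. (row_norm v)\<^sup>2) / \<beta> ^ 11) / l ^ 4"
proof -
  have "perm_prob n (\<lambda>\<pi>. \<exists>i\<le>J. l \<le> \<bar>mart (s + i) \<pi> - mart s \<pi>\<bar>) \<le> perm_exp n (\<lambda>\<pi>. stopped s l J \<pi> ^ 4) / l ^ 4"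
  proof (rule perm_prob_Markov)
    fix \<pi> assume "\<exists>i\<le>J. l \<le> \<bar>mart (s + i) \<pi> - mart s \<pi>\<bar>"
    then have "l \<le> \<bar>stopped s l J \<pi>\<bar>" using stopped_ge[OF l] by blast
    then have "l ^ 4 \<le> \<bar>stopped s l J \<pi>\<bar> ^ 4" using l by (intro power_mono) auto
    then show "l ^ 4 \<le> stopped s l J \<pi> ^ 4" by simp
  qed (use l in auto)
  also have "\<dots> \<le> 2 * \<delta> * (352 * \<delta> * total_norm\<^sup>2 / \<beta> ^ 12 + 528 * (\<Sum>v\<in>{1..n}. (row_norm v)\<^sup>2) / \<beta> ^ 11) / l ^ 4"
    by (intro divide_right_mono perm_exp_stopped_pow4_le[OF \<beta> J n \<delta>]) (use l in auto)
  finally show ?thesis .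
qed

end

section \<open>Oscillation of the standardised form\<close>

context degenerate_kernel
begin

text \<open>Since \<open>quad\<close> has mean 0, its second moment is its variance.\<close>

definition sd :: "nat \<Rightarrow> real" where
  "sd t = sqrt (perm_exp n (\<lambda>\<pi>. (quad (first_obs n t \<pi>))\<^sup>2))"

definition std_quad :: "nat \<Rightarrow> (nat \<Rightarrow> nat) \<Rightarrow> real" where
  "std_quad t \<pi> = quad (first_obs n t \<pi>) / sd t"

lemma sd_square: "(sd t)\<^sup>2 = perm_exp n (\<lambda>\<pi>. (quad (first_obs n t \<pi>))\<^sup>2)"
  unfolding sd_def by (rule real_sqrt_pow2) (simp add: perm_exp_nonneg)

lemma sd_nonneg: "0 \<le> sd t"
  unfolding sd_def by (simp add: perm_exp_nonneg)

lemma perm_prob_std_quad_le: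
  assumes "0 < L"
  shows "perm_prob n (\<lambda>\<pi>. L \<le> \<bar>std_quad t \<pi>\<bar>) \<le> 1 / L\<^sup>2"
proof -
  have "perm_prob n (\<lambda>\<pi>. L \<le> \<bar>std_quad t \<pi>\<bar>) \<le> perm_exp n (\<lambda>\<pi>. (std_quad t \<pi>)\<^sup>2) / L\<^sup>2"
  proof (rule perm_prob_Markov)
    fix \<pi> assume "L \<le> \<bar>std_quad t \<pi>\<bar>"
    then have "L\<^sup>2 \<le> \<bar>std_quad t \<pi>\<bar>\<^sup>2" using assms by (intro power_mono) auto
    then show "L\<^sup>2 \<le> (std_quad t \<pi>)\<^sup>2" by simp
  qed (use assms in auto)
  also have "perm_exp n (\<lambda>\<pi>. (std_quad t \<pi>)\<^sup>2) = (sd t)\<^sup>2 / (sd t)\<^sup>2"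
    unfolding std_quad_def power_divide perm_exp_divide by (simp add: sd_square)
  \<comment> \<open>An inequality rather than an equality, because the quotient is 0 when the
    variance vanishes.\<close>
  also have "\<dots> / L\<^sup>2 \<le> 1 / L\<^sup>2" by (intro divide_right_mono) (auto simp: divide_self_if)
  finally show ?thesis .
qed

lemma mscale_sd_square:
  assumes n: "4 \<le> n" and t: "t + 2 \<le> n"
  shows "(mscale t * sd t)\<^sup>2 = total_norm / 2 * (real n ^ 4 / (real n * (real n - 1) * (real n - 2) * (real n - 3)))
     * (real t * (real t - 1) / ((real n - real t) * (real n - real t - 1)))"
proof -
  define K where "K = real n - real t"
  define D where "D = real n * (real n - 1) * (real n - 2) * (real n - 3)"
  have K: "K > 1" using t by (simp add: K_def)
  have D: "D \<noteq> 0" using n by (simp add: D_def)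
  show ?thesis
    unfolding power_mult_distrib sd_square using perm_exp_quad_square[OF n, of t] t K D
    unfolding mscale_def K_def[symmetric] D_def[symmetric]
    by (simp add: power2_eq_square power4_eq_xxxx ac_simps)
qed

end

lemma one_minus_mult_le:
  fixes x y :: real
  assumes "x \<le> 1" "y \<le> 1"
  shows "1 - x * y \<le> (1 - x) + (1 - y)"
  using mult_nonneg_nonneg[of "1 - x" "1 - y"] assms by (simp add: algebra_simps)

text \<open>The ratio is a product of four quotients in [0, 1]. In each, both numbers are at least
  \<open>\<beta> n\<close> and differ by at most \<open>\<delta> n\<close>, so it falls short of 1
  by at most \<open>\<delta> / \<beta>\<close>; these deficits add up.\<close>

lemma variance_ratio_bounds:
  fixes s t n \<beta> \<delta> :: real
  assumes "0 < \<beta>" "0 < n" "\<beta> * n \<le> s - 1" "s \<le> t" "\<beta> * n \<le> n - t - 1" "t - s \<le> \<delta> * n"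
  defines "\<rho> \<equiv> (s * (s - 1) / ((n - s) * (n - s - 1))) / (t * (t - 1) / ((n - t) * (n - t - 1)))"
  shows "0 \<le> \<rho>" "\<rho> \<le> 1" "1 - \<rho> \<le> 4 * \<delta> / \<beta>"
proof -
  have \<beta>n: "0 < \<beta> * n" using assms by simp
  have eq: "\<rho> = (s / t) * ((s - 1) / (t - 1)) * (((n - t) / (n - s)) * ((n - t - 1) / (n - s - 1)))"
    unfolding \<rho>_def by simp
  have r: "0 \<le> x / y \<and> x / y \<le> 1 \<and> 1 - x / y \<le> \<delta> / \<beta>"
    if "0 < \<beta> * n" "\<beta> * n \<le> x" "x \<le> y" "y - x \<le> \<delta> * n" for x y
  proof -
    have "0 < x" "0 < y" using that by linarith+
    then have "1 - x / y = (y - x) / y" by (simp add: field_simps)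
    also have "\<dots> \<le> (\<delta> * n) / (\<beta> * n)" using that by (intro frac_le) auto
    also have "\<dots> = \<delta> / \<beta>" using assms(2) by simp
    finally show ?thesis using \<open>0 < x\<close> \<open>0 < y\<close> \<open>x \<le> y\<close> by simp
  qed
  note x = r[OF \<beta>n, of s t] r[OF \<beta>n, of "s - 1" "t - 1"] r[OF \<beta>n, of "n - t" "n - s"] r[OF \<beta>n, of "n - t - 1" "n - s - 1"]
  have x1: "0 \<le> s / t \<and> s / t \<le> 1 \<and> 1 - s / t \<le> \<delta> / \<beta>" using assms by (intro x(1)) auto
  have x2: "0 \<le> (s - 1) / (t - 1) \<and> (s - 1) / (t - 1) \<le> 1 \<and> 1 - (s - 1) / (t - 1) \<le> \<delta> / \<beta>" using assms by (intro x(2)) auto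
  have x3: "0 \<le> (n - t) / (n - s) \<and> (n - t) / (n - s) \<le> 1 \<and> 1 - (n - t) / (n - s) \<le> \<delta> / \<beta>" using assms by (intro x(3)) auto
  have x4: "0 \<le> (n - t - 1) / (n - s - 1) \<and> (n - t - 1) / (n - s - 1) \<le> 1 \<and> 1 - (n - t - 1) / (n - s - 1) \<le> \<delta> / \<beta>" using assms by (intro x(4)) auto
  have a: "0 \<le> s / t * ((s - 1) / (t - 1))" "s / t * ((s - 1) / (t - 1)) \<le> 1"
    using x1 x2 by (simp_all only: mult_nonneg_nonneg mult_le_one)
  have b: "0 \<le> (n - t) / (n - s) * ((n - t - 1) / (n - s - 1))" "(n - t) / (n - s) * ((n - t - 1) / (n - s - 1)) \<le> 1"
    using x3 x4 by (simp_all only: mult_nonneg_nonneg mult_le_one)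
  show "0 \<le> \<rho>" unfolding eq using a(1) b(1) by (rule mult_nonneg_nonneg)
  show "\<rho> \<le> 1" unfolding eq using a b by (simp only: mult_le_one)
  have "1 - \<rho> \<le> (1 - s / t * ((s - 1) / (t - 1))) + (1 - (n - t) / (n - s) * ((n - t - 1) / (n - s - 1)))"
    unfolding eq by (rule one_minus_mult_le[OF a(2) b(2)])
  also have "\<dots> \<le> ((1 - s / t) + (1 - (s - 1) / (t - 1))) + ((1 - (n - t) / (n - s)) + (1 - (n - t - 1) / (n - s - 1)))"
    using x1 x2 x3 x4 by (intro add_mono one_minus_mult_le) auto
  also have "\<dots> \<le> 4 * (\<delta> / \<beta>)" using x1 x2 x3 x4 by linarith
  finally show "1 - \<rho> \<le> 4 * \<delta> / \<beta>" by simp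
qed

context degenerate_kernel
begin

text \<open>The standardised form is \<open>mart\<close> divided by \<open>mscale t * sd t\<close>.
  Bounded below and almost constant over short times, this divisor lets oscillations of
  \<open>mart\<close> control those of \<open>std_quad\<close>.\<close>

lemma mscale_sd_bounds:
  assumes n: "4 \<le> n" and A: "0 < total_norm" and \<beta>: "0 < \<beta>"
    and s: "\<beta> * real n \<le> real s - 1" and st: "s \<le> t" and t: "\<beta> * real n \<le> real n - real t - 1"
    and \<delta>: "real t - real s \<le> \<delta> * real n"
  shows "\<beta> * sqrt (total_norm / 2) \<le> mscale t * sd t"
    and "mscale s * sd s \<le> mscale t * sd t"
    and "1 - (mscale s * sd s) / (mscale t * sd t) \<le> 4 * \<delta> / \<beta>"
proof -
  define B where "B = total_norm / 2 * (real n ^ 4 / (real n * (real n - 1) * (real n - 2) * (real n - 3)))"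
  define g where "g t = real t * (real t - 1) / ((real n - real t) * (real n - real t - 1))" for t
  have \<beta>n: "0 < \<beta> * real n" using \<beta> n by simp
  have h: "(mscale r * sd r)\<^sup>2 = B * g r" if "\<beta> * real n \<le> real n - real r - 1" for r
    unfolding B_def g_def by (rule mscale_sd_square[OF n]) (use that \<beta>n in linarith)
  have nn: "0 \<le> mscale r * sd r" if "\<beta> * real n \<le> real n - real r - 1" for r
    using mscale_bounds(1)[OF \<beta> that] n sd_nonneg by simp
  have s': "\<beta> * real n \<le> real n - real s - 1" and t': "\<beta> * real n \<le> real t - 1" using st s t by auto
  have "0 < (real n * (real n - 1) * (real n - 2) * (real n - 3))" using n by simp
  moreover have "(real n * (real n - 1) * (real n - 2) * (real n - 3)) \<le> real n * real n * real n * real n"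
    using n by (intro mult_mono) auto
  ultimately have "1 \<le> real n ^ 4 / (real n * (real n - 1) * (real n - 2) * (real n - 3))"
    by (subst le_divide_eq_1_pos) (simp_all only: power4_eq_xxxx)
  then have "total_norm / 2 * 1 \<le> B" unfolding B_def using A by (intro mult_left_mono) auto
  then have B: "total_norm / 2 \<le> B" by simp
  have g: "\<beta>\<^sup>2 \<le> g r" if "\<beta> * real n \<le> real r - 1" "\<beta> * real n \<le> real n - real r - 1" for r
  proof -
    have "(\<beta> * real n) * (\<beta> * real n) \<le> real r * (real r - 1)" using that \<beta>n by (intro mult_mono) auto
    moreover have "(real n - real r) * (real n - real r - 1) \<le> real n * real n" using that \<beta>n by (intro mult_mono) auto
    moreover have "0 < (real n - real r) * (real n - real r - 1)" using that \<beta>n by (intro mult_pos_pos) auto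
    ultimately have "((\<beta> * real n) * (\<beta> * real n)) / (real n * real n) \<le> g r"
      unfolding g_def
    proof (intro frac_le)
      show "0 \<le> real r * (real r - 1)" using that \<beta>n by (intro mult_nonneg_nonneg) linarith+
    qed
    then show ?thesis using n by (simp add: power2_eq_square)
  qed
  note gs = g[OF s s'] and gt = g[OF t' t]
  have gpos: "0 < g s" "0 < g t" using gs gt \<beta> by (auto intro: less_le_trans[OF zero_less_power])
  have Bpos: "0 < B" using A B by linarith
  have "(\<beta> * sqrt (total_norm / 2))\<^sup>2 \<le> (mscale t * sd t)\<^sup>2"
  proof -
    have "(\<beta> * sqrt (total_norm / 2))\<^sup>2 = total_norm / 2 * \<beta>\<^sup>2" using A by (simp add: power_mult_distrib)
    also have "\<dots> \<le> B * g t" using A Bpos by (intro mult_mono B gt) auto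
    finally show ?thesis unfolding h[OF t] .
  qed
  then show lower: "\<beta> * sqrt (total_norm / 2) \<le> mscale t * sd t"
    by (rule power2_le_imp_le) (rule nn[OF t])
  have "0 < \<beta> * sqrt (total_norm / 2)" using \<beta> A by simp
  then have pos: "0 < mscale t * sd t" using lower by linarith
  have "real s \<le> real t" using st by simp
  note rb = variance_ratio_bounds[OF \<beta> _ s this t \<delta>]
  have rho: "0 \<le> g s / g t" "g s / g t \<le> 1" "1 - g s / g t \<le> 4 * \<delta> / \<beta>"
    using rb n unfolding g_def by auto
  have "(mscale s * sd s)\<^sup>2 \<le> (mscale t * sd t)\<^sup>2"
    unfolding h[OF t] h[OF s'] using rho(2) gpos Bpos by (simp add: field_simps)
  then show le: "mscale s * sd s \<le> mscale t * sd t" by (rule power2_le_imp_le) (rule nn[OF t])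
  let ?r = "(mscale s * sd s) / (mscale t * sd t)"
  have r: "0 \<le> ?r" "?r \<le> 1" using nn[OF s'] pos le by auto
  have "?r\<^sup>2 = g s / g t" unfolding power_divide h[OF t] h[OF s'] using Bpos by simp
  \<comment> \<open>From variances to standard deviations: since \<open>?r\<close> lies in [0, 1],
    its deficit from 1 is at most that of its square.\<close>
  moreover have "?r\<^sup>2 \<le> ?r" unfolding power2_eq_square by (rule mult_left_le[OF r(2,1)])
  ultimately show "1 - ?r \<le> 4 * \<delta> / \<beta>" using rho(3) by linarith
qed

lemma perm_prob_std_quad_osc_le:
  assumes n: "4 \<le> n" and A: "0 < total_norm" and \<beta>: "0 < \<beta>" "\<beta> \<le> 1" and e: "0 < e"
    and s: "\<beta> * real n \<le> real s - 1" and J: "\<beta> * real n \<le> real n - real (s + J) - 1"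
    and \<delta>: "real J \<le> \<delta> * real n" "0 < \<delta>"
  shows "perm_prob n (\<lambda>\<pi>. \<exists>i\<le>J. e < \<bar>std_quad (s + i) \<pi> - std_quad s \<pi>\<bar>)
    \<le> (45056 / (\<beta> ^ 16 * e ^ 4) + 64 / (e\<^sup>2 * \<beta>\<^sup>2)) * \<delta>\<^sup>2
      + 67584 / (\<beta> ^ 15 * e ^ 4) * \<delta> * ((\<Sum>v\<in>{1..n}. (row_norm v)\<^sup>2) / total_norm\<^sup>2)"
proof -
  \<comment> \<open>An oscillation of \<open>std_quad\<close> splits into the increment of
    \<open>mart\<close> over the new divisor and the relative change of divisor times the old value.
    The threshold \<open>l\<close> makes the first part at most \<open>e / 2\<close>, and
    \<open>L\<close> the second. As \<open>L\<close> is of order \<open>1 / \<delta>\<close>,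
    Chebyshev's inequality again costs the square of \<delta>.\<close>
  define l where "l = e / 2 * (\<beta> * sqrt (total_norm / 2))"
  define L where "L = e * \<beta> / (8 * \<delta>)"
  define \<Gamma> where "\<Gamma> = (\<Sum>v\<in>{1..n}. (row_norm v)\<^sup>2)"
  have l: "0 < l" unfolding l_def using e \<beta> A by simp
  have L: "0 < L" unfolding L_def using e \<beta> \<delta> by simp
  have l4: "l ^ 4 = e ^ 4 * \<beta> ^ 4 * total_norm\<^sup>2 / 64"
  proof -
    have "sqrt (total_norm / 2) ^ 4 = (total_norm / 2)\<^sup>2"
      using A power_mult[of "sqrt (total_norm / 2)" 2 2] by simp
    then show ?thesis unfolding l_def power_mult_distrib by (simp add: power_divide)
  qed
  have *: "(\<exists>i\<le>J. l \<le> \<bar>mart (s + i) \<pi> - mart s \<pi>\<bar>) \<or> L \<le> \<bar>std_quad s \<pi>\<bar>"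
    if ex: "\<exists>i\<le>J. e < \<bar>std_quad (s + i) \<pi> - std_quad s \<pi>\<bar>" for \<pi>
  proof (rule ccontr)
    assume "\<not> ?thesis"
    then have small: "i \<le> J \<Longrightarrow> \<bar>mart (s + i) \<pi> - mart s \<pi>\<bar> < l" and sL: "\<bar>std_quad s \<pi>\<bar> < L" for i
      by (metis not_le)+
    obtain i where i: "i \<le> J" "e < \<bar>std_quad (s + i) \<pi> - std_quad s \<pi>\<bar>" using ex by blast
    define t where "t = s + i"
    have t: "s \<le> t" "\<beta> * real n \<le> real n - real t - 1" "real t - real s \<le> \<delta> * real n"
      using i J \<delta> by (auto simp: t_def)
    note b = mscale_sd_bounds[OF n A \<beta>(1) s t]
    define r where "r = mscale s * sd s / (mscale t * sd t)"
    have "\<beta> * real n \<le> real n - real s - 1" "0 \<le> \<delta> * real n" using t \<delta> by auto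
    note b0 = mscale_sd_bounds[OF n A \<beta>(1) s order_refl this(1), of \<delta>]
    have p0: "0 < \<beta> * sqrt (total_norm / 2)" using \<beta> A by simp
    then have pt: "0 < mscale t * sd t" and ps: "0 < mscale s * sd s"
      using b(1) b0(1) \<delta> by auto
    have nz: "mscale t \<noteq> 0" "sd t \<noteq> 0" "mscale s \<noteq> 0" "sd s \<noteq> 0" using pt ps by auto
    have "std_quad t \<pi> - std_quad s \<pi> = (mart t \<pi> - mart s \<pi>) / (mscale t * sd t) - (1 - r) * std_quad s \<pi>"
      unfolding std_quad_def mart_def r_def using nz by (simp add: field_simps)
    then have "\<bar>std_quad t \<pi> - std_quad s \<pi>\<bar> \<le> \<bar>(mart t \<pi> - mart s \<pi>) / (mscale t * sd t)\<bar> + \<bar>(1 - r) * std_quad s \<pi>\<bar>"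
      by linarith
    also have "\<bar>(mart t \<pi> - mart s \<pi>) / (mscale t * sd t)\<bar> = \<bar>mart t \<pi> - mart s \<pi>\<bar> / (mscale t * sd t)"
      using pt by (simp add: abs_divide)
    also have "\<dots> \<le> l / (\<beta> * sqrt (total_norm / 2))"
      using small[OF i(1)] b(1) p0 l unfolding t_def by (intro frac_le) auto
    also have "\<dots> = e / 2"
      by (simp only: l_def nonzero_mult_div_cancel_right[OF less_imp_neq[OF p0, symmetric]])
    also have "\<bar>(1 - r) * std_quad s \<pi>\<bar> \<le> (4 * \<delta> / \<beta>) * L"
    proof -
      have "r \<le> 1" unfolding r_def using b(2) pt by simp
      moreover have "1 - r \<le> 4 * \<delta> / \<beta>" using b(3) unfolding r_def .
      ultimately show ?thesis unfolding abs_mult using sL by (intro mult_mono) auto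
    qed
    also have "(4 * \<delta> / \<beta>) * L = e / 2" unfolding L_def using \<beta> \<delta> by simp
    finally show False using i(2) unfolding t_def by simp
  qed
  have nn: "0 < n" using n by simp
  have "perm_prob n (\<lambda>\<pi>. \<exists>i\<le>J. e < \<bar>std_quad (s + i) \<pi> - std_quad s \<pi>\<bar>)
     \<le> perm_prob n (\<lambda>\<pi>. (\<exists>i\<le>J. l \<le> \<bar>mart (s + i) \<pi> - mart s \<pi>\<bar>) \<or> L \<le> \<bar>std_quad s \<pi>\<bar>)"
    by (rule perm_prob_mono) (rule *)
  also have "\<dots> \<le> perm_prob n (\<lambda>\<pi>. \<exists>i\<le>J. l \<le> \<bar>mart (s + i) \<pi> - mart s \<pi>\<bar>) + perm_prob n (\<lambda>\<pi>. L \<le> \<bar>std_quad s \<pi>\<bar>)"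
    by (rule perm_prob_disj)
  also have "\<dots> \<le> 2 * \<delta> * (352 * \<delta> * total_norm\<^sup>2 / \<beta> ^ 12 + 528 * \<Gamma> / \<beta> ^ 11) / l ^ 4 + 1 / L\<^sup>2"
    unfolding \<Gamma>_def by (intro add_mono perm_prob_max_mart_le[OF \<beta> J nn \<delta> l] perm_prob_std_quad_le[OF L])
  also have "1 / L\<^sup>2 = 64 / (e\<^sup>2 * \<beta>\<^sup>2) * \<delta>\<^sup>2" unfolding L_def by (simp add: power_divide power_mult_distrib)
  also have "2 * \<delta> * (352 * \<delta> * total_norm\<^sup>2 / \<beta> ^ 12 + 528 * \<Gamma> / \<beta> ^ 11) / l ^ 4
     = 45056 / (\<beta> ^ 16 * e ^ 4) * \<delta>\<^sup>2 + 67584 / (\<beta> ^ 15 * e ^ 4) * \<delta> * (\<Gamma> / total_norm\<^sup>2)"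
  proof -
    have "\<beta> ^ 16 = \<beta> ^ 12 * \<beta> ^ 4" "\<beta> ^ 15 = \<beta> ^ 11 * \<beta> ^ 4" by (simp_all add: power_add[symmetric])
    moreover have "2 * \<delta> * (352 * \<delta> * A\<^sup>2 / b12 + 528 * \<Gamma> / b11) / (e4 * b4 * A\<^sup>2 / 64)
      = 45056 / (b12 * b4 * e4) * \<delta>\<^sup>2 + 67584 / (b11 * b4 * e4) * \<delta> * (\<Gamma> / A\<^sup>2)"
      if "A \<noteq> 0" for A b12 b11 b4 e4 :: real
      using that by (simp add: distrib_left add_divide_distrib power2_eq_square ac_simps)
    ultimately show ?thesis unfolding l4 using A by (metis less_irrefl)
  qed
  finally show ?thesis by (simp add: \<Gamma>_def distrib_right)
qed

end

section \<open>Decomposition of the weighted edge count\<close>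

lemma graph_on_finite: "graph_on n G \<Longrightarrow> finite G"
  by (rule finite_subset[of _ "Pow {1..n}"]) (auto simp: graph_on_def)

lemma sum_adjacency:
  assumes "graph_on n G" "finite S" "i \<in> S"
  shows "(\<Sum>j\<in>S. of_bool ({i, j} \<in> G)) = real (card {e\<in>G. e \<subseteq> S \<and> i \<in> e})"
proof -
  have "bij_betw (\<lambda>j. {i, j}) {j\<in>S. {i, j} \<in> G} {e\<in>G. e \<subseteq> S \<and> i \<in> e}"
    unfolding bij_betw_def
  proof (intro conjI subset_antisym subsetI)
    show "inj_on (\<lambda>j. {i, j}) {j\<in>S. {i, j} \<in> G}" by (auto simp: inj_on_def doubleton_eq_iff)
    show "e \<in> {e\<in>G. e \<subseteq> S \<and> i \<in> e}" if "e \<in> (\<lambda>j. {i, j}) ` {j\<in>S. {i, j} \<in> G}" for e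
      using that assms(3) by auto
    fix e assume e: "e \<in> {e\<in>G. e \<subseteq> S \<and> i \<in> e}"
    then have "card e = 2" using assms(1) by (auto simp: graph_on_def)
    then obtain j where "e = {i, j}" using e by (auto simp: card_2_iff)
    then show "e \<in> (\<lambda>j. {i, j}) ` {j\<in>S. {i, j} \<in> G}" using e by auto
  qed
  then have "card {j\<in>S. {i, j} \<in> G} = card {e\<in>G. e \<subseteq> S \<and> i \<in> e}" by (rule bij_betw_same_card)
  then show ?thesis using assms(2) by (simp add: of_bool_def sum.If_cases Int_def)
qed

lemma sum_sum_adjacency:
  assumes G: "graph_on n G" and S: "finite S"
  shows "(\<Sum>i\<in>S. \<Sum>j\<in>S. of_bool ({i, j} \<in> G)) = 2 * real (card {e\<in>G. e \<subseteq> S})"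
proof -
  let ?H = "{e\<in>G. e \<subseteq> S}"
  have H: "finite ?H" using graph_on_finite[OF G] by simp
  have "(\<Sum>i\<in>S. \<Sum>j\<in>S. of_bool ({i, j} \<in> G)) = (\<Sum>i\<in>S. real (card {e\<in>G. e \<subseteq> S \<and> i \<in> e}))"
    by (rule sum.cong[OF refl sum_adjacency[OF G S]])
  also have "\<dots> = (\<Sum>i\<in>S. \<Sum>e\<in>?H. of_bool (i \<in> e))"
    using H by (intro sum.cong refl) (simp add: of_bool_def sum.If_cases Int_def)
  also have "\<dots> = (\<Sum>e\<in>?H. \<Sum>i\<in>S. of_bool (i \<in> e))" by (rule sum.swap)
  also have "\<dots> = (\<Sum>e\<in>?H. 2)"
  proof (rule sum.cong[OF refl])
    fix e assume e: "e \<in> ?H"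
    then have "card (S \<inter> e) = 2" using G by (simp add: graph_on_def Int_absorb1)
    then show "(\<Sum>i\<in>S. of_bool (i \<in> e)) = (2::real)"
      using S by (simp add: of_bool_def sum.If_cases)
  qed
  finally show ?thesis by simp
qed

lemma sum_adjacency_degree:
  assumes "graph_on n G" "i \<in> {1..n}"
  shows "(\<Sum>j\<in>{1..n}. of_bool ({i, j} \<in> G)) = real (degree G i)"
proof -
  have "{e\<in>G. e \<subseteq> {1..n} \<and> i \<in> e} = {e\<in>G. i \<in> e}" using assms(1) by (auto simp: graph_on_def)
  then show ?thesis using sum_adjacency[OF assms(1) finite_atLeastAtMost assms(2)] by (simp add: degree_def)
qed

lemma sum_degree:
  assumes "graph_on n G"
  shows "(\<Sum>i\<in>{1..n}. real (degree G i)) = 2 * real (card G)"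
proof -
  have "{e\<in>G. e \<subseteq> {1..n}} = G" using assms by (auto simp: graph_on_def)
  then have "2 * real (card G) = (\<Sum>i\<in>{1..n}. \<Sum>j\<in>{1..n}. of_bool ({i, j} \<in> G))"
    using sum_sum_adjacency[OF assms, of "{1..n}"] by simp
  also have "\<dots> = (\<Sum>i\<in>{1..n}. real (degree G i))"
    by (rule sum.cong[OF refl sum_adjacency_degree[OF assms]])
  finally show ?thesis by simp
qed

lemma singleton_notin_graph: "graph_on n G \<Longrightarrow> {i} \<notin> G"
  by (force simp: graph_on_def)

lemma degree_le:
  assumes "graph_on n G" "i \<in> {1..n}" shows "real (degree G i) \<le> real n"
proof -
  have "real (degree G i) \<le> (\<Sum>j\<in>{1..n}. 1)"
    unfolding sum_adjacency_degree[OF assms, symmetric] by (intro sum_mono) simp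
  then show ?thesis by simp
qed

text \<open>The first-order part of the Hoeffding decomposition of the adjacency matrix:
  the constants are fixed by the requirement that all rows of the remainder sum to zero.\<close>
definition main_effect :: "nat \<Rightarrow> nat set set \<Rightarrow> nat \<Rightarrow> real" where
  "main_effect n G i = (real (degree G i) - real (card G) / (real n - 1)) / (real n - 2)"

definition interaction :: "nat \<Rightarrow> nat set set \<Rightarrow> nat \<Rightarrow> nat \<Rightarrow> real" where
  "interaction n G i j = (if i = j then 0 else of_bool ({i, j} \<in> G) - main_effect n G i - main_effect n G j)"

lemma sum_main_effect:
  assumes "graph_on n G" "3 \<le> n"
  shows "(\<Sum>i\<in>{1..n}. main_effect n G i) = real (card G) / (real n - 1)"
proof -
  have "(\<Sum>i\<in>{1..n}. main_effect n G i) = (2 * real (card G) - real n * (real (card G) / (real n - 1))) / (real n - 2)"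
    unfolding main_effect_def sum_divide_distrib[symmetric] sum_subtractf sum_degree[OF assms(1)] by simp
  also have "\<dots> = real (card G) / (real n - 1)"
    using assms(2) by (simp add: divide_simps) (simp add: algebra_simps)
  finally show ?thesis .
qed

lemma degenerate_kernel_interaction:
  assumes G: "graph_on n G" and n: "3 \<le> n"
  shows "degenerate_kernel n (interaction n G)"
proof
  show "interaction n G i j = interaction n G j i" for i j
    by (auto simp: interaction_def insert_commute)
  show "interaction n G i i = 0" for i by (simp add: interaction_def)
  fix v assume v: "v \<in> {1..n}"
  let ?b = "main_effect n G"
  \<comment> \<open>The last summand restores the zero on the diagonal, where the off-diagonal
    formula would give minus twice the main effect.\<close>
  have "(\<Sum>i\<in>{1..n}. interaction n G i v) = (\<Sum>i\<in>{1..n}. of_bool ({v, i} \<in> G) - ?b i - ?b v + of_bool (i = v) * (2 * ?b v))"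
    by (rule sum.cong) (auto simp: interaction_def insert_commute singleton_notin_graph[OF G])
  also have "\<dots> = real (degree G v) - real (card G) / (real n - 1) - real n * ?b v + 2 * ?b v"
  proof -
    have "(\<Sum>i\<in>{1..n}. of_bool (i = v) * (2 * ?b v)) = 2 * ?b v"
      using v by (simp add: sum_distrib_right[symmetric] of_bool_def)
    then show ?thesis
      unfolding sum.distrib sum_subtractf sum_adjacency_degree[OF G v] sum_main_effect[OF G n] by simp
  qed
  also have "\<dots> = (real (degree G v) - real (card G) / (real n - 1)) - (real n - 2) * ?b v" by (simp add: algebra_simps)
  also have "\<dots> = 0" using n by (simp add: main_effect_def)
  finally show "(\<Sum>i\<in>{1..n}. interaction n G i v) = 0" .
qed

text \<open>With the weights \<open>pw\<close> and \<open>qw\<close> the first-order parts of \<open>R1\<close> and \<open>R2\<close> cancel.\<close>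
lemma Rw_eq_quad:
  assumes G: "graph_on n G" and n: "3 \<le> n" and pi: "\<pi> \<in> perms n" and t: "t \<le> n"
  shows "Rw n G \<pi> t = degenerate_kernel.quad (interaction n G) (first_obs n t \<pi>)
     + (real t - 1) * (real n - real t - 1) / (real n - 2) * (real (card G) / (real n - 1))"
proof -
  interpret degenerate_kernel n "interaction n G" by (rule degenerate_kernel_interaction[OF G n])
  let ?b = "main_effect n G"
  \<comment> \<open>Each main effect is counted once for every partner inside \<open>S\<close>,
    hence the factor \<open>card S - 1\<close>.\<close>
  have edges: "real (card {e\<in>G. e \<subseteq> S}) = quad S + (real (card S) - 1) * (\<Sum>i\<in>S. ?b i)" if S: "finite S" for S
  proof -
    have "(\<Sum>i\<in>S. \<Sum>j\<in>S. interaction n G i j)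
       = (\<Sum>i\<in>S. \<Sum>j\<in>S. of_bool ({i, j} \<in> G) - ?b i - ?b j + of_bool (i = j) * (2 * ?b i))"
      by (intro sum.cong refl) (auto simp: interaction_def singleton_notin_graph[OF G])
    also have "\<dots> = (\<Sum>i\<in>S. (\<Sum>j\<in>S. of_bool ({i, j} \<in> G)) - real (card S) * ?b i - (\<Sum>j\<in>S. ?b j) + 2 * ?b i)"
    proof (rule sum.cong[OF refl])
      fix i assume "i \<in> S"
      then have "(\<Sum>j\<in>S. of_bool (i = j) * (2 * ?b i)) = 2 * ?b i"
        using S by (simp add: sum_distrib_right[symmetric] of_bool_def)
      then show "(\<Sum>j\<in>S. of_bool ({i, j} \<in> G) - ?b i - ?b j + of_bool (i = j) * (2 * ?b i))
         = (\<Sum>j\<in>S. of_bool ({i, j} \<in> G)) - real (card S) * ?b i - (\<Sum>j\<in>S. ?b j) + 2 * ?b i"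
        unfolding sum.distrib sum_subtractf by simp
    qed
    also have "\<dots> = 2 * real (card {e\<in>G. e \<subseteq> S}) - 2 * (real (card S) - 1) * (\<Sum>i\<in>S. ?b i)"
      unfolding sum.distrib sum_subtractf sum_sum_adjacency[OF G S] sum_distrib_left[symmetric]
      by (simp add: algebra_simps)
    finally show ?thesis unfolding quad_def by (simp add: algebra_simps)
  qed
  define S where "S = first_obs n t \<pi>"
  let ?C = "{1..n} - S"
  have S: "S \<subseteq> {1..n}" "finite S" unfolding S_def by (rule first_obs_subset) simp
  have card: "real (card ?C) = real n - real t" "real (card S) = real t"
  proof -
    have c: "card ?C = n - t" unfolding S_def by (rule card_first_obs_compl[OF pi t])
    then show "real (card ?C) = real n - real t" using t by (simp add: of_nat_diff)
    have "card ?C = n - card S" using S by (subst card_Diff_subset) auto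
    moreover have "card S \<le> n" using card_mono[OF _ S(1)] by simp
    ultimately show "real (card S) = real t" using c t by simp
  qed
  have R1: "R1 G \<pi> t = real (card {e\<in>G. e \<subseteq> S})"
    unfolding R1_def S_def first_obs_def using G
    by (intro arg_cong[where f = real] arg_cong[where f = card]) (fastforce simp: graph_on_def)
  have R2: "R2 G \<pi> t = real (card {e\<in>G. e \<subseteq> ?C})"
    unfolding R2_def S_def first_obs_def using G
    by (intro arg_cong[where f = real] arg_cong[where f = card]) (fastforce simp: graph_on_def not_le)
  \<comment> \<open>Vanishing row sums allow both indices to be moved from the complement into
    \<open>S\<close>, each at the cost of a sign.\<close>
  have quadC: "quad ?C = quad S"
  proof -
    have "(\<Sum>i\<in>?C. \<Sum>j\<in>?C. interaction n G i j) = (\<Sum>j\<in>?C. - (\<Sum>i\<in>S. interaction n G i j))"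
      using S by (subst sum.swap) (intro sum.cong refl sum_compl_of_sum_zero row_sum, auto)
    also have "\<dots> = - (\<Sum>i\<in>S. \<Sum>j\<in>?C. interaction n G i j)" by (subst sum.swap) (simp add: sum_negf)
    also have "\<dots> = - (\<Sum>i\<in>S. - (\<Sum>j\<in>S. interaction n G j i))"
    proof (rule arg_cong[where f = uminus], rule sum.cong[OF refl])
      fix i assume "i \<in> S"
      then show "(\<Sum>j\<in>?C. interaction n G i j) = - (\<Sum>j\<in>S. interaction n G j i)"
        using S sum_compl_of_sum_zero[OF row_sum S(1), of i] by (auto simp: sym[of i])
    qed
    also have "\<dots> = (\<Sum>i\<in>S. \<Sum>j\<in>S. interaction n G i j)" by (simp add: sum_negf sym)
    finally show ?thesis by (simp add: quad_def)
  qed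
  have bC: "(\<Sum>i\<in>?C. ?b i) = real (card G) / (real n - 1) - (\<Sum>i\<in>S. ?b i)"
    using sum_main_effect[OF G n] S by (simp add: sum_diff)
  have "Rw n G \<pi> t = pw n t * (quad S + (real t - 1) * (\<Sum>i\<in>S. ?b i))
      + qw n t * (quad S + (real n - real t - 1) * (real (card G) / (real n - 1) - (\<Sum>i\<in>S. ?b i)))"
    unfolding Rw_def R1 R2 edges[OF S(2)] edges[OF finite_Diff[OF finite_atLeastAtMost]] card quadC bC ..
  also have "\<dots> = (pw n t + qw n t) * quad S + (pw n t * (real t - 1) - qw n t * (real n - real t - 1)) * (\<Sum>i\<in>S. ?b i)
      + qw n t * (real n - real t - 1) * (real (card G) / (real n - 1))"
  proof -
    have "p * (W + x * y) + q * (W + z * (B - y)) = (p + q) * W + (p * x - q * z) * y + q * z * B" for p q W x y z B :: real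
      by (simp add: algebra_simps)
    then show ?thesis .
  qed
  also have "pw n t + qw n t = 1" using n unfolding pw_def qw_def add_divide_distrib[symmetric] by simp
  \<comment> \<open>The weights are proportional to \<open>n - t - 1\<close> and
    \<open>t - 1\<close>, which are exactly the partner counts in the respective other
    group.\<close>
  also have "pw n t * (real t - 1) - qw n t * (real n - real t - 1) = 0"
    unfolding pw_def qw_def by simp
  also have "qw n t * (real n - real t - 1) = (real t - 1) * (real n - real t - 1) / (real n - 2)"
    unfolding qw_def by simp
  finally show ?thesis by (simp add: S_def)
qed

lemma Zw_eq_std_quad:
  assumes G: "graph_on n G" and n: "3 \<le> n" and pi: "\<pi> \<in> perms n" and t: "t \<le> n"
  shows "Zw n G \<pi> t = degenerate_kernel.std_quad n (interaction n G) t \<pi>"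
proof -
  interpret degenerate_kernel n "interaction n G" by (rule degenerate_kernel_interaction[OF G n])
  define C where "C = (real t - 1) * (real n - real t - 1) / (real n - 2) * (real (card G) / (real n - 1))"
  have R: "Rw n G \<sigma> t = quad (first_obs n t \<sigma>) + C" if "\<sigma> \<in> perms n" for \<sigma>
    unfolding C_def by (rule Rw_eq_quad[OF G n that t])
  have E: "perm_exp n (\<lambda>\<sigma>. Rw n G \<sigma> t) = C"
  proof -
    have "perm_exp n (\<lambda>\<sigma>. Rw n G \<sigma> t) = perm_exp n (\<lambda>\<sigma>. quad (first_obs n t \<sigma>) + C)"
      by (rule perm_exp_cong[OF R])
    then show ?thesis by (simp add: perm_exp_add perm_exp_quad[OF t])
  qed
  have "perm_var n (\<lambda>\<sigma>. Rw n G \<sigma> t) = perm_exp n (\<lambda>\<sigma>. (quad (first_obs n t \<sigma>))\<^sup>2)"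
    unfolding perm_var_def E by (rule perm_exp_cong) (simp add: R)
  then show ?thesis unfolding Zw_def E std_quad_def sd_def by (simp add: R[OF pi])
qed

section \<open>Norms of the interaction kernel in terms of the degrees\<close>

lemma square_sum_le: "(x + y)\<^sup>2 \<le> 2 * x\<^sup>2 + 2 * y\<^sup>2" for x y :: real
  using zero_le_power2[of "x - y"] by (simp add: power2_eq_square algebra_simps)

context
  fixes n :: nat and G :: "nat set set" and davg D2 :: real
  assumes G: "graph_on n G" and n: "4 \<le> n"
  defines "davg \<equiv> 2 * real (card G) / real n"
    and "D2 \<equiv> \<Sum>i=1..n. real (degree G i) ^ 2"
begin

text \<open>The last bound, Cauchy-Schwarz for the degrees, lets squares of the average degree be
  absorbed into the sum of squared degrees.\<close>

lemma davg_bounds: "0 \<le> davg" "davg \<le> real n" "real n * davg\<^sup>2 \<le> D2"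
proof -
  show "0 \<le> davg" by (simp add: davg_def)
  have sum: "(\<Sum>i\<in>{1..n}. real (degree G i)) = real n * davg" using sum_degree[OF G] n by (simp add: davg_def)
  have "(\<Sum>i\<in>{1..n}. real (degree G i)) \<le> (\<Sum>i\<in>{1..n}. real n)" by (intro sum_mono degree_le[OF G])
  then have "real n * davg \<le> real n * real n" unfolding sum by simp
  then show "davg \<le> real n" using n by simp
  have "(real n * davg)\<^sup>2 \<le> D2 * real n"
    using sum_squared_le_sum_of_squares[of "\<lambda>i. real (degree G i)" "{1..n}"] unfolding sum by (simp add: D2_def)
  then have "real n * (real n * davg\<^sup>2) \<le> real n * D2" by (simp add: power2_eq_square algebra_simps)
  then show "real n * davg\<^sup>2 \<le> D2" using n by simp
qed

lemma main_effect_square_le: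
  "(main_effect n G i)\<^sup>2 \<le> 8 / (real n)\<^sup>2 * ((real (degree G i))\<^sup>2 + davg\<^sup>2)"
proof -
  have n': "real n / 2 \<le> real n - 2" "0 < real n / 2" "real n / 2 \<le> real n - 1" using n by auto
  have "real (card G) / (real n - 1) \<le> real (card G) / (real n / 2)" using n' by (intro divide_left_mono) auto
  also have "\<dots> = davg" by (simp add: davg_def)
  finally have "real (card G) / (real n - 1) \<le> davg" .
  then have "\<bar>real (degree G i) - real (card G) / (real n - 1)\<bar> \<le> real (degree G i) + davg"
  proof -
    have "0 \<le> real (card G) / (real n - 1)" using n' by simp
    with \<open>real (card G) / (real n - 1) \<le> davg\<close> show ?thesis by linarith
  qed
  then have "\<bar>main_effect n G i\<bar> \<le> (real (degree G i) + davg) / (real n / 2)"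
    unfolding main_effect_def abs_divide using n' davg_bounds(1) by (intro frac_le) auto
  then have "\<bar>main_effect n G i\<bar>\<^sup>2 \<le> ((real (degree G i) + davg) / (real n / 2))\<^sup>2" by (rule power_mono) simp
  also have "\<dots> = 4 / (real n)\<^sup>2 * (real (degree G i) + davg)\<^sup>2"
    unfolding power_divide by simp
  also have "\<dots> \<le> 4 / (real n)\<^sup>2 * (2 * (real (degree G i))\<^sup>2 + 2 * davg\<^sup>2)"
    by (intro mult_left_mono square_sum_le) simp
  finally show ?thesis by (simp add: algebra_simps)
qed

lemma sum_main_effect_square_le: "(\<Sum>i\<in>{1..n}. (main_effect n G i)\<^sup>2) \<le> 16 * D2 / (real n)\<^sup>2"
proof -
  have "(\<Sum>i\<in>{1..n}. (main_effect n G i)\<^sup>2) \<le> (\<Sum>i\<in>{1..n}. 8 / (real n)\<^sup>2 * ((real (degree G i))\<^sup>2 + davg\<^sup>2))"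
    by (intro sum_mono main_effect_square_le)
  also have "\<dots> = 8 / (real n)\<^sup>2 * (D2 + real n * davg\<^sup>2)"
    unfolding sum_distrib_left[symmetric] sum.distrib D2_def by simp
  also have "\<dots> \<le> 8 / (real n)\<^sup>2 * (D2 + D2)" using davg_bounds(3) by (intro mult_left_mono) auto
  finally show ?thesis by simp
qed

lemma degree_square_sum_le: "D2 \<le> (real n)\<^sup>2 * davg"
proof -
  have "D2 \<le> (\<Sum>i\<in>{1..n}. real n * real (degree G i))"
    unfolding D2_def using degree_le[OF G] by (intro sum_mono) (auto simp: power2_eq_square intro: mult_right_mono)
  also have "\<dots> = (real n)\<^sup>2 * davg"
    unfolding sum_distrib_left[symmetric] sum_degree[OF G] using n by (simp add: davg_def power2_eq_square)
  finally show ?thesis .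
qed

lemma row_norm_interaction_le:
  assumes v: "v \<in> {1..n}"
  shows "degenerate_kernel.row_norm n (interaction n G) v \<le> 72 * (real (degree G v) + davg)"
proof -
  interpret degenerate_kernel n "interaction n G" using degenerate_kernel_interaction[OF G] n by simp
  let ?b = "main_effect n G"
  have "row_norm v \<le> (\<Sum>i\<in>{1..n}. 3 * (of_bool ({v, i} \<in> G) + (?b i)\<^sup>2 + (?b v)\<^sup>2))"
    unfolding row_norm_def
  proof (rule sum_mono)
    fix i
    let ?a = "of_bool ({v, i} \<in> G) :: real"
    have "(x - y - z)\<^sup>2 \<le> 3 * (x\<^sup>2 + y\<^sup>2 + z\<^sup>2)" for x y z :: real
      using zero_le_power2[of "x + y"] zero_le_power2[of "x + z"] zero_le_power2[of "y - z"]
      by (simp add: power2_eq_square algebra_simps)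
    from this[of ?a "?b i" "?b v"]
    have "(?a - ?b i - ?b v)\<^sup>2 \<le> 3 * (?a\<^sup>2 + (?b i)\<^sup>2 + (?b v)\<^sup>2)" .
    moreover have "?a\<^sup>2 = ?a" by simp
    ultimately show "(interaction n G i v)\<^sup>2 \<le> 3 * (?a + (?b i)\<^sup>2 + (?b v)\<^sup>2)"
      by (auto simp: interaction_def insert_commute)
  qed
  also have "\<dots> = 3 * (real (degree G v) + (\<Sum>i\<in>{1..n}. (?b i)\<^sup>2) + real n * (?b v)\<^sup>2)"
    unfolding sum_distrib_left[symmetric] sum.distrib sum_adjacency_degree[OF G v] by simp
  also have "\<dots> \<le> 3 * (real (degree G v) + 16 * davg + 8 * (real (degree G v) + davg))"
  proof (intro mult_left_mono add_mono order_refl)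
    have "(\<Sum>i\<in>{1..n}. (?b i)\<^sup>2) \<le> 16 * D2 / (real n)\<^sup>2" by (rule sum_main_effect_square_le)
    also have "\<dots> \<le> 16 * ((real n)\<^sup>2 * davg) / (real n)\<^sup>2"
      using degree_square_sum_le by (intro divide_right_mono) auto
    finally show "(\<Sum>i\<in>{1..n}. (?b i)\<^sup>2) \<le> 16 * davg" using n by simp
    have "real n * (?b v)\<^sup>2 \<le> real n * (8 / (real n)\<^sup>2 * ((real (degree G v))\<^sup>2 + davg\<^sup>2))"
      by (intro mult_left_mono main_effect_square_le) simp
    also have "\<dots> \<le> real n * (8 / (real n)\<^sup>2 * (real n * real (degree G v) + real n * davg))"
      using degree_le[OF G v] davg_bounds
      by (intro mult_left_mono add_mono) (auto simp: power2_eq_square intro: mult_right_mono)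
    also have "\<dots> = 8 * (real (degree G v) + davg)" using n by (simp add: power2_eq_square field_simps)
    finally show "real n * (?b v)\<^sup>2 \<le> 8 * (real (degree G v) + davg)" .
  qed simp
  \<comment> \<open>The sum is 27 times the degree plus 72 times \<open>davg\<close>; the larger
    coefficient is used for both.\<close>
  also have "\<dots> \<le> 72 * (real (degree G v) + davg)" using davg_bounds by simp
  finally show ?thesis .
qed

lemma sum_row_norm_square_interaction_le:
  "(\<Sum>v\<in>{1..n}. (degenerate_kernel.row_norm n (interaction n G) v)\<^sup>2) \<le> 20736 * D2"
proof -
  interpret degenerate_kernel n "interaction n G" using degenerate_kernel_interaction[OF G] n by simp
  have "(\<Sum>v\<in>{1..n}. (row_norm v)\<^sup>2) \<le> (\<Sum>v\<in>{1..n}. 5184 * (2 * (real (degree G v))\<^sup>2 + 2 * davg\<^sup>2))"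
  proof (rule sum_mono)
    fix v assume "v \<in> {1..n}"
    then have "(row_norm v)\<^sup>2 \<le> (72 * (real (degree G v) + davg))\<^sup>2"
      by (intro power_mono row_norm_interaction_le row_norm_nonneg)
    also have "\<dots> = 5184 * (real (degree G v) + davg)\<^sup>2" by (simp only: power_mult_distrib) simp
    also have "\<dots> \<le> 5184 * (2 * (real (degree G v))\<^sup>2 + 2 * davg\<^sup>2)" by (intro mult_left_mono square_sum_le) simp
    finally show "(row_norm v)\<^sup>2 \<le> 5184 * (2 * (real (degree G v))\<^sup>2 + 2 * davg\<^sup>2)" .
  qed
  also have "\<dots> = 10368 * (D2 + real n * davg\<^sup>2)"
    unfolding sum_distrib_left[symmetric] sum.distrib D2_def by simp
  also have "\<dots> \<le> 10368 * (D2 + D2)" using davg_bounds(3) by simp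
  finally show ?thesis by simp
qed

text \<open>Off the diagonal, \<open>(a - b)\<^sup>2 \<ge> a\<^sup>2 / 2 - b\<^sup>2\<close>
  separates the adjacency indicator from the main effects; on it, the lower bound is at most 0.
  Ordered pairs count every edge twice, which cancels the one half.\<close>

lemma total_norm_interaction_ge:
  "real (card G) - 64 * D2 / real n \<le> degenerate_kernel.total_norm n (interaction n G)"
proof -
  interpret degenerate_kernel n "interaction n G" using degenerate_kernel_interaction[OF G] n by simp
  let ?b = "main_effect n G"
  have "{e\<in>G. e \<subseteq> {1..n}} = G" using G by (auto simp: graph_on_def)
  then have a: "(\<Sum>v\<in>{1..n}. \<Sum>i\<in>{1..n}. of_bool ({v, i} \<in> G)) = 2 * real (card G)"
    using sum_sum_adjacency[OF G, of "{1..n}"] by simp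
  have "real (card G) - 4 * real n * (\<Sum>i\<in>{1..n}. (?b i)\<^sup>2)
     = (\<Sum>v\<in>{1..n}. \<Sum>i\<in>{1..n}. of_bool ({v, i} \<in> G) / 2 - 2 * (?b i)\<^sup>2 - 2 * (?b v)\<^sup>2)"
    unfolding sum_subtractf sum_divide_distrib[symmetric] sum_distrib_left[symmetric] a by (simp add: sum_distrib_left sum_negf mult.assoc)
  also have "\<dots> \<le> (\<Sum>v\<in>{1..n}. \<Sum>i\<in>{1..n}. (interaction n G i v)\<^sup>2)"
  proof (intro sum_mono)
    fix v i
    let ?a = "of_bool ({v, i} \<in> G) :: real"
    have a2: "?a\<^sup>2 = ?a" by simp
    show "?a / 2 - 2 * (?b i)\<^sup>2 - 2 * (?b v)\<^sup>2 \<le> (interaction n G i v)\<^sup>2"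
    proof (cases "i = v")
      case True
      then show ?thesis by (simp add: singleton_notin_graph[OF G] interaction_def)
    next
      case False
      have "?a\<^sup>2 \<le> 2 * (?a - ?b i - ?b v)\<^sup>2 + 2 * (?b i + ?b v)\<^sup>2"
        using square_sum_le[of "?a - ?b i - ?b v" "?b i + ?b v"] by simp
      then have "?a / 2 - (?b i + ?b v)\<^sup>2 \<le> (?a - ?b i - ?b v)\<^sup>2" unfolding a2 by linarith
      moreover have "(?b i + ?b v)\<^sup>2 \<le> 2 * (?b i)\<^sup>2 + 2 * (?b v)\<^sup>2" by (rule square_sum_le)
      ultimately show ?thesis using False by (simp add: interaction_def insert_commute)
    qed
  qed
  also have "\<dots> = total_norm" by (simp add: total_norm_def row_norm_def)
  finally have "real (card G) - 4 * real n * (\<Sum>i\<in>{1..n}. (?b i)\<^sup>2) \<le> total_norm" .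
  moreover have "4 * real n * (\<Sum>i\<in>{1..n}. (?b i)\<^sup>2) \<le> 4 * real n * (16 * D2 / (real n)\<^sup>2)"
    by (intro mult_left_mono sum_main_effect_square_le) simp
  moreover have "4 * real n * (16 * D2 / (real n)\<^sup>2) = 64 * D2 / real n" using n by (simp add: power2_eq_square)
  ultimately show ?thesis by linarith
qed

end

section \<open>Tightness\<close>

lemma step_path_in_Dspace:
  fixes f :: "nat \<Rightarrow> real"
  shows "(\<lambda>u. if a \<le> u \<and> u \<le> b then f (nat \<lfloor>real n * u\<rfloor>) else 0) \<in> Dspace a b"
proof -
  let ?x = "\<lambda>u. if a \<le> u \<and> u \<le> b then f (nat \<lfloor>real n * u\<rfloor>) else 0"
  have "(?x \<longlongrightarrow> ?x t) (at_right t)" if t: "t \<in> {a..b}" "t < b" for t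
  proof (rule tendsto_eventually)
    define c where "c = (if n = 0 then b else min b ((of_int \<lfloor>real n * t\<rfloor> + 1) / real n))"
    have "real n * t < of_int \<lfloor>real n * t\<rfloor> + 1" by linarith
    then have "n \<noteq> 0 \<Longrightarrow> t < (of_int \<lfloor>real n * t\<rfloor> + 1) / real n"
      by (simp add: pos_less_divide_eq mult.commute)
    then have "t < c" using t(2) by (simp add: c_def)
    then have "\<forall>\<^sub>F s in at_right t. s \<in> {t<..<c}" by (rule eventually_at_right_real)
    then show "\<forall>\<^sub>F s in at_right t. ?x s = ?x t"
    proof (rule eventually_mono)
      fix s assume s: "s \<in> {t<..<c}"
      have "\<lfloor>real n * s\<rfloor> = \<lfloor>real n * t\<rfloor>"
      proof (cases "n = 0")
        case False
        have "s < (of_int \<lfloor>real n * t\<rfloor> + 1) / real n" using s False by (simp add: c_def)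
        then have "real n * s < of_int \<lfloor>real n * t\<rfloor> + 1"
          using False by (simp add: pos_less_divide_eq mult.commute)
        moreover have "real n * t \<le> real n * s" using s by (intro mult_left_mono) auto
        then have "of_int \<lfloor>real n * t\<rfloor> \<le> real n * s" using of_int_floor_le[of "real n * t"] by linarith
        ultimately show ?thesis by (intro floor_unique)
      qed simp
      moreover have "a \<le> s" "s \<le> b" using s t by (auto simp: c_def split: if_splits)
      ultimately show "?x s = ?x t" using t by simp
    qed
  qed
  moreover have "\<exists>l. (?x \<longlongrightarrow> l) (at_left t)" if t: "t \<in> {a..b}" "a < t" for t
  proof (rule exI, rule tendsto_eventually)
    \<comment> \<open>Just to the left of \<open>t\<close>, the floor of \<open>n * s\<close> is
      constantly the ceiling of \<open>n * t\<close> minus 1, including when \<open>n * t\<close> is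
      an integer and the path jumps at \<open>t\<close>.\<close>
    define c where "c = (if n = 0 then a else max a ((of_int \<lceil>real n * t\<rceil> - 1) / real n))"
    have "of_int \<lceil>real n * t\<rceil> - 1 < real n * t" by linarith
    then have "n \<noteq> 0 \<Longrightarrow> (of_int \<lceil>real n * t\<rceil> - 1) / real n < t"
      by (simp add: pos_divide_less_eq mult.commute)
    then have "c < t" using t(2) by (simp add: c_def)
    then have "\<forall>\<^sub>F s in at_left t. s \<in> {c<..<t}" by (rule eventually_at_left_real)
    then show "\<forall>\<^sub>F s in at_left t. ?x s = (if n = 0 then f 0 else f (nat (\<lceil>real n * t\<rceil> - 1)))"
    proof (rule eventually_mono)
      fix s assume s: "s \<in> {c<..<t}"
      have "\<lfloor>real n * s\<rfloor> = \<lceil>real n * t\<rceil> - 1" if "n \<noteq> 0"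
      proof -
        have "(of_int \<lceil>real n * t\<rceil> - 1) / real n < s" using s that by (simp add: c_def)
        then have "of_int \<lceil>real n * t\<rceil> - 1 < real n * s"
          using that by (simp add: pos_divide_less_eq mult.commute)
        moreover have "real n * s < real n * t" using s that by simp
        then have "real n * s < of_int \<lceil>real n * t\<rceil>" using le_of_int_ceiling[of "real n * t"] by linarith
        ultimately show ?thesis by (intro floor_unique) simp_all
      qed
      moreover have "a \<le> s" "s \<le> b" using s t by (auto simp: c_def split: if_splits)
      ultimately show "?x s = (if n = 0 then f 0 else f (nat (\<lceil>real n * t\<rceil> - 1)))" by simp
    qed
  qed
  ultimately have "cadlag_on a b ?x" unfolding cadlag_on_def by blast
  then show ?thesis by (auto simp: Dspace_def)
qed

lemma Zw_path_in_Dspace: "Zw_path n G \<epsilon> \<pi> \<in> Dspace \<epsilon> (1 - \<epsilon>)"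
  unfolding Zw_path_def by (rule step_path_in_Dspace)

lemma sum_half_powers_le:
  fixes \<eta> :: real
  assumes "0 \<le> \<eta>" and J: "finite J"
  shows "(\<Sum>j\<in>J. \<eta> / 2 ^ Suc j) \<le> \<eta>"
proof -
  have s: "(\<lambda>j. \<eta> * (1/2) ^ Suc j) sums (\<eta> * 1)" by (rule sums_mult[OF power_half_series])
  have "(\<Sum>j\<in>J. \<eta> / 2 ^ Suc j) = (\<Sum>j\<in>J. \<eta> * (1/2) ^ Suc j)" by (simp add: power_one_over)
  also have "\<dots> \<le> (\<Sum>j. \<eta> * (1/2) ^ Suc j)"
    by (rule sum_le_suminf[OF sums_summable[OF s] J]) (use assms(1) in auto)
  also have "\<dots> = \<eta>" using sums_unique[OF s] by simp
  finally show ?thesis .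
qed

text \<open>Since the jumps of the processes vanish in the limit, tightness can be obtained from finite
  nets with respect to the supremum distance.\<close>
lemma tight_if_finite_nets:
  fixes X :: "nat \<Rightarrow> (nat \<Rightarrow> nat) \<Rightarrow> real \<Rightarrow> real"
  assumes ab: "a \<le> b" and X: "\<And>n \<pi>. \<pi> \<in> perms n \<Longrightarrow> X n \<pi> \<in> Dspace a b"
    and net: "\<And>e \<rho>. 0 < e \<Longrightarrow> 0 < \<rho> \<Longrightarrow> \<exists>T N. finite T \<and>
      (\<forall>n\<ge>N. perm_prob n (\<lambda>\<pi>. \<not> (\<exists>y\<in>T. \<forall>t\<in>{a..b}. \<bar>X n \<pi> t - y t\<bar> \<le> e)) \<le> \<rho>)"
    and \<eta>: "0 < \<eta>"
  shows "\<exists>K. K \<subseteq> Dspace a b \<and> compactin (skorokhod_topology a b) K \<and>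
      (\<forall>n. perm_prob n (\<lambda>\<pi>. X n \<pi> \<in> K) \<ge> 1 - \<eta>)"
proof -
  define near where "near e T x \<longleftrightarrow> (\<exists>y\<in>T. \<forall>t\<in>{a..b}. \<bar>x t - y t\<bar> \<le> e)" for e T and x :: "real \<Rightarrow> real"
  have "\<exists>T. finite T \<and> (\<forall>n. perm_prob n (\<lambda>\<pi>. \<not> near e T (X n \<pi>)) \<le> \<rho>)" if pos: "0 < e" "0 < \<rho>" for e \<rho>
  proof -
    obtain T N where T: "finite T" "\<And>n. N \<le> n \<Longrightarrow> perm_prob n (\<lambda>\<pi>. \<not> near e T (X n \<pi>)) \<le> \<rho>"
      using net[OF pos] unfolding near_def by blast
    \<comment> \<open>The finitely many early processes take finitely many paths in all, so adding
      these paths makes the net serve every \<open>n\<close>.\<close>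
    define T' where "T' = T \<union> (\<Union>n\<in>{..<N}. X n ` perms n)"
    have "finite T'" unfolding T'_def using T(1) finite_perms by auto
    moreover have "perm_prob n (\<lambda>\<pi>. \<not> near e T' (X n \<pi>)) \<le> \<rho>" for n
    proof (cases "N \<le> n")
      case True
      have "perm_prob n (\<lambda>\<pi>. \<not> near e T' (X n \<pi>)) \<le> perm_prob n (\<lambda>\<pi>. \<not> near e T (X n \<pi>))"
        by (rule perm_prob_mono) (auto simp: near_def T'_def)
      then show ?thesis using T(2)[OF True] by linarith
    next
      case False
      have "near e T' (X n \<pi>)" if "\<pi> \<in> perms n" for \<pi>
        unfolding near_def
      proof (rule bexI)
        show "X n \<pi> \<in> T'" using that False by (auto simp: T'_def)
      qed (use pos in simp)
      then have "perm_prob n (\<lambda>\<pi>. \<not> near e T' (X n \<pi>)) \<le> perm_prob n (\<lambda>\<pi>. False)"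
        by (intro perm_prob_mono) auto
      then show ?thesis using pos by (simp add: perm_prob_def)
    qed
    ultimately show ?thesis by blast
  qed
  then have "\<forall>j. \<exists>T. finite T \<and> (\<forall>n. perm_prob n (\<lambda>\<pi>. \<not> near (1 / real (Suc j)) T (X n \<pi>)) \<le> \<eta> / 2 ^ Suc j)"
    using \<eta> by simp
  then obtain T where T: "\<And>j. finite (T j)"
    "\<And>j n. perm_prob n (\<lambda>\<pi>. \<not> near (1 / real (Suc j)) (T j) (X n \<pi>)) \<le> \<eta> / 2 ^ Suc j"
    by metis
  define F where "F = {x \<in> Dspace a b. \<forall>j. near (1 / real (Suc j)) (T j) x}"
  have "\<exists>T. finite T \<and> (\<forall>x\<in>F. \<exists>y\<in>T. \<forall>t\<in>{a..b}. \<bar>x t - y t\<bar> \<le> e)" if e: "0 < e" for e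
  proof -
    obtain j where j: "1 / real (Suc j) < e" using nat_approx_posE[OF e] by metis
    have "\<exists>y\<in>T j. \<forall>t\<in>{a..b}. \<bar>x t - y t\<bar> \<le> e" if "x \<in> F" for x
    proof -
      have "near (1 / real (Suc j)) (T j) x" using that by (simp add: F_def)
      then obtain y where y: "y \<in> T j" "\<forall>t\<in>{a..b}. \<bar>x t - y t\<bar> \<le> 1 / real (Suc j)"
        unfolding near_def by blast
      then have "\<forall>t\<in>{a..b}. \<bar>x t - y t\<bar> \<le> e" using j by (meson less_imp_le order_trans)
      then show ?thesis using y(1) by blast
    qed
    then show ?thesis using T(1)[of j] by blast
  qed
  then obtain K where K: "F \<subseteq> K" "K \<subseteq> Dspace a b" "compactin (skorokhod_topology a b) K"
    using uniformly_totally_bounded_subset_compactin_skorokhod[OF ab, of F] by (auto simp: F_def)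
  have "1 - \<eta> \<le> perm_prob n (\<lambda>\<pi>. X n \<pi> \<in> K)" for n
  proof -
    define bad where "bad \<pi> j \<longleftrightarrow> \<not> near (1 / real (Suc j)) (T j) (X n \<pi>)" for \<pi> j
    \<comment> \<open>A union over all levels would be infinite. Recording only the least failing
      level leaves finitely many values, because there are finitely many permutations.\<close>
    define J where "J = (\<lambda>\<pi>. LEAST j. bad \<pi> j) ` perms n"
    have J: "finite J" unfolding J_def using finite_perms by simp
    have "perm_prob n (\<lambda>\<pi>. \<not> X n \<pi> \<in> K) \<le> perm_prob n (\<lambda>\<pi>. \<exists>j\<in>J. bad \<pi> j)"
    proof (rule perm_prob_mono)
      fix \<pi> assume pi: "\<pi> \<in> perms n" "\<not> X n \<pi> \<in> K"
      then have "X n \<pi> \<notin> F" using K(1) by blast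
      then have "\<exists>j. bad \<pi> j" using X[OF pi(1)] by (auto simp: F_def bad_def)
      then have "bad \<pi> (LEAST j. bad \<pi> j)" by (rule LeastI_ex)
      then show "\<exists>j\<in>J. bad \<pi> j" using pi(1) unfolding J_def by blast
    qed
    also have "\<dots> \<le> (\<Sum>j\<in>J. perm_prob n (\<lambda>\<pi>. bad \<pi> j))" by (rule perm_prob_UN[OF J])
    also have "\<dots> \<le> (\<Sum>j\<in>J. \<eta> / 2 ^ Suc j)" unfolding bad_def by (intro sum_mono T(2))
    also have "\<dots> \<le> \<eta>" using sum_half_powers_le[OF _ J] \<eta> by simp
    finally show ?thesis unfolding perm_prob_not by simp
  qed
  then show ?thesis using K by blast
qed

text \<open>Values at the grid points are rounded down to multiples of \<open>e\<close>, of which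
  finitely many are relevant below the bound \<open>M\<close>. Rounding and oscillation within a
  cell each contribute an error \<open>e\<close>.\<close>

lemma finite_net_of_step_functions:
  fixes idx :: "real \<Rightarrow> nat" and u :: "nat \<Rightarrow> real"
  assumes e: "0 < e" and idx: "\<And>t. t \<in> {a..b} \<Longrightarrow> idx t \<le> m"
  shows "\<exists>T. finite T \<and> (\<forall>x :: real \<Rightarrow> real. (\<forall>i\<le>m. \<bar>x (u i)\<bar> \<le> M) \<and> (\<forall>t\<in>{a..b}. \<bar>x t - x (u (idx t))\<bar> \<le> e) \<longrightarrow>
     (\<exists>y\<in>T. \<forall>t\<in>{a..b}. \<bar>x t - y t\<bar> \<le> 2 * e))"
proof -
  define V where "V = (\<lambda>z::int. e * of_int z) ` {\<lfloor>- M / e\<rfloor>..\<lfloor>M / e\<rfloor>}"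
  define T where "T = (\<lambda>h t. h (idx t)) ` PiE {..m} (\<lambda>_. V)"
  have "finite T" unfolding T_def V_def by (intro finite_imageI finite_PiE) auto
  moreover have "\<exists>y\<in>T. \<forall>t\<in>{a..b}. \<bar>x t - y t\<bar> \<le> 2 * e"
    if x: "\<forall>i\<le>m. \<bar>x (u i)\<bar> \<le> M" "\<forall>t\<in>{a..b}. \<bar>x t - x (u (idx t))\<bar> \<le> e" for x :: "real \<Rightarrow> real"
  proof
    define h where "h = restrict (\<lambda>i. e * of_int \<lfloor>x (u i) / e\<rfloor>) {..m}"
    show "(\<lambda>t. h (idx t)) \<in> T" unfolding T_def
    proof (rule imageI)
      show "h \<in> PiE {..m} (\<lambda>_. V)" unfolding h_def
      proof (rule restrict_PiE_iff[THEN iffD2], rule ballI)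
        fix i assume "i \<in> {..m}"
        then have "\<bar>x (u i)\<bar> \<le> M" using x(1) by simp
        then have "- M \<le> x (u i)" "x (u i) \<le> M" by linarith+
        then have "- M / e \<le> x (u i) / e" "x (u i) / e \<le> M / e" using e by (simp_all only: divide_right_mono less_imp_le)
        then have "\<lfloor>- M / e\<rfloor> \<le> \<lfloor>x (u i) / e\<rfloor>" "\<lfloor>x (u i) / e\<rfloor> \<le> \<lfloor>M / e\<rfloor>" by (auto intro: floor_mono)
        then show "e * of_int \<lfloor>x (u i) / e\<rfloor> \<in> V" unfolding V_def by auto
      qed
    qed
    show "\<forall>t\<in>{a..b}. \<bar>x t - h (idx t)\<bar> \<le> 2 * e"
    proof
      fix t assume t: "t \<in> {a..b}"
      let ?v = "x (u (idx t))"
      have "h (idx t) = e * of_int \<lfloor>?v / e\<rfloor>" using idx[OF t] by (simp add: h_def)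
      moreover have "e * of_int \<lfloor>?v / e\<rfloor> \<le> e * (?v / e)" using e by (intro mult_left_mono) auto
      moreover have "e * (?v / e) \<le> e * (of_int \<lfloor>?v / e\<rfloor> + 1)"
        using e by (intro mult_left_mono) (auto intro: less_imp_le)
      moreover have "\<bar>x t - ?v\<bar> \<le> e" using x(2) t by blast
      ultimately show "\<bar>x t - h (idx t)\<bar> \<le> 2 * e" using e by (simp add: distrib_left)
    qed
  qed
  ultimately show ?thesis by blast
qed

lemma eventually_kernel_norms:
  fixes G :: "nat \<Rightarrow> nat set set" and k :: "nat \<Rightarrow> real" and \<gamma> :: real
  assumes graphs: "\<And>n. graph_on n (G n)"
    and edges: "(\<lambda>n. real (card (G n))) \<in> \<Theta>(\<lambda>n. k n * real n)"
    and k_lower: "(\<lambda>n. 1::real) \<in> O(k)"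
    and deg: "(\<lambda>n. \<Sum>i=1..n. real (degree (G n) i) ^ 2) \<in> o(\<lambda>n. k n * real n ^ 2)"
    and \<gamma>: "0 < \<gamma>"
  shows "\<forall>\<^sub>F n in sequentially. 0 < degenerate_kernel.total_norm n (interaction n (G n)) \<and>
    (\<Sum>v\<in>{1..n}. (degenerate_kernel.row_norm n (interaction n (G n)) v)\<^sup>2)
      / (degenerate_kernel.total_norm n (interaction n (G n)))\<^sup>2 \<le> \<gamma>"
proof -
  have "(\<lambda>n. real (card (G n))) \<in> \<Omega>(\<lambda>n. k n * real n)" using edges by (rule bigthetaD2)
  then obtain c where c: "c > 0" "\<forall>\<^sub>F n in sequentially. c * norm (k n * real n) \<le> norm (real (card (G n)))"
    by (auto elim: landau_omega.bigE)
  obtain d where d: "d > 0" "\<forall>\<^sub>F n in sequentially. norm (1::real) \<le> d * norm (k n)"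
    using landau_o.bigE[OF k_lower] by blast
  \<comment> \<open>The bound 1 / 128 makes \<open>64 * D2 / n\<close> at most half of the edge
    count, leaving the other half as a lower bound for \<open>total_norm\<close>. The second bound
    makes the final ratio at most \<gamma>; the quotient \<open>d / c\<close> comes from
    \<open>c / d * n \<le> card G\<close>, where the lower bound on \<open>k\<close> is used.
    Absolute values appear because \<open>k\<close> carries no sign assumption.\<close>
  define \<tau> where "\<tau> = min (1 / 128) (\<gamma> * c / d / 82944)"
  have \<tau>: "0 < \<tau>" "\<tau> \<le> 1 / 128" "\<tau> \<le> \<gamma> * c / d / 82944" using \<gamma> c d by (auto simp: \<tau>_def)
  have "0 < \<tau> * c" using \<tau> c by simp
  then have sm: "\<forall>\<^sub>F n in sequentially. norm (\<Sum>i=1..n. real (degree (G n) i) ^ 2) \<le> \<tau> * c * norm (k n * real n ^ 2)"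
    by (rule landau_o.smallD[OF deg])
  show ?thesis using c(2) d(2) sm eventually_ge_at_top[of 4]
  proof eventually_elim
    case (elim n)
    interpret degenerate_kernel n "interaction n (G n)"
      using degenerate_kernel_interaction[OF graphs] elim(4) by simp
    define D2 where "D2 = (\<Sum>i=1..n. real (degree (G n) i) ^ 2)"
    define m where "m = real (card (G n))"
    have D20: "0 \<le> D2" unfolding D2_def by (intro sum_nonneg) simp
    have n: "0 < real n" "4 \<le> n" using elim(4) by auto
    have k: "1 / d \<le> \<bar>k n\<bar>" "0 < \<bar>k n\<bar>" using elim(2) d(1) by (auto simp: field_simps)
    have m: "c * (\<bar>k n\<bar> * real n) \<le> m" using elim(1) by (simp add: m_def abs_mult)
    have "c * (1 / d * real n) \<le> c * (\<bar>k n\<bar> * real n)"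
      using c k n by (intro mult_left_mono mult_right_mono) auto
    then have m': "c / d * real n \<le> m" using m by simp
    have mpos: "0 < m" using m' c d n by (auto intro: less_le_trans[of 0 "c / d * real n"])
    have "D2 \<le> \<tau> * (c * (\<bar>k n\<bar> * real n)) * real n"
      using elim(3) D20 unfolding D2_def[symmetric] by (simp add: abs_mult power2_eq_square mult.assoc)
    also have "\<dots> \<le> \<tau> * m * real n" using m \<tau> n by (intro mult_right_mono mult_left_mono) auto
    finally have D2: "D2 \<le> \<tau> * m * real n" .
    have "D2 \<le> 1 / 128 * m * real n" by (rule order_trans[OF D2]) (use \<tau> mpos n in \<open>intro mult_right_mono, auto\<close>)
    then have "64 * D2 / real n \<le> m / 2" using n by (simp add: field_simps)
    then have A: "m / 2 \<le> total_norm"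
      using total_norm_interaction_ge[OF graphs n(2)] unfolding D2_def[symmetric] m_def[symmetric] by linarith
    have "(\<Sum>v\<in>{1..n}. (row_norm v)\<^sup>2) / total_norm\<^sup>2 \<le> (20736 * D2) / (m / 2)\<^sup>2"
      using sum_row_norm_square_interaction_le[OF graphs n(2)] A mpos D20 unfolding D2_def[symmetric]
      by (intro frac_le power_mono) auto
    also have "\<dots> \<le> (20736 * (\<tau> * m * real n)) / (m / 2)\<^sup>2" using D2 by (intro divide_right_mono) auto
    also have "\<dots> = 82944 * \<tau> * (real n / m)" using mpos by (simp add: power2_eq_square field_simps)
    also have "\<dots> \<le> 82944 * \<tau> * (d / c)"
      using m' c d \<tau> mpos by (intro mult_left_mono) (auto simp: field_simps)
    also have "\<dots> \<le> 82944 * (\<gamma> * c / d / 82944) * (d / c)"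
      using \<tau> c d by (intro mult_right_mono mult_left_mono) auto
    also have "\<dots> = \<gamma>" using c d by simp
    finally show ?case using A mpos by simp
  qed
qed

lemma perm_prob_Zw_path_irregular_le:
  fixes G :: "nat set set" and \<epsilon> e M :: real and m :: nat
  assumes G: "graph_on n G" and eps: "0 < \<epsilon>" "\<epsilon> < 1/2" and e: "0 < e" and M: "0 < M" and m: "0 < m"
    and n: "4 \<le> n" "m \<le> n" "4 / \<epsilon> \<le> real n"
    and A: "0 < degenerate_kernel.total_norm n (interaction n G)"
    and \<Gamma>: "(\<Sum>v\<in>{1..n}. (degenerate_kernel.row_norm n (interaction n G) v)\<^sup>2)
      / (degenerate_kernel.total_norm n (interaction n G))\<^sup>2 \<le> \<gamma>"
  defines "u \<equiv> \<lambda>i. \<epsilon> + real i * ((1 - 2 * \<epsilon>) / real m)"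
    and "idx \<equiv> \<lambda>t. nat \<lfloor>(t - \<epsilon>) / ((1 - 2 * \<epsilon>) / real m)\<rfloor>"
    and "C1 \<equiv> 45056 / ((\<epsilon> / 2) ^ 16 * e ^ 4) + 64 / (e\<^sup>2 * (\<epsilon> / 2)\<^sup>2)"
    and "C2 \<equiv> 67584 / ((\<epsilon> / 2) ^ 15 * e ^ 4)"
  shows "perm_prob n (\<lambda>\<pi>. \<not> ((\<forall>i\<le>m. \<bar>Zw_path n G \<epsilon> \<pi> (u i)\<bar> \<le> M) \<and>
      (\<forall>t\<in>{\<epsilon>..1 - \<epsilon>}. \<bar>Zw_path n G \<epsilon> \<pi> t - Zw_path n G \<epsilon> \<pi> (u (idx t))\<bar> \<le> e)))
    \<le> 4 * C1 / real m + 2 * C2 * \<gamma> + (real m + 1) / M\<^sup>2"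
proof -
  interpret degenerate_kernel n "interaction n G" using degenerate_kernel_interaction[OF G] n by simp
  define h where "h = (1 - 2 * \<epsilon>) / real m"
  \<comment> \<open>Half of \<epsilon> is sacrificed to absorb the rounding of times and the shifts
    by 1; \<open>4 / \<epsilon> \<le> n\<close> makes \<open>\<beta> * n\<close> at least 2, which
    is enough.\<close>
  define \<beta> where "\<beta> = \<epsilon> / 2"
  \<comment> \<open>A cell covers at most \<open>n / m\<close> time units plus one for rounding, and
    that one is at most \<open>n / m\<close> as well.\<close>
  define \<delta> where "\<delta> = 2 / real m"
  define s where "s i = nat \<lfloor>real n * u i\<rfloor>" for i
  define J where "J i = s (Suc i) - s i" for i
  have h: "0 < h" "real m * h = 1 - 2 * \<epsilon>" "h \<le> 1 / real m" using eps m by (auto simp: h_def divide_right_mono)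
  have \<beta>: "0 < \<beta>" "\<beta> \<le> 1" and \<delta>: "0 < \<delta>" using eps m by (auto simp: \<beta>_def \<delta>_def)
  have \<beta>n: "2 \<le> \<beta> * real n" "real n * \<epsilon> = 2 * (\<beta> * real n)" using n(3) eps by (simp_all add: \<beta>_def field_simps)
  have u_mono: "u i \<le> u j" if "i \<le> j" for i j
    unfolding u_def h_def[symmetric] using that h by (intro add_left_mono mult_right_mono) auto
  have um: "u m = 1 - \<epsilon>" "u 0 = \<epsilon>" "u (Suc i) = u i + h" for i
    unfolding u_def h_def[symmetric] by (simp_all add: h distrib_right)
  have ub: "\<epsilon> \<le> u i" "i \<le> m \<Longrightarrow> u i \<le> 1 - \<epsilon>" for i
    using u_mono[of 0 i] u_mono[of i m] um by auto
  have fl: "nat \<lfloor>real n * t\<rfloor> \<le> n" "real (nat \<lfloor>real n * t\<rfloor>) \<le> real n * t" "real n * t - 1 < real (nat \<lfloor>real n * t\<rfloor>)"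
    if "0 \<le> t" "t \<le> 1" for t
  proof -
    have "0 \<le> real n * t" using that by simp
    then have r: "real (nat \<lfloor>real n * t\<rfloor>) = of_int \<lfloor>real n * t\<rfloor>" by simp
    show 1: "real (nat \<lfloor>real n * t\<rfloor>) \<le> real n * t" unfolding r by (rule of_int_floor_le)
    show "real n * t - 1 < real (nat \<lfloor>real n * t\<rfloor>)" unfolding r by linarith
    have "real n * t \<le> real n" using that by (simp add: mult_left_le)
    then show "nat \<lfloor>real n * t\<rfloor> \<le> n" using 1 by linarith
  qed
  have s_mono: "s i \<le> s j" if "i \<le> j" for i j
    unfolding s_def using u_mono[OF that] by (intro nat_mono floor_mono mult_left_mono) auto
  have sJ: "s i + J i = s (Suc i)" for i using s_mono[of i "Suc i"] by (simp add: J_def)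
  have path: "Zw_path n G \<epsilon> \<pi> t = std_quad (nat \<lfloor>real n * t\<rfloor>) \<pi>" if "\<pi> \<in> perms n" "t \<in> {\<epsilon>..1 - \<epsilon>}" for \<pi> t
  proof -
    have "nat \<lfloor>real n * t\<rfloor> \<le> n" using that eps by (intro fl(1)) auto
    then show ?thesis using Zw_eq_std_quad[OF G _ that(1)] n(1) that(2) by (simp add: Zw_path_def)
  qed
  have idx: "idx t \<le> m" "u (idx t) \<le> t" "t < u (Suc (idx t))" if t: "t \<in> {\<epsilon>..1 - \<epsilon>}" for t
  proof -
    have "0 \<le> (t - \<epsilon>) / h" using t h by simp
    then have r: "real (idx t) = of_int \<lfloor>(t - \<epsilon>) / h\<rfloor>" unfolding idx_def h_def[symmetric] by simp
    have "real (idx t) \<le> (t - \<epsilon>) / h" unfolding r by (rule of_int_floor_le)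
    then have 1: "real (idx t) * h \<le> t - \<epsilon>" using h by (simp add: pos_le_divide_eq)
    then show "u (idx t) \<le> t" unfolding u_def h_def[symmetric] by simp
    have "real (idx t) * h \<le> real m * h" using 1 t h by simp
    then have "real (idx t) \<le> real m" by (rule mult_right_le_imp_le) (rule h(1))
    then show "idx t \<le> m" by simp
    have "(t - \<epsilon>) / h < real (idx t) + 1" unfolding r by linarith
    then have "t - \<epsilon> < (real (idx t) + 1) * h" using h by (simp add: pos_divide_less_eq)
    then show "t < u (Suc (idx t))" unfolding u_def h_def[symmetric] by (simp add: add.commute)
  qed
  have cell: "perm_prob n (\<lambda>\<pi>. \<exists>j\<le>J i. e < \<bar>std_quad (s i + j) \<pi> - std_quad (s i) \<pi>\<bar>) \<le> C1 * \<delta>\<^sup>2 + C2 * \<delta> * \<gamma>"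
    if i: "i < m" for i
  proof -
    have 01: "0 \<le> u i" "u i \<le> 1" "0 \<le> u (Suc i)" "u (Suc i) \<le> 1 - \<epsilon>" "u (Suc i) \<le> 1"
      using ub(1)[of i] ub(2)[of i] ub(1)[of "Suc i"] ub(2)[of "Suc i"] i eps by auto
    have "real n * \<epsilon> \<le> real n * u i" using ub(1)[of i] by (intro mult_left_mono) auto
    then have s1: "\<beta> * real n \<le> real (s i) - 1" using fl(3)[OF 01(1,2)] \<beta>n unfolding s_def by linarith
    have "real n * u (Suc i) \<le> real n * (1 - \<epsilon>)" using 01 by (intro mult_left_mono) auto
    also have "\<dots> = real n - real n * \<epsilon>" by (simp add: right_diff_distrib)
    finally have "real n * u (Suc i) \<le> real n - real n * \<epsilon>" .
    then have s2: "\<beta> * real n \<le> real n - real (s i + J i) - 1"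
      using fl(2)[OF 01(3,5)] \<beta>n unfolding sJ unfolding s_def by linarith
    have "real (J i) = real (s (Suc i)) - real (s i)" using s_mono[of i "Suc i"] by (simp add: J_def of_nat_diff)
    also have "\<dots> \<le> real n * u (Suc i) - (real n * u i - 1)"
      using fl(2)[OF 01(3,5)] fl(3)[OF 01(1,2)] unfolding s_def by linarith
    also have "\<dots> = real n * h + 1" unfolding um(3) by (simp add: distrib_left)
    also have "\<dots> \<le> real n * (1 / real m) + real n * (1 / real m)"
      using h(3) n m by (intro add_mono mult_left_mono) (auto simp: field_simps)
    finally have s3: "real (J i) \<le> \<delta> * real n" by (simp add: \<delta>_def)
    have "perm_prob n (\<lambda>\<pi>. \<exists>j\<le>J i. e < \<bar>std_quad (s i + j) \<pi> - std_quad (s i) \<pi>\<bar>)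
       \<le> C1 * \<delta>\<^sup>2 + C2 * \<delta> * ((\<Sum>v\<in>{1..n}. (row_norm v)\<^sup>2) / total_norm\<^sup>2)"
      using perm_prob_std_quad_osc_le[OF n(1) A \<beta> e s1 s2 s3 \<delta>] unfolding C1_def C2_def \<beta>_def .
    also have "\<dots> \<le> C1 * \<delta>\<^sup>2 + C2 * \<delta> * \<gamma>"
      using \<delta> eps e by (intro add_left_mono mult_left_mono[OF \<Gamma>]) (auto simp: C2_def)
    finally show ?thesis .
  qed
  have "perm_prob n (\<lambda>\<pi>. \<not> ((\<forall>i\<le>m. \<bar>Zw_path n G \<epsilon> \<pi> (u i)\<bar> \<le> M) \<and>
      (\<forall>t\<in>{\<epsilon>..1 - \<epsilon>}. \<bar>Zw_path n G \<epsilon> \<pi> t - Zw_path n G \<epsilon> \<pi> (u (idx t))\<bar> \<le> e)))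
    \<le> perm_prob n (\<lambda>\<pi>. (\<exists>i\<in>{..<m}. \<exists>j\<le>J i. e < \<bar>std_quad (s i + j) \<pi> - std_quad (s i) \<pi>\<bar>) \<or>
        (\<exists>i\<in>{..m}. M \<le> \<bar>std_quad (s i) \<pi>\<bar>))"
  proof (rule perm_prob_mono)
    fix \<pi>
    assume pi: "\<pi> \<in> perms n" and bad: "\<not> ((\<forall>i\<le>m. \<bar>Zw_path n G \<epsilon> \<pi> (u i)\<bar> \<le> M) \<and>
      (\<forall>t\<in>{\<epsilon>..1 - \<epsilon>}. \<bar>Zw_path n G \<epsilon> \<pi> t - Zw_path n G \<epsilon> \<pi> (u (idx t))\<bar> \<le> e))"
    have pu: "Zw_path n G \<epsilon> \<pi> (u i) = std_quad (s i) \<pi>" if "i \<le> m" for i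
      unfolding s_def using ub that by (intro path[OF pi]) auto
    from bad consider i where "i \<le> m" "M < \<bar>Zw_path n G \<epsilon> \<pi> (u i)\<bar>"
      | t where "t \<in> {\<epsilon>..1 - \<epsilon>}" "e < \<bar>Zw_path n G \<epsilon> \<pi> t - Zw_path n G \<epsilon> \<pi> (u (idx t))\<bar>"
      by (meson not_le)
    then show "(\<exists>i\<in>{..<m}. \<exists>j\<le>J i. e < \<bar>std_quad (s i + j) \<pi> - std_quad (s i) \<pi>\<bar>) \<or>
        (\<exists>i\<in>{..m}. M \<le> \<bar>std_quad (s i) \<pi>\<bar>)"
    proof cases
      case 1
      then show ?thesis using pu by (auto intro!: bexI[of _ i])
    next
      case 2
      note t = idx[OF 2(1)]
      \<comment> \<open>Index \<open>m\<close> occurs only at the right end point, which is itself a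
        grid point and so shows no oscillation. Only the \<open>m\<close> genuine cells
        remain.\<close>
      have "idx t \<noteq> m"
      proof
        assume "idx t = m"
        then have "t = u m" using t(2) um(1) 2(1) by auto
        then show False using 2(2) \<open>idx t = m\<close> e by simp
      qed
      then have im: "idx t < m" using t(1) by simp
      define r where "r = nat \<lfloor>real n * t\<rfloor>"
      have "s (idx t) \<le> r" "r \<le> s (Suc (idx t))" unfolding s_def r_def
        using t by (auto intro!: nat_mono floor_mono mult_left_mono)
      then have "r = s (idx t) + (r - s (idx t))" "r - s (idx t) \<le> J (idx t)" by (auto simp: J_def)
      moreover have "e < \<bar>std_quad r \<pi> - std_quad (s (idx t)) \<pi>\<bar>"
        using 2(2) path[OF pi 2(1)] pu[OF t(1)] unfolding r_def by simp
      ultimately show ?thesis using im by (metis lessThan_iff)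
    qed
  qed
  also have "\<dots> \<le> perm_prob n (\<lambda>\<pi>. \<exists>i\<in>{..<m}. \<exists>j\<le>J i. e < \<bar>std_quad (s i + j) \<pi> - std_quad (s i) \<pi>\<bar>)
      + perm_prob n (\<lambda>\<pi>. \<exists>i\<in>{..m}. M \<le> \<bar>std_quad (s i) \<pi>\<bar>)"
    by (rule perm_prob_disj)
  also have "\<dots> \<le> (\<Sum>i\<in>{..<m}. perm_prob n (\<lambda>\<pi>. \<exists>j\<le>J i. e < \<bar>std_quad (s i + j) \<pi> - std_quad (s i) \<pi>\<bar>))
      + (\<Sum>i\<in>{..m}. perm_prob n (\<lambda>\<pi>. M \<le> \<bar>std_quad (s i) \<pi>\<bar>))"
    by (intro add_mono perm_prob_UN) auto
  also have "\<dots> \<le> (\<Sum>i\<in>{..<m}. C1 * \<delta>\<^sup>2 + C2 * \<delta> * \<gamma>) + (\<Sum>i\<in>{..m}. 1 / M\<^sup>2)"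
    using cell perm_prob_std_quad_le[OF M] by (intro add_mono sum_mono) auto
  also have "\<dots> = 4 * C1 / real m + 2 * C2 * \<gamma> + (real m + 1) / M\<^sup>2"
    using m by (simp add: \<delta>_def power2_eq_square distrib_left add_divide_distrib)
  finally show ?thesis .
qed

theorem theorem3p1:
  fixes G :: "nat \<Rightarrow> nat set set" and k :: "nat \<Rightarrow> real" and \<epsilon> :: real
  assumes graphs: "\<And>n. graph_on n (G n)"
    and edges: "(\<lambda>n. real (card (G n))) \<in> \<Theta>(\<lambda>n. k n * real n)"
    and k_lower: "(\<lambda>n. 1::real) \<in> O(k)"
    and deg: "(\<lambda>n. \<Sum>i=1..n. real (degree (G n) i) ^ 2) \<in> o(\<lambda>n. k n * real n ^ 2)"
    and eps: "0 < \<epsilon>" "\<epsilon> < 1/2"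
  shows "\<forall>\<eta>>0. \<exists>K. K \<subseteq> Dspace \<epsilon> (1 - \<epsilon>)
            \<and> compactin (skorokhod_topology \<epsilon> (1 - \<epsilon>)) K
            \<and> (\<forall>n. perm_prob n (\<lambda>\<pi>. Zw_path n (G n) \<epsilon> \<pi> \<in> K) \<ge> 1 - \<eta>)"
proof (intro allI impI)
  fix \<eta> :: real assume \<eta>: "0 < \<eta>"
  show "\<exists>K. K \<subseteq> Dspace \<epsilon> (1 - \<epsilon>) \<and> compactin (skorokhod_topology \<epsilon> (1 - \<epsilon>)) K
      \<and> (\<forall>n. perm_prob n (\<lambda>\<pi>. Zw_path n (G n) \<epsilon> \<pi> \<in> K) \<ge> 1 - \<eta>)"
  proof (rule tight_if_finite_nets[OF _ Zw_path_in_Dspace _ \<eta>])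
    show "\<epsilon> \<le> 1 - \<epsilon>" using eps by simp
    fix e \<rho> :: real assume e: "0 < e" and \<rho>: "0 < \<rho>"
    define e' where "e' = e / 2"
    have e': "0 < e'" using e by (simp add: e'_def)
    define C1 where "C1 = 45056 / ((\<epsilon> / 2) ^ 16 * e' ^ 4) + 64 / (e'\<^sup>2 * (\<epsilon> / 2)\<^sup>2)"
    define C2 where "C2 = 67584 / ((\<epsilon> / 2) ^ 15 * e' ^ 4)"
    have C: "0 < C1" "0 < C2" using eps e' by (auto simp: C1_def C2_def intro!: add_pos_pos divide_pos_pos)
    \<comment> \<open>The number of cells, then \<gamma> and \<open>M\<close>, make the three error
      terms at most \<open>\<rho> / 4\<close>, \<open>\<rho> / 4\<close> and
      \<open>\<rho> / 2\<close>. The level \<open>M\<close> must come after \<open>m\<close>, since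
      its cost grows with the number of grid points.\<close>
    obtain m where m: "16 * C1 / \<rho> < real m" using reals_Archimedean2 by blast
    moreover have "0 < 16 * C1 / \<rho>" using C \<rho> by simp
    ultimately have m0: "0 < m" by (metis of_nat_0_less_iff order_less_trans)
    define \<gamma> where "\<gamma> = \<rho> / (8 * C2)"
    define M where "M = sqrt (2 * (real m + 1) / \<rho>)"
    have \<gamma>: "0 < \<gamma>" and M: "0 < M" using C \<rho> by (auto simp: \<gamma>_def M_def)
    define u where "u = (\<lambda>i. \<epsilon> + real i * ((1 - 2 * \<epsilon>) / real m))"
    define idx where "idx = (\<lambda>t. nat \<lfloor>(t - \<epsilon>) / ((1 - 2 * \<epsilon>) / real m)\<rfloor>)"
    have "idx t \<le> m" if "t \<in> {\<epsilon>..1 - \<epsilon>}" for t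
    proof -
      have "(t - \<epsilon>) / ((1 - 2 * \<epsilon>) / real m) \<le> (1 - 2 * \<epsilon>) / ((1 - 2 * \<epsilon>) / real m)"
        using that eps m0 by (intro divide_right_mono) auto
      also have "\<dots> = real m" using eps by simp
      finally show ?thesis unfolding idx_def by linarith
    qed
    from finite_net_of_step_functions[where idx = idx and m = m and a = \<epsilon> and b = "1 - \<epsilon>" and u = u and M = M, OF e' this]
    obtain T where T: "finite T \<and> (\<forall>x :: real \<Rightarrow> real.
        (\<forall>i\<le>m. \<bar>x (u i)\<bar> \<le> M) \<and> (\<forall>t\<in>{\<epsilon>..1 - \<epsilon>}. \<bar>x t - x (u (idx t))\<bar> \<le> e') \<longrightarrow>
        (\<exists>y\<in>T. \<forall>t\<in>{\<epsilon>..1 - \<epsilon>}. \<bar>x t - y t\<bar> \<le> 2 * e'))" ..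
    have e2: "2 * e' = e" by (simp add: e'_def)
    obtain N where N: "\<And>n. N \<le> n \<Longrightarrow> 0 < degenerate_kernel.total_norm n (interaction n (G n)) \<and>
      (\<Sum>v\<in>{1..n}. (degenerate_kernel.row_norm n (interaction n (G n)) v)\<^sup>2)
        / (degenerate_kernel.total_norm n (interaction n (G n)))\<^sup>2 \<le> \<gamma>"
      using eventually_kernel_norms[OF graphs edges k_lower deg \<gamma>] unfolding eventually_sequentially by blast
    obtain N' where N': "4 / \<epsilon> < real N'" using reals_Archimedean2 by blast
    have "perm_prob n (\<lambda>\<pi>. \<not> (\<exists>y\<in>T. \<forall>t\<in>{\<epsilon>..1 - \<epsilon>}. \<bar>Zw_path n (G n) \<epsilon> \<pi> t - y t\<bar> \<le> e)) \<le> \<rho>"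
      if n: "max (max N N') (max 4 m) \<le> n" for n
    proof -
      have n': "4 \<le> n" "m \<le> n" "4 / \<epsilon> \<le> real n" "N \<le> n" using n N' by auto
      have "perm_prob n (\<lambda>\<pi>. \<not> (\<exists>y\<in>T. \<forall>t\<in>{\<epsilon>..1 - \<epsilon>}. \<bar>Zw_path n (G n) \<epsilon> \<pi> t - y t\<bar> \<le> e))
        \<le> perm_prob n (\<lambda>\<pi>. \<not> ((\<forall>i\<le>m. \<bar>Zw_path n (G n) \<epsilon> \<pi> (u i)\<bar> \<le> M) \<and>
          (\<forall>t\<in>{\<epsilon>..1 - \<epsilon>}. \<bar>Zw_path n (G n) \<epsilon> \<pi> t - Zw_path n (G n) \<epsilon> \<pi> (u (idx t))\<bar> \<le> e')))"
        using T unfolding e2 by (intro perm_prob_mono) blast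
      also have "\<dots> \<le> 4 * C1 / real m + 2 * C2 * \<gamma> + (real m + 1) / M\<^sup>2"
        unfolding u_def idx_def C1_def C2_def using N[OF n'(4)]
        by (intro perm_prob_Zw_path_irregular_le[OF graphs eps e' M m0 n'(1-3)]) auto
      also have "\<dots> \<le> \<rho> / 4 + \<rho> / 4 + \<rho> / 2"
      proof (intro add_mono)
        show "4 * C1 / real m \<le> \<rho> / 4" using m m0 \<rho> by (simp add: field_simps)
        show "2 * C2 * \<gamma> \<le> \<rho> / 4" using C by (simp add: \<gamma>_def)
        have "M\<^sup>2 = 2 * (real m + 1) / \<rho>" using \<rho> by (simp add: M_def)
        moreover have "q / (2 * q / \<rho>) = \<rho> / 2" if "0 < q" for q :: real using that by simp
        from this[of "real m + 1"] have "(real m + 1) / (2 * (real m + 1) / \<rho>) = \<rho> / 2" by simp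
        ultimately show "(real m + 1) / M\<^sup>2 \<le> \<rho> / 2" by (simp only: order_refl)
      qed
      finally show ?thesis by simp
    qed
    then show "\<exists>T N. finite T \<and> (\<forall>n\<ge>N. perm_prob n (\<lambda>\<pi>. \<not> (\<exists>y\<in>T. \<forall>t\<in>{\<epsilon>..1 - \<epsilon>}. \<bar>Zw_path n (G n) \<epsilon> \<pi> t - y t\<bar> \<le> e)) \<le> \<rho>)"
      using T by blast
  qed
qed

end
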